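(* Let $A=KQ_n/I$ be a Nakayama algebra with $I=\langle g_1,\dots,g_k\rangle$, and let $s\in\mathcal{S}$ be a non-projective simple module. Then: (1) $\mathrm{pd}(s)=1$ if and only if $s$ is not a hook. (2) $\mathrm{pd}(s)=2$ if and only if $s$ is a hook and its denouement belongs to $\mathscr{X}_A$ (that is, $s=h(g_i)$ for some $i$ and $d(g_i)\in\mathscr{X}_A$). (3) $\mathrm{gld}(A)\ge 3$ if and only if $\bigcup_{i\neq j}\,[Hod(g_i)\cap Int(g_j)]\neq\emptyset$.
   Context: $K$ is an algebraically closed field and $n\ge 2$. $Q_n$ denotes either the linear quiver $A_n$ with vertices $1,\dots,n$ and arrows $\alpha_j:j\to j+1$ ($1\le j\le n-1$), or the cyclic quiver $\widetilde{A}_n$ with vertices $1,\dots,n$ and arrows $\alpha_j:j\to j+1$ ($1\le j\le n-1$) and $\alpha_n:n\to 1$. A Nakayama algebra means a finite-dimensional algebra $A=KQ_n/I$ with $I$ an admissible two-sided ideal; $I$ is generated by a minimal set of paths, and writing $I=\langle g_1,\dots,g_k\rangle$ always means that $\{g_1,\dots,g_k\}$ is this minimal set of paths. Vertices are read modulo $n$ in the cyclic case. Paths compose from right to left, and modules are such that the indecomposable projective $P(j)$ with top $j$ is uniserial with composition factors $j,j+1,j+2,\dots$ from top to socle. The simple module at vertex $x$ is denoted by $x$, and $\mathcal{S}$ is the set of all simple $A$-modules, i.e. of vertices. $\mathrm{pd}$ is projective dimension and $\mathrm{gld}$ is global dimension. Length of a path means number of arrows plus $1$. For a path $g=\alpha_{d(g)-1}\cdots\alpha_{h(g)}$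 of length $\ell_g\ge 3$, its origin vertex $h(g)$ is the hook of $g$ and its end vertex $d(g)=h(g)+\ell_g-1$ is the denouement of $g$. $Hod(g)$ is the multiset $\{h(g),h(g)+1,\dots,d(g)\}$ of the $\ell_g$ vertices visited by $g$, and $Int(g)$ is the multiset obtained from $Hod(g)$ by removing the first and last entries $h(g)$ and $d(g)$ (one occurrence each). A simple module is called a hook if it equals $h(g_i)$ for some generator $g_i$. The set $\mathscr{X}_A$ is $\mathcal{S}\setminus\bigcup_{i=1}^k Int(g_i)$.
   Formalization: Part (3) is stated only when it is not the case that k=1 and the single generator has length greater than n+1 (possible only on the cyclic quiver); there gld(A)≥3 although the union over i≠j is empty, so (3) as written fails, e.g. n=2, I=⟨α₁α₂α₁⟩. *)

theory Defs
  imports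
    "HOL-Computational_Algebra.Polynomial"
    "HOL-Library.Multiset"
    "HOL-Library.Extended_Nat"
    "Graph_Theory.Arc_Walk"
    "HOL-Algebra.Algebra"
begin

section \<open>Left modules over a ring that need not be commutative\<close>

text \<open>HOL-Algebra's locale \<open>module\<close> requires a commutative ring; its record type and its locale
  \<open>submodule\<close> do not.\<close>

locale left_module = R?: ring R + M?: abelian_group M
  for R :: "('a, 'm) ring_scheme" (structure) and M :: "('a, 'b, 'n) module_scheme" (structure) +
  assumes smult_closed:
      "\<lbrakk>a \<in> carrier R; x \<in> carrier M\<rbrakk> \<Longrightarrow> a \<odot>\<^bsub>M\<^esub> x \<in> carrier M"
    and smult_l_distr:
      "\<lbrakk>a \<in> carrier R; b \<in> carrier R; x \<in> carrier M\<rbrakk> \<Longrightarrow>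
       (a \<oplus>\<^bsub>R\<^esub> b) \<odot>\<^bsub>M\<^esub> x = a \<odot>\<^bsub>M\<^esub> x \<oplus>\<^bsub>M\<^esub> b \<odot>\<^bsub>M\<^esub> x"
    and smult_r_distr:
      "\<lbrakk>a \<in> carrier R; x \<in> carrier M; y \<in> carrier M\<rbrakk> \<Longrightarrow>
       a \<odot>\<^bsub>M\<^esub> (x \<oplus>\<^bsub>M\<^esub> y) = a \<odot>\<^bsub>M\<^esub> x \<oplus>\<^bsub>M\<^esub> a \<odot>\<^bsub>M\<^esub> y"
    and smult_assoc:
      "\<lbrakk>a \<in> carrier R; b \<in> carrier R; x \<in> carrier M\<rbrakk> \<Longrightarrow>
       (a \<otimes>\<^bsub>R\<^esub> b) \<odot>\<^bsub>M\<^esub> x = a \<odot>\<^bsub>M\<^esub> (b \<odot>\<^bsub>M\<^esub> x)"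
    and smult_one: "x \<in> carrier M \<Longrightarrow> \<one>\<^bsub>R\<^esub> \<odot>\<^bsub>M\<^esub> x = x"

definition left_module_hom ::
  "('a, 'm) ring_scheme \<Rightarrow> ('a, 'b) module \<Rightarrow> ('a, 'c) module \<Rightarrow> ('b \<Rightarrow> 'c) set" where
  "left_module_hom R M N =
     {f \<in> carrier M \<rightarrow> carrier N.
        (\<forall>x\<in>carrier M. \<forall>y\<in>carrier M. f (x \<oplus>\<^bsub>M\<^esub> y) = f x \<oplus>\<^bsub>N\<^esub> f y) \<and>
        (\<forall>a\<in>carrier R. \<forall>x\<in>carrier M. f (a \<odot>\<^bsub>M\<^esub> x) = a \<odot>\<^bsub>N\<^esub> f x)}"

definition fg_left_module :: "('a, 'm) ring_scheme \<Rightarrow> ('a, 'b) module \<Rightarrow> bool" where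
  "fg_left_module R M \<longleftrightarrow> left_module R M \<and>
     (\<exists>B. finite B \<and> B \<subseteq> carrier M \<and> (\<forall>H. submodule H R M \<and> B \<subseteq> H \<longrightarrow> H = carrier M))"

definition simple_left_module :: "('a, 'm) ring_scheme \<Rightarrow> ('a, 'b) module \<Rightarrow> bool" where
  "simple_left_module R S \<longleftrightarrow> left_module R S \<and> carrier S \<noteq> {\<zero>\<^bsub>S\<^esub>} \<and>
     (\<forall>H. submodule H R S \<longrightarrow> H = {\<zero>\<^bsub>S\<^esub>} \<or> H = carrier S)"

section \<open>Projective and global dimension\<close>

text \<open>Homological notions quantify over modules, and in HOL the elements of all these modules must
  come from one type. The type \<open>nat \<Rightarrow> 'a\<close> is large enough for every ring with elements
  in \<open>'a\<close>: it contains each free module \<open>R^m\<close> (as functions vanishing on \<open>{m..}\<close>) and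
  hence, choosing representatives, an isomorphic copy of each finitely generated module.\<close>

type_synonym 'a lmod = "('a, nat \<Rightarrow> 'a) module"

definition projective_module :: "('a, 'm) ring_scheme \<Rightarrow> 'a lmod \<Rightarrow> bool" where
  "projective_module R P \<longleftrightarrow> left_module R P \<and>
     (\<forall>(M :: 'a lmod) (N :: 'a lmod) f g.
        left_module R M \<and> left_module R N \<and>
        f \<in> left_module_hom R M N \<and> f ` carrier M = carrier N \<and> g \<in> left_module_hom R P N \<longrightarrow>
        (\<exists>h\<in>left_module_hom R P M. \<forall>x\<in>carrier P. f (h x) = g x))"

text \<open>\<open>\<cdots> \<rightarrow> P 2 \<rightarrow> P 1 \<rightarrow> P 0 \<rightarrow> M \<rightarrow> 0\<close> with differentials \<open>d i : P (Suc i) \<rightarrow> P i\<close> and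
  augmentation \<open>e\<close>, inside the category of finitely generated modules.\<close>

definition projective_resolution ::
  "('a, 'm) ring_scheme \<Rightarrow> 'a lmod \<Rightarrow> (nat \<Rightarrow> 'a lmod) \<Rightarrow>
   (nat \<Rightarrow> (nat \<Rightarrow> 'a) \<Rightarrow> (nat \<Rightarrow> 'a)) \<Rightarrow> ((nat \<Rightarrow> 'a) \<Rightarrow> (nat \<Rightarrow> 'a)) \<Rightarrow> bool" where
  "projective_resolution R M P d e \<longleftrightarrow>
     (\<forall>i. fg_left_module R (P i) \<and> projective_module R (P i)) \<and>
     (\<forall>i. d i \<in> left_module_hom R (P (Suc i)) (P i)) \<and>
     e \<in> left_module_hom R (P 0) M \<and>
     e ` carrier (P 0) = carrier M \<and>
     d 0 ` carrier (P 1) = a_kernel (P 0) M e \<and>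
     (\<forall>i. d (Suc i) ` carrier (P (Suc (Suc i))) = a_kernel (P (Suc i)) (P i) (d i))"

text \<open>The infimum of the empty set is \<open>\<infinity>\<close>.\<close>

definition proj_dim :: "('a, 'm) ring_scheme \<Rightarrow> 'a lmod \<Rightarrow> enat" where
  "proj_dim R M =
     Inf {enat l | l. \<exists>P d e. projective_resolution R M P d e \<and>
                              (\<forall>i>l. carrier (P i) = {\<zero>\<^bsub>P i\<^esub>})}"

definition gl_dim :: "('a, 'm) ring_scheme \<Rightarrow> enat" where
  "gl_dim R = Sup {proj_dim R M | M :: 'a lmod. fg_left_module R M}"

section \<open>Path algebras\<close>

text \<open>A quiver is a multi-digraph. A path is a pair of its origin vertex and the list of its arrows
  in the order in which they are traversed; the pair \<open>(x, [])\<close> is the trivial path at \<open>x\<close>.\<close>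

type_synonym ('v, 'e) qpath = "'v \<times> 'e list"

definition path_end :: "('v, 'e) pre_digraph \<Rightarrow> ('v, 'e) qpath \<Rightarrow> 'v" where
  "path_end Q p = last (pre_digraph.awalk_verts Q (fst p) (snd p))"

definition qpaths :: "('v, 'e) pre_digraph \<Rightarrow> ('v, 'e) qpath set" where
  "qpaths Q = {p. \<exists>v. pre_digraph.awalk Q (fst p) (snd p) v}"

text \<open>Elements are finitely supported functions on paths. Paths compose from right to left, so the
  product \<open>q p\<close> traverses \<open>p\<close> first: the coefficient of \<open>f g\<close> at a path is the sum over all
  ways of splitting it into an initial part, weighted by \<open>g\<close>, and a final part, weighted by
  \<open>f\<close>.\<close>

definition path_algebra :: "('v, 'e) pre_digraph \<Rightarrow> (('v, 'e) qpath \<Rightarrow> 'k::field) ring" where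
  "path_algebra Q =
     \<lparr>carrier = {f. finite {p. f p \<noteq> 0} \<and> {p. f p \<noteq> 0} \<subseteq> qpaths Q},
      mult = (\<lambda>f g p. \<Sum>i\<le>length (snd p).
                f (path_end Q (fst p, take i (snd p)), drop i (snd p)) *
                g (fst p, take i (snd p))),
      one = (\<lambda>p. if fst p \<in> verts Q \<and> snd p = [] then 1 else 0),
      ring.zero = (\<lambda>p. 0),
      add = (\<lambda>f g p. f p + g p)\<rparr>"

definition path_elem :: "('v, 'e) qpath \<Rightarrow> ('v, 'e) qpath \<Rightarrow> 'k::field" where
  "path_elem p = (\<lambda>q. if q = p then 1 else 0)"

definition arrow_ideal :: "('v, 'e) pre_digraph \<Rightarrow> (('v, 'e) qpath \<Rightarrow> 'k::field) set" where
  "arrow_ideal Q = Idl\<^bsub>path_algebra Q\<^esub> (path_elem ` {p \<in> qpaths Q. length (snd p) = 1})"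

primrec ideal_power :: "('a, 'm) ring_scheme \<Rightarrow> 'a set \<Rightarrow> nat \<Rightarrow> 'a set" where
  "ideal_power R J 0 = carrier R"
| "ideal_power R J (Suc m) = ideal_prod R J (ideal_power R J m)"

definition admissible_ideal ::
  "('v, 'e) pre_digraph \<Rightarrow> (('v, 'e) qpath \<Rightarrow> 'k::field) set \<Rightarrow> bool" where
  "admissible_ideal Q I \<longleftrightarrow> ideal I (path_algebra Q) \<and>
     I \<subseteq> ideal_power (path_algebra Q) (arrow_ideal Q) 2 \<and>
     (\<exists>N\<ge>2. ideal_power (path_algebra Q) (arrow_ideal Q) N \<subseteq> I)"

definition minimal_path_generators ::
  "('v, 'e) pre_digraph \<Rightarrow> (('v, 'e) qpath \<Rightarrow> 'k::field) set \<Rightarrow> ('v, 'e) qpath set \<Rightarrow> bool" where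
  "minimal_path_generators Q I G \<longleftrightarrow> G \<subseteq> qpaths Q \<and>
     I = Idl\<^bsub>path_algebra Q\<^esub> (path_elem ` G) \<and>
     (\<forall>G'. G' \<subset> G \<longrightarrow> I \<noteq> Idl\<^bsub>path_algebra Q\<^esub> (path_elem ` G'))"

definition bound_quiver_algebra ::
  "('v, 'e) pre_digraph \<Rightarrow> (('v, 'e) qpath \<Rightarrow> 'k::field) set \<Rightarrow> (('v, 'e) qpath \<Rightarrow> 'k) set ring" where
  "bound_quiver_algebra Q I = path_algebra Q Quot I"

text \<open>\<open>S\<close> is (isomorphic to) the simple module at the vertex \<open>x\<close>, i.e. the simple module on
  which the idempotent of the trivial path at \<open>x\<close> does not act as zero. As the path algebra is
  unital and contains the field, modules over the bound quiver algebra as a ring and as an algebra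
  over the field are the same.\<close>

definition simple_at ::
  "('v, 'e) pre_digraph \<Rightarrow> (('v, 'e) qpath \<Rightarrow> 'k::field) set \<Rightarrow> 'v \<Rightarrow>
   (('v, 'e) qpath \<Rightarrow> 'k) set lmod \<Rightarrow> bool" where
  "simple_at Q I x S \<longleftrightarrow> simple_left_module (bound_quiver_algebra Q I) S \<and>
     (\<exists>v\<in>carrier S. (I +>\<^bsub>path_algebra Q\<^esub> path_elem (x, [])) \<odot>\<^bsub>S\<^esub> v \<noteq> \<zero>\<^bsub>S\<^esub>)"

section \<open>The quivers of Nakayama algebras; hooks and denouements\<close>

text \<open>The arrow \<open>\<alpha>\<^sub>j\<close> is represented by its index \<open>j\<close>.\<close>

definition linear_quiver :: "nat \<Rightarrow> (nat, nat) pre_digraph" where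
  "linear_quiver n = \<lparr>verts = {1..n}, arcs = {1..<n}, tail = (\<lambda>j. j), head = (\<lambda>j. j + 1)\<rparr>"

definition cyclic_quiver :: "nat \<Rightarrow> (nat, nat) pre_digraph" where
  "cyclic_quiver n =
     \<lparr>verts = {1..n}, arcs = {1..n}, tail = (\<lambda>j. j), head = (\<lambda>j. if j = n then 1 else j + 1)\<rparr>"

text \<open>The length of a path is the number of vertices it visits, counted with multiplicity.\<close>

definition path_length :: "('v, 'e) qpath \<Rightarrow> nat" where
  "path_length g = length (snd g) + 1"

definition hook :: "('v, 'e) qpath \<Rightarrow> 'v" where
  "hook g = fst g"

definition denouement :: "('v, 'e) pre_digraph \<Rightarrow> ('v, 'e) qpath \<Rightarrow> 'v" where
  "denouement Q g = path_end Q g"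

definition Hod :: "('v, 'e) pre_digraph \<Rightarrow> ('v, 'e) qpath \<Rightarrow> 'v multiset" where
  "Hod Q g = mset (pre_digraph.awalk_verts Q (fst g) (snd g))"

definition Intr :: "('v, 'e) pre_digraph \<Rightarrow> ('v, 'e) qpath \<Rightarrow> 'v multiset" where
  "Intr Q g = Hod Q g - {#hook g#} - {#denouement Q g#}"

definition X_set :: "('v, 'e) pre_digraph \<Rightarrow> ('v, 'e) qpath set \<Rightarrow> 'v set" where
  "X_set Q G = verts Q - (\<Union>g\<in>G. set_mset (Intr Q g))"

text \<open>Pitfall: on the cyclic quiver a path with more than \<open>n + 1\<close> vertices has its denouement in its
  own interior. If such a path is the only generator, the simple module at its hook has infinite
  projective dimension, although no two distinct generators exist. A criterion for
  \<open>gl_dim \<ge> 3\<close> in terms of pairs of distinct generators must exclude this case.\<close>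

end

theory Submission
  imports Defs
begin

text \<open>Let \<open>P(x)\<close> be the indecomposable projective with top \<open>x\<close> and \<open>l(x)\<close> its length. Submodules
  of \<open>P(x)\<close> are determined by their length, and the one with top \<open>x + i\<close> is the quotient of
  \<open>P(x + i)\<close> of length \<open>l(x) - i\<close>. So the minimal projective resolution of the simple module \<open>x\<close>
  begins with \<open>P(x + l(x)) \<rightarrow> P(x + 1) \<rightarrow> P(x)\<close>; its first syzygy is projective iff
  \<open>l(x + 1) = l(x) - 1\<close>, that is, iff no generator starts at \<open>x\<close>. If \<open>g\<close> starts at \<open>x\<close>, then
  \<open>x + l(x) = d(g)\<close>, and the second syzygy is \<open>P(d(g))\<close> iff no generator starts strictly between
  \<open>x\<close> and \<open>d(g)\<close>; by minimality of the generators this means that \<open>d(g)\<close> is interior to none of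
  them.

  Lower bounds for the projective dimension come from stable retracts: for two projective
  presentations of a module, each syzygy is a retract of the other one up to homomorphisms that
  factor through a projective module. The global dimension is at most \<open>2\<close> if all simple modules
  have projective dimension at most \<open>2\<close>, by extending a finitely generated module one composition
  factor at a time. Finally, if \<open>Hod(g)\<close> meets \<open>Int(g')\<close> for \<open>g \<noteq> g'\<close>, then the two paths overlap,
  and the one that ends first has its denouement inside the other.\<close>

section \<open>Left modules and their homomorphisms\<close>

text \<open>Projective dimension is defined by the existence of some resolution, so an upper bound
  needs one resolution, while a lower bound has to control all of them. Of an arbitrary resolution
  nothing is known, not even that its terms split into copies of the \<open>P(x)\<close>. Stable
  retracts compare syzygies of arbitrary presentations; this is a weak form of Schanuel's lemma that
  needs neither minimality nor Krull-Schmidt.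

  All modules share one element type, so sums and quotients have to be coded: sums by interleaving,
  quotients by representatives. For the same reason composition factors are adjoined to a submodule
  rather than split off as quotients.

  Of the radical of \<open>P(x)\<close> only a dichotomy is used: r e_x lies in R (p x 1) or has a
  left inverse up to e_x, never both. In the path algebra it comes from a geometric series, as the
  arrow ideal is nilpotent modulo \<open>I\<close>.

  In (3) a generator may overlap itself by winding around the cyclic quiver. It then has every
  vertex in its interior, including the hook of any other generator; the length bound excludes a
  lone generator of this kind.\<close>

context left_module
begin

lemma smult_r_null [simp]:
  assumes "a \<in> carrier R" shows "a \<odot>\<^bsub>M\<^esub> \<zero>\<^bsub>M\<^esub> = \<zero>\<^bsub>M\<^esub>"
proof -
  have "a \<odot>\<^bsub>M\<^esub> \<zero>\<^bsub>M\<^esub> \<oplus>\<^bsub>M\<^esub> a \<odot>\<^bsub>M\<^esub> \<zero>\<^bsub>M\<^esub> = a \<odot>\<^bsub>M\<^esub> \<zero>\<^bsub>M\<^esub>"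
    using smult_r_distr[OF assms M.zero_closed M.zero_closed] by simp
  then show ?thesis using smult_closed[OF assms M.zero_closed] by (simp add: M.add.l_cancel_one')
qed

lemma smult_l_null [simp]:
  assumes "x \<in> carrier M" shows "\<zero>\<^bsub>R\<^esub> \<odot>\<^bsub>M\<^esub> x = \<zero>\<^bsub>M\<^esub>"
proof -
  have "\<zero>\<^bsub>R\<^esub> \<odot>\<^bsub>M\<^esub> x \<oplus>\<^bsub>M\<^esub> \<zero>\<^bsub>R\<^esub> \<odot>\<^bsub>M\<^esub> x = \<zero>\<^bsub>R\<^esub> \<odot>\<^bsub>M\<^esub> x"
    using smult_l_distr[OF R.zero_closed R.zero_closed assms] by simp
  then show ?thesis using smult_closed[OF R.zero_closed assms] by (simp add: M.add.l_cancel_one')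
qed

lemma smult_r_minus:
  assumes "a \<in> carrier R" "x \<in> carrier M" shows "a \<odot>\<^bsub>M\<^esub> (\<ominus>\<^bsub>M\<^esub> x) = \<ominus>\<^bsub>M\<^esub> (a \<odot>\<^bsub>M\<^esub> x)"
proof -
  have "a \<odot>\<^bsub>M\<^esub> (\<ominus>\<^bsub>M\<^esub> x) \<oplus>\<^bsub>M\<^esub> a \<odot>\<^bsub>M\<^esub> x = \<zero>\<^bsub>M\<^esub>"
    using smult_r_distr[of a "\<ominus>\<^bsub>M\<^esub> x" x] assms by (simp add: M.l_neg)
  then show ?thesis using assms smult_closed by (metis M.a_inv_closed M.minus_equality)
qed

lemma smult_minus_one:
  assumes "x \<in> carrier M" shows "(\<ominus>\<^bsub>R\<^esub> \<one>\<^bsub>R\<^esub>) \<odot>\<^bsub>M\<^esub> x = \<ominus>\<^bsub>M\<^esub> x"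
proof -
  have "(\<ominus>\<^bsub>R\<^esub> \<one>\<^bsub>R\<^esub>) \<odot>\<^bsub>M\<^esub> x \<oplus>\<^bsub>M\<^esub> x = \<zero>\<^bsub>M\<^esub>"
    using smult_l_distr[of "\<ominus>\<^bsub>R\<^esub> \<one>\<^bsub>R\<^esub>" "\<one>\<^bsub>R\<^esub>" x] assms by (simp add: R.l_neg smult_one)
  then show ?thesis using assms smult_closed
    by (metis M.minus_equality R.a_inv_closed R.one_closed)
qed

text \<open>Negatives need no separate premise, because -x is (-1) x.\<close>

lemma submoduleI:
  assumes "H \<subseteq> carrier M" "\<zero>\<^bsub>M\<^esub> \<in> H"
    and "\<And>x y. \<lbrakk>x \<in> H; y \<in> H\<rbrakk> \<Longrightarrow> x \<oplus>\<^bsub>M\<^esub> y \<in> H"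
    and sm: "\<And>a x. \<lbrakk>a \<in> carrier R; x \<in> H\<rbrakk> \<Longrightarrow> a \<odot>\<^bsub>M\<^esub> x \<in> H"
  shows "submodule H R M"
proof -
  have "\<ominus>\<^bsub>M\<^esub> x \<in> H" if "x \<in> H" for x
    using sm[of "\<ominus>\<^bsub>R\<^esub> \<one>\<^bsub>R\<^esub>" x] smult_minus_one[of x] that assms(1) by auto
  then show ?thesis
    using assms by (intro submodule.intro subgroup.intro submodule_axioms.intro) (auto simp: a_inv_def)
qed

lemma submoduleD:
  assumes "submodule H R M"
  shows "H \<subseteq> carrier M" "\<zero>\<^bsub>M\<^esub> \<in> H" "\<And>x y. \<lbrakk>x \<in> H; y \<in> H\<rbrakk> \<Longrightarrow> x \<oplus>\<^bsub>M\<^esub> y \<in> H"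
    "\<And>a x. \<lbrakk>a \<in> carrier R; x \<in> H\<rbrakk> \<Longrightarrow> a \<odot>\<^bsub>M\<^esub> x \<in> H" "\<And>x. x \<in> H \<Longrightarrow> \<ominus>\<^bsub>M\<^esub> x \<in> H"
proof -
  interpret submodule H R M by fact
  show "H \<subseteq> carrier M" "\<zero>\<^bsub>M\<^esub> \<in> H" "\<And>x y. \<lbrakk>x \<in> H; y \<in> H\<rbrakk> \<Longrightarrow> x \<oplus>\<^bsub>M\<^esub> y \<in> H"
    "\<And>a x. \<lbrakk>a \<in> carrier R; x \<in> H\<rbrakk> \<Longrightarrow> a \<odot>\<^bsub>M\<^esub> x \<in> H"
    using subset one_closed m_closed by auto
  show "\<And>x. x \<in> H \<Longrightarrow> \<ominus>\<^bsub>M\<^esub> x \<in> H" using m_inv_closed by (simp add: a_inv_def)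
qed

lemma submodule_carrier: "submodule (carrier M) R M"
  by (rule submoduleI) (auto intro: smult_closed)

text \<open>Submodules, and later all syzygies, are records that differ from the ambient module in
  the carrier only, so homomorphisms restrict without any change of the function.\<close>

lemma left_module_submodule:
  assumes "submodule H R M" shows "left_module R (M\<lparr>carrier := H\<rparr>)"
proof -
  note H = submoduleD[OF assms]
  have "abelian_group (M\<lparr>carrier := H\<rparr>)"
  proof (rule abelian_groupI)
    fix x assume "x \<in> carrier (M\<lparr>carrier := H\<rparr>)"
    then have "\<ominus>\<^bsub>M\<^esub> x \<in> H" "\<ominus>\<^bsub>M\<^esub> x \<oplus>\<^bsub>M\<^esub> x = \<zero>\<^bsub>M\<^esub>" using H M.l_neg by auto
    then show "\<exists>y\<in>carrier (M\<lparr>carrier := H\<rparr>). y \<oplus>\<^bsub>M\<lparr>carrier := H\<rparr>\<^esub> x = \<zero>\<^bsub>M\<lparr>carrier := H\<rparr>\<^esub>" by auto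
  qed (use H M.a_assoc M.a_comm in \<open>auto simp: subset_iff\<close>)
  moreover have "left_module_axioms R (M\<lparr>carrier := H\<rparr>)"
    using H by unfold_locales (auto simp: subset_iff smult_l_distr smult_r_distr smult_assoc smult_one)
  ultimately show ?thesis using R.ring_axioms by (simp add: left_module_def)
qed

end

section \<open>Homomorphisms: sums, restrictions, kernels and images\<close>

lemma left_module_homI:
  assumes "\<And>x. x \<in> carrier M \<Longrightarrow> f x \<in> carrier N"
    and "\<And>x y. \<lbrakk>x \<in> carrier M; y \<in> carrier M\<rbrakk> \<Longrightarrow> f (x \<oplus>\<^bsub>M\<^esub> y) = f x \<oplus>\<^bsub>N\<^esub> f y"
    and "\<And>a x. \<lbrakk>a \<in> carrier R; x \<in> carrier M\<rbrakk> \<Longrightarrow> f (a \<odot>\<^bsub>M\<^esub> x) = a \<odot>\<^bsub>N\<^esub> f x"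
  shows "f \<in> left_module_hom R M N"
  using assms by (auto simp: left_module_hom_def)

lemma left_module_homD:
  assumes "f \<in> left_module_hom R M N"
  shows "x \<in> carrier M \<Longrightarrow> f x \<in> carrier N"
    and "\<lbrakk>x \<in> carrier M; y \<in> carrier M\<rbrakk> \<Longrightarrow> f (x \<oplus>\<^bsub>M\<^esub> y) = f x \<oplus>\<^bsub>N\<^esub> f y"
    and "\<lbrakk>a \<in> carrier R; x \<in> carrier M\<rbrakk> \<Longrightarrow> f (a \<odot>\<^bsub>M\<^esub> x) = a \<odot>\<^bsub>N\<^esub> f x"
  using assms by (auto simp: left_module_hom_def)

lemma left_module_hom_zero:
  assumes "left_module R M" "left_module R N" "f \<in> left_module_hom R M N"
  shows "f \<zero>\<^bsub>M\<^esub> = \<zero>\<^bsub>N\<^esub>"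
proof -
  interpret M: left_module R M by fact
  interpret N: left_module R N by fact
  note f = left_module_homD[OF assms(3)]
  have "f \<zero>\<^bsub>M\<^esub> = f (\<zero>\<^bsub>R\<^esub> \<odot>\<^bsub>M\<^esub> \<zero>\<^bsub>M\<^esub>)" by simp
  also have "\<dots> = \<zero>\<^bsub>R\<^esub> \<odot>\<^bsub>N\<^esub> f \<zero>\<^bsub>M\<^esub>" by (rule f) auto
  also have "\<dots> = \<zero>\<^bsub>N\<^esub>" using f(1) by simp
  finally show ?thesis .
qed

lemma left_module_hom_minus:
  assumes "left_module R M" "left_module R N" "f \<in> left_module_hom R M N" "x \<in> carrier M"
  shows "f (\<ominus>\<^bsub>M\<^esub> x) = \<ominus>\<^bsub>N\<^esub> f x"
proof -
  interpret M: left_module R M by fact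
  interpret N: left_module R N by fact
  note f = left_module_homD[OF assms(3)]
  show ?thesis
    using f(3)[of "\<ominus>\<^bsub>R\<^esub> \<one>\<^bsub>R\<^esub>" x] assms(4) f(1) by (simp add: M.smult_minus_one N.smult_minus_one)
qed

lemma left_module_hom_id: "(\<lambda>x. x) \<in> left_module_hom R M M"
  by (auto simp: left_module_hom_def)

lemma left_module_hom_comp:
  assumes "f \<in> left_module_hom R M N" "g \<in> left_module_hom R N L"
  shows "(\<lambda>x. g (f x)) \<in> left_module_hom R M L"
  using assms by (auto simp: left_module_hom_def Pi_def)

lemma left_module_hom_const_zero:
  assumes "left_module R N" shows "(\<lambda>x. \<zero>\<^bsub>N\<^esub>) \<in> left_module_hom R M N"
proof -
  interpret N: left_module R N by fact
  show ?thesis by (rule left_module_homI) auto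
qed

lemma left_module_hom_add:
  assumes "left_module R N" "f \<in> left_module_hom R M N" "g \<in> left_module_hom R M N"
  shows "(\<lambda>x. f x \<oplus>\<^bsub>N\<^esub> g x) \<in> left_module_hom R M N"
proof -
  interpret N: left_module R N by fact
  note fg = left_module_homD[OF assms(2)] left_module_homD[OF assms(3)]
  show ?thesis by (rule left_module_homI) (auto simp: fg N.smult_r_distr N.M.a_ac)
qed

lemma left_module_hom_uminus:
  assumes "left_module R N" "f \<in> left_module_hom R M N"
  shows "(\<lambda>x. \<ominus>\<^bsub>N\<^esub> f x) \<in> left_module_hom R M N"
proof -
  interpret N: left_module R N by fact
  note f = left_module_homD[OF assms(2)]
  show ?thesis by (rule left_module_homI) (auto simp: f N.smult_r_minus N.M.minus_add)
qed

lemma left_module_hom_restrict: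
  assumes "f \<in> left_module_hom R M N" "H \<subseteq> carrier M"
  shows "f \<in> left_module_hom R (M\<lparr>carrier := H\<rparr>) N"
  using assms(2) by (intro left_module_homI) (auto simp: left_module_homD[OF assms(1)] subsetD)

lemma left_module_hom_corestrict:
  "\<lbrakk>f \<in> left_module_hom R M N; f ` carrier M \<subseteq> H\<rbrakk> \<Longrightarrow> f \<in> left_module_hom R M (N\<lparr>carrier := H\<rparr>)"
  by (auto simp: left_module_hom_def)

lemma left_module_hom_extend:
  "\<lbrakk>f \<in> left_module_hom R M (N\<lparr>carrier := H\<rparr>); H \<subseteq> carrier N\<rbrakk> \<Longrightarrow> f \<in> left_module_hom R M N"
  by (auto simp: left_module_hom_def)

lemma submodule_a_kernel:
  assumes "left_module R M" "left_module R N" "f \<in> left_module_hom R M N"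
  shows "submodule (a_kernel M N f) R M"
proof -
  interpret M: left_module R M by fact
  interpret N: left_module R N by fact
  note f = left_module_homD[OF assms(3)]
  show ?thesis
    by (rule M.submoduleI)
      (auto simp: a_kernel_def' f left_module_hom_zero[OF assms] intro: M.smult_closed)
qed

lemma submodule_image:
  assumes "left_module R M" "left_module R N" "f \<in> left_module_hom R M N" "submodule H R M"
  shows "submodule (f ` H) R N"
proof -
  interpret M: left_module R M by fact
  interpret N: left_module R N by fact
  note f = left_module_homD[OF assms(3)]
  note H = M.submoduleD[OF assms(4)]
  show ?thesis
  proof (rule N.submoduleI)
    show "f ` H \<subseteq> carrier N" using f(1) H(1) by auto
    show "\<zero>\<^bsub>N\<^esub> \<in> f ` H" using left_module_hom_zero[OF assms(1-3)] H(2) by (metis imageI)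
    show "x \<oplus>\<^bsub>N\<^esub> y \<in> f ` H" if "x \<in> f ` H" "y \<in> f ` H" for x y
    proof -
      obtain x' y' where "x = f x'" "y = f y'" "x' \<in> H" "y' \<in> H" using \<open>x \<in> f ` H\<close> \<open>y \<in> f ` H\<close> by auto
      then show ?thesis using f(2)[of x' y', symmetric] H(1) H(3)[of x' y'] by (simp add: subsetD)
    qed
    show "a \<odot>\<^bsub>N\<^esub> x \<in> f ` H" if "a \<in> carrier R" "x \<in> f ` H" for a x
    proof -
      obtain x' where "x = f x'" "x' \<in> H" using \<open>x \<in> f ` H\<close> by auto
      then show ?thesis using f(3)[of a x', symmetric] H(1) H(4)[of a x'] \<open>a \<in> carrier R\<close> by (simp add: subsetD)
    qed
  qed
qed

lemma submodule_vimage: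
  assumes "left_module R M" "left_module R N" "f \<in> left_module_hom R M N" "submodule H R N"
  shows "submodule {x \<in> carrier M. f x \<in> H} R M"
proof -
  interpret M: left_module R M by fact
  interpret N: left_module R N by fact
  note f = left_module_homD[OF assms(3)]
  note H = N.submoduleD[OF assms(4)]
  show ?thesis
    by (rule M.submoduleI)
      (auto simp: f left_module_hom_zero[OF assms(1-3)] H intro: M.smult_closed)
qed

lemma (in left_module) submodule_of_submodule:
  assumes "submodule H R M" "K \<subseteq> H"
  shows "submodule K R (M\<lparr>carrier := H\<rparr>) \<longleftrightarrow> submodule K R M"
proof -
  interpret H: left_module R "M\<lparr>carrier := H\<rparr>" by (rule left_module_submodule[OF assms(1)])
  note H = submoduleD[OF assms(1)]
  show ?thesis
  proof
    assume "submodule K R (M\<lparr>carrier := H\<rparr>)"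
    from H.submoduleD[OF this] show "submodule K R M" using H by (intro submoduleI) auto
  next
    assume "submodule K R M"
    from submoduleD[OF this] show "submodule K R (M\<lparr>carrier := H\<rparr>)"
      using assms(2) by (intro H.submoduleI) auto
  qed
qed

text \<open>The type annotation matters: projectivity is tested only against modules over the same
  element type, so every lifting problem below has to be posed inside
  \<open>'a lmod\<close>.\<close>

lemma projective_lift:
  fixes P M N :: "'a lmod"
  assumes "projective_module R P" "left_module R M" "left_module R N"
    and "f \<in> left_module_hom R M N" "f ` carrier M = carrier N" "g \<in> left_module_hom R P N"
  obtains h where "h \<in> left_module_hom R P M" "\<And>x. x \<in> carrier P \<Longrightarrow> f (h x) = g x"
proof -
  have "\<exists>h\<in>left_module_hom R P M. \<forall>x\<in>carrier P. f (h x) = g x"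
    using assms(1)[unfolded projective_module_def, THEN conjunct2, rule_format, of M N f g] assms(2-6) by blast
  then show ?thesis using that by blast
qed

lemma fg_left_module_D: "fg_left_module R M \<Longrightarrow> left_module R M"
  by (simp add: fg_left_module_def)

lemma projective_module_D: "projective_module R M \<Longrightarrow> left_module R M"
  by (simp add: projective_module_def)

lemma left_module_a_kernel:
  assumes "left_module R M" "left_module R N" "f \<in> left_module_hom R M N"
  shows "left_module R (M\<lparr>carrier := a_kernel M N f\<rparr>)"
  by (rule left_module.left_module_submodule[OF assms(1) submodule_a_kernel[OF assms]])

lemma left_module_hom_inj_on:
  assumes M: "left_module R M" and N: "left_module R N" and f: "f \<in> left_module_hom R M N"
    and "\<And>x. \<lbrakk>x \<in> carrier M; f x = \<zero>\<^bsub>N\<^esub>\<rbrakk> \<Longrightarrow> x = \<zero>\<^bsub>M\<^esub>"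
  shows "inj_on f (carrier M)"
proof (rule inj_onI)
  interpret M: left_module R M by fact
  interpret N: left_module R N by fact
  note D = left_module_homD[OF f]
  fix x y assume xy: "x \<in> carrier M" "y \<in> carrier M" "f x = f y"
  have "f (x \<oplus>\<^bsub>M\<^esub> \<ominus>\<^bsub>M\<^esub> y) = \<zero>\<^bsub>N\<^esub>"
    using xy by (simp add: D left_module_hom_minus[OF M N f] N.M.r_neg)
  then have "x \<oplus>\<^bsub>M\<^esub> \<ominus>\<^bsub>M\<^esub> y = \<zero>\<^bsub>M\<^esub>" using assms(4) xy by simp
  then show "x = y" using xy by (metis M.M.a_inv_closed M.M.minus_equality M.M.minus_minus)
qed

text \<open>\<open>g\<close> is \<open>f\<close> followed by the inverse of \<open>i\<close> on its
  image; injectivity makes that inverse linear. This supplies inverses of isomorphisms and the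
  retraction of a split sequence.\<close>

lemma left_module_hom_factor:
  assumes N: "left_module R N" and i: "i \<in> left_module_hom R N L" "inj_on i (carrier N)"
    and f: "f \<in> left_module_hom R M L" "f ` carrier M \<subseteq> i ` carrier N"
  obtains g where "g \<in> left_module_hom R M N" "\<And>x. x \<in> carrier M \<Longrightarrow> i (g x) = f x"
proof
  interpret N: left_module R N by fact
  let ?g = "\<lambda>x. inv_into (carrier N) i (f x)"
  have g: "?g x \<in> carrier N" "i (?g x) = f x" if "x \<in> carrier M" for x
  proof -
    have "f x \<in> i ` carrier N" using f(2) that by blast
    then show "?g x \<in> carrier N" "i (?g x) = f x" by (rule inv_into_into, rule f_inv_into_f)
  qed
  show "?g \<in> left_module_hom R M N"
  proof (rule left_module_homI)
    show "?g x \<in> carrier N" if "x \<in> carrier M" for x by (rule g[OF that])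
    show "?g (x \<oplus>\<^bsub>M\<^esub> y) = ?g x \<oplus>\<^bsub>N\<^esub> ?g y" if xy: "x \<in> carrier M" "y \<in> carrier M" for x y
      using xy g by (intro inv_into_f_eq i(2)) (auto simp: left_module_homD[OF i(1)] left_module_homD[OF f(1)])
    show "?g (a \<odot>\<^bsub>M\<^esub> x) = a \<odot>\<^bsub>N\<^esub> ?g x" if ax: "a \<in> carrier R" "x \<in> carrier M" for a x
      using ax g by (intro inv_into_f_eq i(2))
        (auto simp: left_module_homD[OF i(1)] left_module_homD[OF f(1)] intro: N.smult_closed)
  qed
  show "i (?g x) = f x" if "x \<in> carrier M" for x by (rule g[OF that])
qed

section \<open>Finitely generated, zero and quotient modules\<close>

lemma fg_left_moduleE:
  assumes "fg_left_module R M"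
  obtains B where "finite B" "B \<subseteq> carrier M" "\<forall>H. submodule H R M \<and> B \<subseteq> H \<longrightarrow> H = carrier M"
  using assms unfolding fg_left_module_def by (elim exE conjE) (rule that)

text \<open>If a submodule of \<open>N\<close> contains the images of the generators, its preimage
  contains the generators and is all of \<open>M\<close>.\<close>

lemma fg_left_module_image:
  assumes fg: "fg_left_module R M" and N: "left_module R N"
    and f: "f \<in> left_module_hom R M N" "f ` carrier M = carrier N"
  shows "fg_left_module R N"
proof -
  obtain B where B: "finite B" "B \<subseteq> carrier M"
    "\<forall>H. submodule H R M \<and> B \<subseteq> H \<longrightarrow> H = carrier M"
    using fg by (elim fg_left_moduleE) (rule that)
  have "H = carrier N" if H: "submodule H R N" "f ` B \<subseteq> H" for H
  proof -
    have "{x \<in> carrier M. f x \<in> H} = carrier M"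
      using H(2) B(2) by (intro B(3)[rule_format] conjI submodule_vimage[OF fg_left_module_D[OF fg] N f(1) H(1)]) auto
    then have "f ` carrier M \<subseteq> H" by auto
    then show ?thesis using f(2) left_module.submoduleD(1)[OF N H(1)] by auto
  qed
  then show ?thesis
    unfolding fg_left_module_def using N B(1,2) f by (auto intro!: exI[of _ "f ` B"])
qed

text \<open>Resolutions are indexed by all natural numbers, so a finite one is padded with zero
  modules, which must count as finitely generated and projective.\<close>

lemma trivial_module:
  assumes Z: "left_module R Z" and z: "carrier Z = {\<zero>\<^bsub>Z\<^esub>}"
  shows "fg_left_module R Z" and "projective_module R (Z :: 'a lmod)"
proof -
  interpret Z: left_module R Z by fact
  show "fg_left_module R Z"
    unfolding fg_left_module_def using Z z by (auto intro!: exI[of _ "{\<zero>\<^bsub>Z\<^esub>}"] dest: Z.submoduleD(1))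
  show "projective_module R Z"
    unfolding projective_module_def
  proof (intro conjI allI impI)
    fix A B :: "'a lmod" and f g
    assume *: "left_module R A \<and> left_module R B \<and> f \<in> left_module_hom R A B \<and>
      f ` carrier A = carrier B \<and> g \<in> left_module_hom R Z B"
    then have "f \<zero>\<^bsub>A\<^esub> = \<zero>\<^bsub>B\<^esub>" "g \<zero>\<^bsub>Z\<^esub> = \<zero>\<^bsub>B\<^esub>" using left_module_hom_zero Z by blast+
    then show "\<exists>h\<in>left_module_hom R Z A. \<forall>x\<in>carrier Z. f (h x) = g x"
      using z * by (intro bexI[of _ "\<lambda>x. \<zero>\<^bsub>A\<^esub>"] left_module_hom_const_zero) auto
  qed fact
qed

lemma (in left_module) submodule_zero: "submodule {\<zero>\<^bsub>M\<^esub>} R M"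
  by (rule submoduleI) auto

text \<open>Cosets would leave the type \<open>nat \<Rightarrow> 'a\<close>, so the quotient lives on representatives.\<close>

lemma quotient_module:
  fixes M :: "'a lmod"
  assumes M: "left_module R M" and H: "submodule H R M"
  obtains L :: "'a lmod" and p where "left_module R L" "p \<in> left_module_hom R M L"
    "p ` carrier M = carrier L" "a_kernel M L p = H"
proof -
  interpret M: left_module R M by fact
  note H = M.submoduleD[OF H]
  define cong where "cong x y \<longleftrightarrow> (\<exists>h\<in>H. x = y \<oplus>\<^bsub>M\<^esub> h)" for x y
  define rep where "rep x = (SOME y. y \<in> carrier M \<and> cong y x)" for x
  have Hc: "h \<in> carrier M" if "h \<in> H" for h using H(1) that by auto
  have crefl: "cong x x" if "x \<in> carrier M" for x
    using that H(2) by (auto simp: cong_def intro!: bexI[of _ "\<zero>\<^bsub>M\<^esub>"])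
  have csym: "cong y x" if xy: "cong x y" "y \<in> carrier M" for x y
  proof -
    obtain h where "h \<in> H" "x = y \<oplus>\<^bsub>M\<^esub> h" using xy(1) by (auto simp: cong_def)
    then show ?thesis using xy(2) H(5)[of h] Hc
      by (auto simp: cong_def M.M.a_assoc M.M.r_neg intro!: bexI[of _ "\<ominus>\<^bsub>M\<^esub> h"])
  qed
  have ctrans: "cong x z" if xy: "cong x y" "cong y z" "z \<in> carrier M" for x y z
  proof -
    obtain h h' where "h \<in> H" "x = y \<oplus>\<^bsub>M\<^esub> h" "h' \<in> H" "y = z \<oplus>\<^bsub>M\<^esub> h'" using xy by (auto simp: cong_def)
    then show ?thesis using xy(3) H(3)[of h' h] Hc
      by (auto simp: cong_def M.M.a_assoc intro!: bexI[of _ "h' \<oplus>\<^bsub>M\<^esub> h"])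
  qed
  have rep: "rep x \<in> carrier M" "cong (rep x) x" if "x \<in> carrier M" for x
    using someI[of "\<lambda>y. y \<in> carrier M \<and> cong y x" x] crefl[OF that] that by (auto simp: rep_def)
  have rep_eq: "rep x = rep y \<longleftrightarrow> cong x y" if "x \<in> carrier M" "y \<in> carrier M" for x y
  proof
    assume "rep x = rep y"
    then show "cong x y" using rep that csym ctrans by metis
  next
    assume "cong x y"
    \<comment> \<open>For congruent elements \<open>SOME\<close> chooses from the same predicate, so
      \<open>rep\<close> is constant on cosets.\<close>
    then have "(y' \<in> carrier M \<and> cong y' x) = (y' \<in> carrier M \<and> cong y' y)" for y'
      using that csym ctrans by blast
    then show "rep x = rep y" by (simp add: rep_def)
  qed
  have cadd: "cong (x \<oplus>\<^bsub>M\<^esub> z) (y \<oplus>\<^bsub>M\<^esub> z)" if xy: "cong x y" "y \<in> carrier M" "z \<in> carrier M" for x y z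
  proof -
    obtain h where "h \<in> H" "x = y \<oplus>\<^bsub>M\<^esub> h" using xy(1) by (auto simp: cong_def)
    then show ?thesis using xy(2,3) Hc by (auto simp: cong_def M.M.a_ac intro!: bexI[of _ h])
  qed
  have csm: "cong (a \<odot>\<^bsub>M\<^esub> x) (a \<odot>\<^bsub>M\<^esub> y)" if xy: "cong x y" "y \<in> carrier M" "a \<in> carrier R" for a x y
  proof -
    obtain h where "h \<in> H" "x = y \<oplus>\<^bsub>M\<^esub> h" using xy(1) by (auto simp: cong_def)
    then show ?thesis using xy(2,3) H(4)[of a h] Hc
      by (auto simp: cong_def M.smult_r_distr intro!: bexI[of _ "a \<odot>\<^bsub>M\<^esub> h"])
  qed
  have rl: "rep (rep x \<oplus>\<^bsub>M\<^esub> y) = rep (x \<oplus>\<^bsub>M\<^esub> y)" "rep (y \<oplus>\<^bsub>M\<^esub> rep x) = rep (y \<oplus>\<^bsub>M\<^esub> x)"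
    if "x \<in> carrier M" "y \<in> carrier M" for x y
  proof -
    show "rep (rep x \<oplus>\<^bsub>M\<^esub> y) = rep (x \<oplus>\<^bsub>M\<^esub> y)" using that rep[of x] cadd by (subst rep_eq) auto
    then show "rep (y \<oplus>\<^bsub>M\<^esub> rep x) = rep (y \<oplus>\<^bsub>M\<^esub> x)"
      using that rep[of x] by (simp add: M.M.a_comm)
  qed
  have rl3: "rep (x \<oplus>\<^bsub>M\<^esub> (y \<oplus>\<^bsub>M\<^esub> rep z)) = rep (x \<oplus>\<^bsub>M\<^esub> (y \<oplus>\<^bsub>M\<^esub> z))"
    if "x \<in> carrier M" "y \<in> carrier M" "z \<in> carrier M" for x y z
    using that rep[of z] rl(2)[of z "x \<oplus>\<^bsub>M\<^esub> y"] by (simp add: M.M.a_assoc)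
  have rr: "rep (rep x) = rep x" if "x \<in> carrier M" for x
    using that rep[of x] by (simp add: rep_eq)
  have rs: "rep (a \<odot>\<^bsub>M\<^esub> rep x) = rep (a \<odot>\<^bsub>M\<^esub> x)" if "x \<in> carrier M" "a \<in> carrier R" for a x
    using that rep[of x] csm by (subst rep_eq) (auto intro: M.smult_closed)
  have rs2: "rep (a \<odot>\<^bsub>M\<^esub> rep x \<oplus>\<^bsub>M\<^esub> b \<odot>\<^bsub>M\<^esub> rep x) = rep (a \<odot>\<^bsub>M\<^esub> x \<oplus>\<^bsub>M\<^esub> b \<odot>\<^bsub>M\<^esub> x)"
    "rep (a \<odot>\<^bsub>M\<^esub> (b \<odot>\<^bsub>M\<^esub> rep x)) = rep (a \<odot>\<^bsub>M\<^esub> (b \<odot>\<^bsub>M\<^esub> x))"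
    if "a \<in> carrier R" "b \<in> carrier R" "x \<in> carrier M" for a b x
    using rs[of x "a \<oplus>\<^bsub>R\<^esub> b"] rs[of x "a \<otimes>\<^bsub>R\<^esub> b"] that rep[of x]
    by (simp_all add: M.smult_l_distr M.smult_assoc)
  define L :: "'a lmod" where "L = \<lparr>carrier = rep ` carrier M, mult = \<lambda>_ _. undefined, one = \<lambda>_. undefined, ring.zero = rep \<zero>\<^bsub>M\<^esub>,
    add = (\<lambda>x y. rep (x \<oplus>\<^bsub>M\<^esub> y)), smult = (\<lambda>a x. rep (a \<odot>\<^bsub>M\<^esub> x))\<rparr>"
  have L_simps: "carrier L = rep ` carrier M" "\<zero>\<^bsub>L\<^esub> = rep \<zero>\<^bsub>M\<^esub>" "x \<oplus>\<^bsub>L\<^esub> y = rep (x \<oplus>\<^bsub>M\<^esub> y)"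
    "a \<odot>\<^bsub>L\<^esub> x = rep (a \<odot>\<^bsub>M\<^esub> x)" for x y a
    by (simp_all add: L_def)
  have "abelian_group L"
  proof (rule abelian_groupI)
    fix x assume "x \<in> carrier L"
    then obtain x' where "x' \<in> carrier M" "x = rep x'" by (auto simp: L_simps)
    then show "\<exists>y\<in>carrier L. y \<oplus>\<^bsub>L\<^esub> x = \<zero>\<^bsub>L\<^esub>"
      by (intro bexI[of _ "rep (\<ominus>\<^bsub>M\<^esub> x')"]) (auto simp: L_simps rl rep M.M.l_neg)
  qed (auto simp: L_simps rl rl3 rr rep M.M.a_ac)
  moreover have "left_module_axioms R L"
    by unfold_locales (auto simp: L_simps rl rl3 rr rs rs2 rep M.smult_closed M.smult_l_distr M.smult_r_distr
        M.smult_assoc M.smult_one)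
  ultimately have "left_module R L" using M.R.ring_axioms by (simp add: left_module_def)
  moreover have "rep \<in> left_module_hom R M L"
    by (rule left_module_homI) (auto simp: L_simps rl rs rep)
  moreover have "a_kernel M L rep = H"
    using Hc by (auto simp: a_kernel_def' L_simps rep_eq cong_def)
  ultimately show thesis using that[of L rep] by (simp add: L_simps)
qed

section \<open>Projective dimension by iterated syzygies\<close>

text \<open>A finite recursion in place of infinite resolutions: one presentation at a time, chosen
  existentially, so that bounds can be proved by induction on \<open>k\<close>. The link to
  \<open>proj_dim\<close> is \<open>proj_dim_le_iff\<close>.\<close>

primrec pd_le :: "('a, 'm) ring_scheme \<Rightarrow> nat \<Rightarrow> 'a lmod \<Rightarrow> bool" where
  "pd_le R 0 M \<longleftrightarrow> fg_left_module R M \<and> projective_module R M"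
| "pd_le R (Suc k) M \<longleftrightarrow> left_module R M \<and>
     (\<exists>P e. fg_left_module R P \<and> projective_module R P \<and> e \<in> left_module_hom R P M \<and>
            e ` carrier P = carrier M \<and> pd_le R k (P\<lparr>carrier := a_kernel P M e\<rparr>))"

lemma pd_le_left_module: "pd_le R k M \<Longrightarrow> left_module R M"
  by (cases k) (auto simp: projective_module_def)

text \<open>Unlike retracts, stable retracts pass to syzygies for any choice of the projective presentations.\<close>

definition stable_retract :: "('a, 'm) ring_scheme \<Rightarrow> 'a lmod \<Rightarrow> 'a lmod \<Rightarrow> bool" where
  "stable_retract R M N \<longleftrightarrow>
     (\<exists>u\<in>left_module_hom R M N. \<exists>v\<in>left_module_hom R N M. \<exists>Q. projective_module R Q \<and>
        (\<exists>p\<in>left_module_hom R M Q. \<exists>q\<in>left_module_hom R Q M.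
           \<forall>x\<in>carrier M. v (u x) \<oplus>\<^bsub>M\<^esub> q (p x) = x))"

lemma stable_retractI:
  assumes "u \<in> left_module_hom R M N" "v \<in> left_module_hom R N M" "projective_module R Q"
    "p \<in> left_module_hom R M Q" "q \<in> left_module_hom R Q M"
    "\<And>x. x \<in> carrier M \<Longrightarrow> v (u x) \<oplus>\<^bsub>M\<^esub> q (p x) = x"
  shows "stable_retract R M N"
  unfolding stable_retract_def using assms by blast

text \<open>In effect \<open>M\<close> is a direct summand of the sum of \<open>N\<close> and
  \<open>Q\<close>: g v is lifted from \<open>N\<close> and g q from \<open>Q\<close>, and the two
  lifts, composed with \<open>u\<close> and \<open>p\<close> and added, lift g (v u + q p) =
  g.\<close>

lemma stable_retract_projective:
  assumes M: "left_module R M" and "projective_module R N" and "stable_retract R M N"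
  shows "projective_module R M"
  unfolding projective_module_def
proof (intro conjI allI impI)
  show "left_module R M" by fact
  fix A B :: "'a lmod" and f g
  assume *: "left_module R A \<and> left_module R B \<and> f \<in> left_module_hom R A B \<and>
    f ` carrier A = carrier B \<and> g \<in> left_module_hom R M B"
  then have A: "left_module R A" and B: "left_module R B" and f: "f \<in> left_module_hom R A B"
    "f ` carrier A = carrier B" and g: "g \<in> left_module_hom R M B" by auto
  obtain u v Q p q where u: "u \<in> left_module_hom R M N" and v: "v \<in> left_module_hom R N M"
    and Q: "projective_module R Q" and p: "p \<in> left_module_hom R M Q" and q: "q \<in> left_module_hom R Q M"
    and eq: "\<And>x. x \<in> carrier M \<Longrightarrow> v (u x) \<oplus>\<^bsub>M\<^esub> q (p x) = x"
    using assms(3) unfolding stable_retract_def by blast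
  obtain h1 where h1: "h1 \<in> left_module_hom R N A" "\<And>x. x \<in> carrier N \<Longrightarrow> f (h1 x) = g (v x)"
    using projective_lift[OF assms(2) A B f left_module_hom_comp[OF v g]] by blast
  obtain h2 where h2: "h2 \<in> left_module_hom R Q A" "\<And>x. x \<in> carrier Q \<Longrightarrow> f (h2 x) = g (q x)"
    using projective_lift[OF Q A B f left_module_hom_comp[OF q g]] by blast
  show "\<exists>h\<in>left_module_hom R M A. \<forall>x\<in>carrier M. f (h x) = g x"
  proof (intro bexI ballI)
    show "(\<lambda>x. h1 (u x) \<oplus>\<^bsub>A\<^esub> h2 (p x)) \<in> left_module_hom R M A"
      by (intro left_module_hom_add A left_module_hom_comp[OF u h1(1)] left_module_hom_comp[OF p h2(1)])
    fix x assume x: "x \<in> carrier M"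
    note D = left_module_homD[OF u] left_module_homD[OF v] left_module_homD[OF p] left_module_homD[OF q]
      left_module_homD[OF f(1)] left_module_homD[OF g] left_module_homD[OF h1(1)] left_module_homD[OF h2(1)]
    have "f (h1 (u x) \<oplus>\<^bsub>A\<^esub> h2 (p x)) = g (v (u x) \<oplus>\<^bsub>M\<^esub> q (p x))"
      using x by (simp add: D h1(2) h2(2))
    then show "f (h1 (u x) \<oplus>\<^bsub>A\<^esub> h2 (p x)) = g x" using eq x by simp
  qed
qed

text \<open>\<open>u\<close>, \<open>v\<close> and \<open>q\<close> lift to maps \<open>a\<close>,
  \<open>b\<close> and \<open>q'\<close> between the projective modules. The defect h = id - b a -
  q' p eF maps \<open>F\<close> into the kernel of \<open>eF\<close>, because v u + q p = id, and on
  that kernel its last term vanishes. So there id = b a + h, where \<open>h\<close> passes through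
  \<open>F\<close>: the new projective module is \<open>F\<close>.\<close>

lemma stable_retract_syzygy:
  assumes MN: "stable_retract R M N" and M: "left_module R M" and N: "left_module R N"
    and F: "projective_module R F" and eF: "eF \<in> left_module_hom R F M" "eF ` carrier F = carrier M"
    and P: "projective_module R P" and eP: "eP \<in> left_module_hom R P N" "eP ` carrier P = carrier N"
  shows "stable_retract R (F\<lparr>carrier := a_kernel F M eF\<rparr>) (P\<lparr>carrier := a_kernel P N eP\<rparr>)"
proof -
  obtain u v Q p q where u: "u \<in> left_module_hom R M N" and v: "v \<in> left_module_hom R N M"
    and Q: "projective_module R Q" and p: "p \<in> left_module_hom R M Q" and q: "q \<in> left_module_hom R Q M"
    and eq: "\<And>x. x \<in> carrier M \<Longrightarrow> v (u x) \<oplus>\<^bsub>M\<^esub> q (p x) = x"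
    using MN unfolding stable_retract_def by blast
  note F' = projective_module_D[OF F] and P' = projective_module_D[OF P] and Q' = projective_module_D[OF Q]
  interpret M: left_module R M by fact
  interpret F: left_module R F by (rule F')
  obtain a where a: "a \<in> left_module_hom R F P" "\<And>x. x \<in> carrier F \<Longrightarrow> eP (a x) = u (eF x)"
    using projective_lift[OF F P' N eP left_module_hom_comp[OF eF(1) u]] by blast
  obtain b where b: "b \<in> left_module_hom R P F" "\<And>x. x \<in> carrier P \<Longrightarrow> eF (b x) = v (eP x)"
    using projective_lift[OF P F' M eF left_module_hom_comp[OF eP(1) v]] by blast
  obtain q' where q': "q' \<in> left_module_hom R Q F" "\<And>x. x \<in> carrier Q \<Longrightarrow> eF (q' x) = q x"
    using projective_lift[OF Q F' M eF q] by blast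
  note D = left_module_homD[OF u] left_module_homD[OF v] left_module_homD[OF p] left_module_homD[OF q]
    left_module_homD[OF eF(1)] left_module_homD[OF eP(1)] left_module_homD[OF a(1)]
    left_module_homD[OF b(1)] left_module_homD[OF q'(1)]
  define h where "h x = x \<oplus>\<^bsub>F\<^esub> \<ominus>\<^bsub>F\<^esub> (b (a x) \<oplus>\<^bsub>F\<^esub> q' (p (eF x)))" for x
  have h: "h \<in> left_module_hom R F F"
    unfolding h_def
    by (intro left_module_hom_add left_module_hom_uminus F' left_module_hom_id left_module_hom_comp[OF a(1) b(1)]
        left_module_hom_comp[OF left_module_hom_comp[OF eF(1) p] q'(1)])
  have "eF (h x) = \<zero>\<^bsub>M\<^esub>" if x: "x \<in> carrier F" for x
    using x eq[of "eF x"] by (simp add: h_def D left_module_hom_minus[OF F' M eF(1)] a(2) b(2) q'(2) M.M.r_neg)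
  then have h': "h \<in> left_module_hom R F (F\<lparr>carrier := a_kernel F M eF\<rparr>)"
    using h by (intro left_module_hom_corestrict) (auto simp: a_kernel_def' left_module_homD)
  have K: "a_kernel F M eF \<subseteq> carrier F" "a_kernel P N eP \<subseteq> carrier P" by (auto simp: a_kernel_def')
  have a': "a \<in> left_module_hom R (F\<lparr>carrier := a_kernel F M eF\<rparr>) (P\<lparr>carrier := a_kernel P N eP\<rparr>)"
    by (intro left_module_hom_corestrict left_module_hom_restrict a(1) K)
      (auto simp: a_kernel_def' D a(2) left_module_hom_zero[OF M N u])
  have b': "b \<in> left_module_hom R (P\<lparr>carrier := a_kernel P N eP\<rparr>) (F\<lparr>carrier := a_kernel F M eF\<rparr>)"
    by (intro left_module_hom_corestrict left_module_hom_restrict b(1) K)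
      (auto simp: a_kernel_def' D b(2) left_module_hom_zero[OF N M v])
  have i: "(\<lambda>x. x) \<in> left_module_hom R (F\<lparr>carrier := a_kernel F M eF\<rparr>) F"
    by (intro left_module_hom_restrict left_module_hom_id K)
  have "b (a x) \<oplus>\<^bsub>F\<^esub> h x = x" if "x \<in> a_kernel F M eF" for x
  proof -
    have x: "x \<in> carrier F" "eF x = \<zero>\<^bsub>M\<^esub>" using that by (auto simp: a_kernel_def')
    have "q' (p (eF x)) = \<zero>\<^bsub>F\<^esub>"
      using x by (simp add: left_module_hom_zero[OF M Q' p] left_module_hom_zero[OF Q' F' q'(1)])
    then show ?thesis using x by (simp add: h_def D F.M.r_neg1 F.M.a_lcomm F.M.r_neg)
  qed
  then show ?thesis
    unfolding stable_retract_def using a' b' F i h' by (auto intro!: bexI exI)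
qed

text \<open>Any projective module serves as \<open>Q\<close>, since the map through it is
  zero.\<close>

lemma stable_retract_refl:
  assumes M: "left_module R M" and Q: "projective_module R Q"
  shows "stable_retract R M M"
proof -
  interpret M: left_module R M by fact
  show ?thesis
    unfolding stable_retract_def
    using left_module_hom_id[of R M] Q left_module_hom_const_zero[OF projective_module_D[OF Q], of M]
      left_module_hom_const_zero[OF M, of Q] M.M.r_zero
    by (intro bexI[of _ "\<lambda>x. x"] exI[of _ Q] conjI bexI[of _ "\<lambda>x. \<zero>\<^bsub>Q\<^esub>"] bexI[of _ "\<lambda>x. \<zero>\<^bsub>M\<^esub>"]) auto
qed

lemma stable_retract_pd_le_Suc:
  assumes "stable_retract R M N" "left_module R M" "pd_le R (Suc k) N"
    and "projective_module R F" "eF \<in> left_module_hom R F M" "eF ` carrier F = carrier M"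
  shows "\<exists>N'. pd_le R k N' \<and> stable_retract R (F\<lparr>carrier := a_kernel F M eF\<rparr>) N'"
  using stable_retract_syzygy[OF assms(1,2) _ assms(4-6)] assms(3) by auto

text \<open>The bound provides some presentation with projective kernel; the kernel of the
  prescribed presentation is a stable retract of that one.\<close>

lemma pd_le_1_syzygy:
  assumes M: "left_module R M" "pd_le R 1 M"
    and F: "projective_module R F" "e \<in> left_module_hom R F M" "e ` carrier F = carrier M"
  shows "projective_module R (F\<lparr>carrier := a_kernel F M e\<rparr>)"
proof -
  obtain N' where "pd_le R 0 N'" "stable_retract R (F\<lparr>carrier := a_kernel F M e\<rparr>) N'"
    using stable_retract_pd_le_Suc[OF stable_retract_refl[OF M(1) F(1)] M(1) _ F, of 0] M(2) by auto
  moreover have "left_module R (F\<lparr>carrier := a_kernel F M e\<rparr>)"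
    by (rule left_module_a_kernel[OF projective_module_D[OF F(1)] M(1) F(2)])
  ultimately show ?thesis using stable_retract_projective by auto
qed

text \<open>The same comparison twice: \<open>F\<close> against the chosen presentation of
  \<open>M\<close>, and \<open>G\<close> against that of its syzygy. In this form lower bounds are
  read off from the start of an explicit resolution.\<close>

lemma pd_le_2_syzygy:
  assumes M: "left_module R M" "pd_le R 2 M"
    and F: "projective_module R F" "e \<in> left_module_hom R F M" "e ` carrier F = carrier M"
    and G: "projective_module R G" "d \<in> left_module_hom R G F" "d ` carrier G = a_kernel F M e"
  shows "projective_module R (G\<lparr>carrier := a_kernel G F d\<rparr>)"
proof -
  let ?K = "F\<lparr>carrier := a_kernel F M e\<rparr>"
  have K: "left_module R ?K"
    by (rule left_module_a_kernel[OF projective_module_D[OF F(1)] M(1) F(2)])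
  obtain N' where N': "pd_le R (Suc 0) N'" "stable_retract R ?K N'"
    using stable_retract_pd_le_Suc[OF stable_retract_refl[OF M(1) F(1)] M(1) _ F, of "Suc 0"] M(2)
    by (auto simp: numeral_2_eq_2)
  have d: "d \<in> left_module_hom R G ?K" using G by (intro left_module_hom_corestrict) auto
  have eq: "a_kernel G ?K d = a_kernel G F d" by (simp add: a_kernel_def')
  obtain N'' where "pd_le R 0 N''" "stable_retract R (G\<lparr>carrier := a_kernel G F d\<rparr>) N''"
    using stable_retract_pd_le_Suc[OF N'(2) K N'(1) G(1) d] G(3) eq by auto
  moreover have "left_module R (G\<lparr>carrier := a_kernel G F d\<rparr>)"
    by (rule left_module_a_kernel[OF projective_module_D[OF G(1)] projective_module_D[OF F(1)] G(2)])
  ultimately show ?thesis using stable_retract_projective by auto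
qed

text \<open>The inverse of \<open>e\<close> makes \<open>M\<close> a retract of \<open>P\<close>,
  with zero as the stable correction.\<close>

lemma pd_le_0_iso:
  assumes P: "pd_le R 0 P" and M: "left_module R M" and e: "e \<in> left_module_hom R P M"
    "e ` carrier P = carrier M" "a_kernel P M e = {\<zero>\<^bsub>P\<^esub>}"
  shows "pd_le R 0 M"
proof -
  have P': "left_module R P" "projective_module R P" "fg_left_module R P"
    using P by (auto simp: projective_module_def)
  have inj: "inj_on e (carrier P)"
    using e(3) by (intro left_module_hom_inj_on[OF P'(1) M e(1)]) (auto simp: a_kernel_def')
  obtain g where g: "g \<in> left_module_hom R M P" "\<And>x. x \<in> carrier M \<Longrightarrow> e (g x) = x"
    using left_module_hom_factor[OF P'(1) e(1) inj left_module_hom_id] e(2) by blast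
  interpret M: left_module R M by fact
  have "stable_retract R M P"
    by (rule stable_retractI[OF g(1) e(1) P'(2) left_module_hom_const_zero[OF P'(1)] left_module_hom_const_zero[OF M]])
      (use g(2) in auto)
  then show ?thesis
    using stable_retract_projective[OF M P'(2)] fg_left_module_image[OF P'(3) M e(1,2)] by simp
qed

text \<open>\<open>M\<close> is presented by itself with kernel zero, and the zero module satisfies
  every bound, again by presenting itself.\<close>

lemma pd_le_0_Suc:
  assumes "pd_le R 0 M" shows "pd_le R (Suc k) M"
proof -
  have "pd_le R k M" if "left_module R M" "carrier M = {\<zero>\<^bsub>M\<^esub>}" for M :: "'a lmod"
    using that
  proof (induction k arbitrary: M)
    case 0
    then show ?case using trivial_module by auto
  next
    case (Suc k)
    have "a_kernel M M (\<lambda>x. x) = carrier M" using Suc(3) by (auto simp: a_kernel_def')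
    then have "M\<lparr>carrier := a_kernel M M (\<lambda>x. x)\<rparr> = M" by simp
    then show ?case using Suc trivial_module[OF Suc(2,3)] left_module_hom_id[of R M]
      by (auto intro!: exI[of _ M] exI[of _ "\<lambda>x. x"])
  qed
  note triv = this
  interpret M: left_module R M using assms by (simp add: projective_module_def)
  have "a_kernel M M (\<lambda>x. x) = {\<zero>\<^bsub>M\<^esub>}" by (auto simp: a_kernel_def')
  moreover have "pd_le R k (M\<lparr>carrier := {\<zero>\<^bsub>M\<^esub>}\<rparr>)"
    by (intro triv M.left_module_submodule M.submodule_zero) simp
  ultimately show ?thesis
    using assms left_module_hom_id[of R M] by (auto simp: projective_module_def intro!: exI[of _ M] exI[of _ "\<lambda>x. x"])
qed

lemma pd_le_Suc: "pd_le R k M \<Longrightarrow> pd_le R (Suc k) M"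
proof (induction k arbitrary: M)
  case 0
  then show ?case by (rule pd_le_0_Suc)
next
  case (Suc k)
  then show ?case by (subst pd_le.simps(2)) (auto simp del: pd_le.simps(2) simp: pd_le.simps(2)[of R k M])
qed

lemma pd_le_mono:
  assumes "pd_le R k M" "k \<le> l" shows "pd_le R l M"
  using assms(2) by (induction rule: dec_induct) (use assms(1) pd_le_Suc in blast)+

section \<open>Syzygy bounds and projective resolutions\<close>

lemma projective_resolutionD:
  assumes "projective_resolution R M P d e"
  shows "fg_left_module R (P i)" "projective_module R (P i)" "d i \<in> left_module_hom R (P (Suc i)) (P i)"
    "e \<in> left_module_hom R (P 0) M" "e ` carrier (P 0) = carrier M"
    "d 0 ` carrier (P (Suc 0)) = a_kernel (P 0) M e"
    "d (Suc i) ` carrier (P (Suc (Suc i))) = a_kernel (P (Suc i)) (P i) (d i)"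
  using assms by (simp_all add: projective_resolution_def)

text \<open>The presentation of \<open>M\<close> is spliced in front of a resolution of its kernel:
  the augmentation of the latter, regarded as a map into \<open>P0\<close>, becomes the differential
  in degree 0.\<close>

lemma pd_le_imp_resolution:
  assumes "pd_le R k M"
  shows "\<exists>P d e. projective_resolution R M P d e \<and> (\<forall>i>k. carrier (P i) = {\<zero>\<^bsub>P i\<^esub>})"
  using assms
proof (induction k arbitrary: M)
  case 0
  then have M: "left_module R M" "fg_left_module R M" "projective_module R M"
    by (auto simp: projective_module_def)
  interpret M: left_module R M by fact
  let ?Z = "M\<lparr>carrier := {\<zero>\<^bsub>M\<^esub>}\<rparr>"
  have Z: "left_module R ?Z" by (intro M.left_module_submodule M.submodule_zero)
  have triv: "fg_left_module R ?Z" "projective_module R ?Z" using trivial_module[OF Z] by auto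
  have "projective_resolution R M (\<lambda>i. if i = 0 then M else ?Z) (\<lambda>i x. \<zero>\<^bsub>M\<^esub>) (\<lambda>x. x)"
    unfolding projective_resolution_def
    using M triv left_module_hom_id[of R M] left_module_hom_const_zero[OF Z] left_module_hom_const_zero[OF M(1)]
    by (auto simp: a_kernel_def')
  then show ?case by (intro exI conjI) auto
next
  case (Suc k)
  then obtain P0 e0 where P0: "fg_left_module R P0" "projective_module R P0" "e0 \<in> left_module_hom R P0 M"
    "e0 ` carrier P0 = carrier M" "pd_le R k (P0\<lparr>carrier := a_kernel P0 M e0\<rparr>)"
    by auto
  let ?K = "P0\<lparr>carrier := a_kernel P0 M e0\<rparr>"
  obtain P d e where res: "projective_resolution R ?K P d e" "\<forall>i>k. carrier (P i) = {\<zero>\<^bsub>P i\<^esub>}"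
    using Suc.IH[OF P0(5)] by blast
  note r = projective_resolutionD[OF res(1)]
  have e: "e \<in> left_module_hom R (P 0) P0" "e ` carrier (P 0) = a_kernel P0 M e0"
    "a_kernel (P 0) ?K e = a_kernel (P 0) P0 e"
    using r(4,5) by (auto intro: left_module_hom_extend[where H = "a_kernel P0 M e0"] simp: a_kernel_def')
  let ?P = "\<lambda>i. case i of 0 \<Rightarrow> P0 | Suc j \<Rightarrow> P j"
  let ?d = "\<lambda>i. case i of 0 \<Rightarrow> e | Suc j \<Rightarrow> d j"
  have "projective_resolution R M ?P ?d e0"
    unfolding projective_resolution_def
  proof (intro conjI allI)
    fix i
    show "fg_left_module R (?P i)" "projective_module R (?P i)"
      using r(1,2) P0(1,2) by (auto split: nat.split)
    show "?d i \<in> left_module_hom R (?P (Suc i)) (?P i)"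
      using r(3) e(1) by (auto split: nat.split)
    show "?d (Suc i) ` carrier (?P (Suc (Suc i))) = a_kernel (?P (Suc i)) (?P i) (?d i)"
      using r(6,7) e(3) by (auto split: nat.split)
  qed (use P0(3,4) e(2) in simp_all)
  moreover have "carrier (?P i) = {\<zero>\<^bsub>?P i\<^esub>}" if "i > Suc k" for i
    using res(2) that by (cases i) auto
  ultimately show ?case by blast
qed

text \<open>Dropping \<open>P 0\<close> leaves a resolution of the kernel of \<open>e\<close>. At
  \<open>k = 0\<close> that kernel is the image of the zero module \<open>P 1\<close>, so
  \<open>e\<close> is an isomorphism.\<close>

lemma resolution_imp_pd_le:
  assumes "projective_resolution R M P d e" "\<forall>i>k. carrier (P i) = {\<zero>\<^bsub>P i\<^esub>}" "left_module R M"
  shows "pd_le R k M"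
  using assms
proof (induction k arbitrary: M P d e)
  case 0
  note r = projective_resolutionD[OF 0(1)]
  note P = fg_left_module_D[OF r(1)]
  have "d 0 ` carrier (P (Suc 0)) = {\<zero>\<^bsub>P 0\<^esub>}"
    using 0(2) left_module_hom_zero[OF P P r(3)] by simp
  then have "a_kernel (P 0) M e = {\<zero>\<^bsub>P 0\<^esub>}" using r(6) by simp
  then show ?case by (intro pd_le_0_iso[OF _ 0(3) r(4,5)]) (use r(1,2) in simp)
next
  case (Suc k)
  note r = projective_resolutionD[OF Suc(2)]
  note P = fg_left_module_D[OF r(1)]
  let ?K = "(P 0)\<lparr>carrier := a_kernel (P 0) M e\<rparr>"
  have K: "left_module R ?K" by (rule left_module_a_kernel[OF P Suc(4) r(4)])
  have d0: "d 0 \<in> left_module_hom R (P (Suc 0)) ?K"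
    by (intro left_module_hom_corestrict r(3)) (simp add: r(6))
  have "a_kernel (P (Suc 0)) ?K (d 0) = a_kernel (P (Suc 0)) (P 0) (d 0)"
    by (simp add: a_kernel_def')
  then have "projective_resolution R ?K (\<lambda>i. P (Suc i)) (\<lambda>i. d (Suc i)) (d 0)"
    unfolding projective_resolution_def using r(1-3,6,7) d0 by simp
  then have "pd_le R k ?K" by (rule Suc.IH) (use Suc(3) K in auto)
  then show ?case using r(1,2,4,5) Suc(4) by auto
qed

text \<open>The bounds on the length of resolutions form an upward closed set, and in
  \<open>enat\<close> the infimum of a nonempty set is attained.\<close>

lemma proj_dim_le_iff:
  assumes "left_module R M"
  shows "proj_dim R M \<le> enat k \<longleftrightarrow> pd_le R k M"
proof -
  define A where "A = {l. \<exists>P d e. projective_resolution R M P d e \<and> (\<forall>i>l. carrier (P i) = {\<zero>\<^bsub>P i\<^esub>})}"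
  have pd: "proj_dim R M = Inf (enat ` A)"
    unfolding proj_dim_def A_def by (rule arg_cong[of _ _ Inf]) auto
  have up: "m \<in> A" if "l \<in> A" "l \<le> m" for l m
  proof -
    have "\<forall>i>m. i > l" using that(2) by auto
    then show ?thesis using that(1) unfolding A_def by blast
  qed
  have "k \<in> A \<longleftrightarrow> pd_le R k M"
    unfolding A_def using pd_le_imp_resolution resolution_imp_pd_le[OF _ _ assms] by blast
  moreover have "Inf (enat ` A) \<le> enat k \<longleftrightarrow> k \<in> A"
  proof
    assume *: "Inf (enat ` A) \<le> enat k"
    then have "A \<noteq> {}" by (auto simp: top_enat_def)
    then have "Inf (enat ` A) \<in> enat ` A"
      unfolding Inf_enat_def by (auto intro: LeastI)
    then show "k \<in> A" using * up by auto
  qed (auto intro: Inf_lower)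
  ultimately show ?thesis using pd by simp
qed

section \<open>Direct sums and extensions\<close>

text \<open>The elements of a direct sum have to be functions \<open>nat \<Rightarrow> 'a\<close> again, so the two summands
  occupy the even and the odd arguments.\<close>

definition interleave :: "(nat \<Rightarrow> 'a) \<Rightarrow> (nat \<Rightarrow> 'a) \<Rightarrow> nat \<Rightarrow> 'a" where
  "interleave x y n = (if even n then x (n div 2) else y (n div 2))"

definition evens :: "(nat \<Rightarrow> 'a) \<Rightarrow> nat \<Rightarrow> 'a" where "evens z n = z (2 * n)"

definition odds :: "(nat \<Rightarrow> 'a) \<Rightarrow> nat \<Rightarrow> 'a" where "odds z n = z (2 * n + 1)"

lemma evens_interleave [simp]: "evens (interleave x y) = x"
  and odds_interleave [simp]: "odds (interleave x y) = y"
  by (auto simp: evens_def odds_def interleave_def)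

lemma interleave_evens_odds [simp]: "interleave (evens z) (odds z) = z"
  by (auto simp: evens_def odds_def interleave_def elim: oddE)

definition direct_sum :: "'a lmod \<Rightarrow> 'a lmod \<Rightarrow> 'a lmod" where
  "direct_sum M N = \<lparr>carrier = {z. evens z \<in> carrier M \<and> odds z \<in> carrier N},
     mult = \<lambda>_ _. undefined, one = \<lambda>_. undefined, ring.zero = interleave \<zero>\<^bsub>M\<^esub> \<zero>\<^bsub>N\<^esub>,
     add = (\<lambda>z w. interleave (evens z \<oplus>\<^bsub>M\<^esub> evens w) (odds z \<oplus>\<^bsub>N\<^esub> odds w)),
     smult = (\<lambda>a z. interleave (a \<odot>\<^bsub>M\<^esub> evens z) (a \<odot>\<^bsub>N\<^esub> odds z))\<rparr>"

lemma direct_sum_simps: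
  "carrier (direct_sum M N) = {z. evens z \<in> carrier M \<and> odds z \<in> carrier N}"
  "\<zero>\<^bsub>direct_sum M N\<^esub> = interleave \<zero>\<^bsub>M\<^esub> \<zero>\<^bsub>N\<^esub>"
  "z \<oplus>\<^bsub>direct_sum M N\<^esub> w = interleave (evens z \<oplus>\<^bsub>M\<^esub> evens w) (odds z \<oplus>\<^bsub>N\<^esub> odds w)"
  "a \<odot>\<^bsub>direct_sum M N\<^esub> z = interleave (a \<odot>\<^bsub>M\<^esub> evens z) (a \<odot>\<^bsub>N\<^esub> odds z)"
  by (simp_all add: direct_sum_def)

lemma left_module_direct_sum:
  assumes M: "left_module R M" and N: "left_module R N"
  shows "left_module R (direct_sum M N)"
proof -
  interpret M: left_module R M by fact
  interpret N: left_module R N by fact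
  have "abelian_group (direct_sum M N)"
  proof (rule abelian_groupI)
    fix z assume "z \<in> carrier (direct_sum M N)"
    then show "\<exists>w\<in>carrier (direct_sum M N). w \<oplus>\<^bsub>direct_sum M N\<^esub> z = \<zero>\<^bsub>direct_sum M N\<^esub>"
      by (intro bexI[of _ "interleave (\<ominus>\<^bsub>M\<^esub> evens z) (\<ominus>\<^bsub>N\<^esub> odds z)"])
        (auto simp: direct_sum_simps M.M.l_neg N.M.l_neg)
  qed (auto simp: direct_sum_simps M.M.a_ac N.M.a_ac)
  moreover have "left_module_axioms R (direct_sum M N)"
    by unfold_locales (auto simp: direct_sum_simps M.smult_l_distr M.smult_r_distr M.smult_assoc M.smult_one
      N.smult_l_distr N.smult_r_distr N.smult_assoc N.smult_one M.smult_closed N.smult_closed)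
  ultimately show ?thesis using M.R.ring_axioms by (simp add: left_module_def)
qed

lemma direct_sum_homs:
  assumes M: "left_module R M" and N: "left_module R N"
  shows "evens \<in> left_module_hom R (direct_sum M N) M" "odds \<in> left_module_hom R (direct_sum M N) N"
    "(\<lambda>x. interleave x \<zero>\<^bsub>N\<^esub>) \<in> left_module_hom R M (direct_sum M N)"
    "(\<lambda>y. interleave \<zero>\<^bsub>M\<^esub> y) \<in> left_module_hom R N (direct_sum M N)"
proof -
  interpret M: left_module R M by fact
  interpret N: left_module R N by fact
  show "evens \<in> left_module_hom R (direct_sum M N) M" "odds \<in> left_module_hom R (direct_sum M N) N"
    "(\<lambda>x. interleave x \<zero>\<^bsub>N\<^esub>) \<in> left_module_hom R M (direct_sum M N)"
    "(\<lambda>y. interleave \<zero>\<^bsub>M\<^esub> y) \<in> left_module_hom R N (direct_sum M N)"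
    by (rule left_module_homI; auto simp: direct_sum_simps)+
qed

text \<open>\<open>L\<close> is projective, so \<open>p\<close> has a section \<open>s\<close>; x -
  s (p x) lies in the kernel of \<open>p\<close>, which gives \<open>r\<close> with i r + s p = id.
  Thus \<open>M\<close> is a stable retract of \<open>N\<close>, with \<open>L\<close> as the
  projective module.\<close>

lemma pd_le_0_extension:
  assumes M: "left_module R M" and i: "i \<in> left_module_hom R N M" "inj_on i (carrier N)"
    and p: "p \<in> left_module_hom R M L" "p ` carrier M = carrier L"
    and ex: "i ` carrier N = a_kernel M L p" and NL: "pd_le R 0 N" "pd_le R 0 L"
  shows "pd_le R 0 M"
proof -
  have N: "left_module R N" "projective_module R N" "fg_left_module R N"
    and L: "left_module R L" "projective_module R L" "fg_left_module R L"
    using NL by (auto simp: projective_module_def)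
  interpret M: left_module R M by fact
  interpret N: left_module R N by fact
  interpret L: left_module R L by fact
  note D = left_module_homD[OF i(1)] left_module_homD[OF p(1)]
  obtain s where s: "s \<in> left_module_hom R L M" "\<And>x. x \<in> carrier L \<Longrightarrow> p (s x) = x"
    using projective_lift[OF L(2) M L(1) p left_module_hom_id] by blast
  let ?f = "\<lambda>x. x \<oplus>\<^bsub>M\<^esub> \<ominus>\<^bsub>M\<^esub> s (p x)"
  have f: "?f \<in> left_module_hom R M M"
    by (intro left_module_hom_add left_module_hom_uminus M left_module_hom_id left_module_hom_comp[OF p(1) s(1)])
  have "?f ` carrier M \<subseteq> i ` carrier N"
    unfolding ex using s(2)
    by (auto simp: a_kernel_def' D left_module_homD[OF s(1)] left_module_hom_minus[OF M L(1) p(1)] L.M.r_neg)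
  then obtain r where r: "r \<in> left_module_hom R M N" "\<And>x. x \<in> carrier M \<Longrightarrow> i (r x) = ?f x"
    using left_module_hom_factor[OF N(1) i f] by blast
  have "stable_retract R M N"
  proof (rule stable_retractI[OF r(1) i(1) L(2) p(1) s(1)])
    fix x assume "x \<in> carrier M"
    then show "i (r x) \<oplus>\<^bsub>M\<^esub> s (p x) = x"
      by (simp add: r(2) D left_module_homD[OF s(1)] M.M.a_assoc M.M.l_neg)
  qed
  then have "projective_module R M" by (rule stable_retract_projective[OF M N(2)])
  moreover have "fg_left_module R M"
  proof -
    obtain B where B: "finite B" "B \<subseteq> carrier N" "\<forall>H. submodule H R N \<and> B \<subseteq> H \<longrightarrow> H = carrier N"
      using N(3) by (elim fg_left_moduleE) (rule that)
    obtain C where C: "finite C" "C \<subseteq> carrier L" "\<forall>H. submodule H R L \<and> C \<subseteq> H \<longrightarrow> H = carrier L"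
      using L(3) by (elim fg_left_moduleE) (rule that)
    have "H = carrier M" if H: "submodule H R M" "i ` B \<union> s ` C \<subseteq> H" for H
    proof -
      note HD = M.submoduleD[OF H(1)]
      have "{x \<in> carrier N. i x \<in> H} = carrier N"
        using H B(2) by (intro B(3)[rule_format] conjI submodule_vimage[OF N(1) M i(1)]) auto
      moreover have "{x \<in> carrier L. s x \<in> H} = carrier L"
        using H C(2) by (intro C(3)[rule_format] conjI submodule_vimage[OF L(1) M s(1)]) auto
      ultimately have "i (r x) \<oplus>\<^bsub>M\<^esub> s (p x) \<in> H" if "x \<in> carrier M" for x
        using left_module_homD(1)[OF r(1) that] D(4)[OF that] by (intro HD(3)) auto
      moreover have "i (r x) \<oplus>\<^bsub>M\<^esub> s (p x) = x" if "x \<in> carrier M" for x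
        using that by (simp add: r(2) D left_module_homD[OF s(1)] M.M.a_assoc M.M.l_neg)
      ultimately show ?thesis using HD(1) by auto
    qed
    then show ?thesis
      unfolding fg_left_module_def using M B(1,2) C(1,2) D left_module_homD[OF s(1)]
      by (intro conjI exI[of _ "i ` B \<union> s ` C"]) auto
  qed
  ultimately show ?thesis by simp
qed

lemma pd_le_0_direct_sum:
  assumes "pd_le R 0 M" "pd_le R 0 N" shows "pd_le R 0 (direct_sum M N)"
proof -
  have M: "left_module R M" and N: "left_module R N" using assms pd_le_left_module by blast+
  note h = direct_sum_homs[OF M N]
  interpret M: left_module R M by fact
  interpret N: left_module R N by fact
  have "interleave x \<zero>\<^bsub>N\<^esub> = interleave y \<zero>\<^bsub>N\<^esub> \<Longrightarrow> x = y" for x y by (metis evens_interleave)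
  then have "inj_on (\<lambda>x. interleave x \<zero>\<^bsub>N\<^esub>) (carrier M)" by (auto intro: inj_onI)
  moreover have "odds ` carrier (direct_sum M N) = carrier N"
  proof
    show "carrier N \<subseteq> odds ` carrier (direct_sum M N)"
      by (auto simp: direct_sum_simps intro!: image_eqI[of _ _ "interleave \<zero>\<^bsub>M\<^esub> _"])
  qed (auto simp: direct_sum_simps)
  moreover have "(\<lambda>x. interleave x \<zero>\<^bsub>N\<^esub>) ` carrier M = a_kernel (direct_sum M N) N odds"
  proof
    show "a_kernel (direct_sum M N) N odds \<subseteq> (\<lambda>x. interleave x \<zero>\<^bsub>N\<^esub>) ` carrier M"
    proof
      fix z assume "z \<in> a_kernel (direct_sum M N) N odds"
      then have "evens z \<in> carrier M" "z = interleave (evens z) \<zero>\<^bsub>N\<^esub>"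
        using interleave_evens_odds[of z] by (auto simp: a_kernel_def' direct_sum_simps)
      then show "z \<in> (\<lambda>x. interleave x \<zero>\<^bsub>N\<^esub>) ` carrier M" by blast
    qed
  qed (auto simp: a_kernel_def' direct_sum_simps)
  ultimately show ?thesis
    using pd_le_0_extension[OF left_module_direct_sum[OF M N] h(3) _ h(2)] assms by blast
qed

lemma pd_le_SucI:
  assumes "left_module R M" "pd_le R 0 P" "e \<in> left_module_hom R P M" "e ` carrier P = carrier M"
    "pd_le R k (P\<lparr>carrier := a_kernel P M e\<rparr>)"
  shows "pd_le R (Suc k) M"
  unfolding pd_le.simps(2) using assms(1) assms(2)[unfolded pd_le.simps(1)] assms(3-5)
  by (intro conjI exI[of _ P] exI[of _ e]) simp_all

text \<open>The premise \<open>ext\<close> is the statement of \<open>pd_le_extension\<close> for \<open>k\<close>, which is proved from this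
  lemma by induction.\<close>

lemma pd_le_Suc_sum:
  assumes ext: "\<And>M N L :: 'a lmod. \<And>i p. \<lbrakk>left_module R M; i \<in> left_module_hom R N M; inj_on i (carrier N);
      p \<in> left_module_hom R M L; p ` carrier M = carrier L; i ` carrier N = a_kernel M L p;
      pd_le R k N; pd_le R k L\<rbrakk> \<Longrightarrow> pd_le R k M"
    and M: "left_module R M"
    and P: "pd_le R 0 P" "e \<in> left_module_hom R P M" "pd_le R k (P\<lparr>carrier := a_kernel P M e\<rparr>)"
    and Q: "pd_le R 0 Q" "q \<in> left_module_hom R Q M"
      "pd_le R k (Q\<lparr>carrier := {y \<in> carrier Q. q y \<in> e ` carrier P}\<rparr>)"
  defines "H \<equiv> (\<lambda>z. e (evens z) \<oplus>\<^bsub>M\<^esub> q (odds z)) ` carrier (direct_sum P Q)"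
  shows "submodule H R M" "pd_le R (Suc k) (M\<lparr>carrier := H\<rparr>)"
proof -
  note P' = pd_le_left_module[OF P(1)] and Q' = pd_le_left_module[OF Q(1)]
  let ?D = "direct_sum P Q" and ?E = "\<lambda>z. e (evens z) \<oplus>\<^bsub>M\<^esub> q (odds z)"
  note h = direct_sum_homs[OF P' Q'] and D = left_module_direct_sum[OF P' Q']
  interpret M: left_module R M by fact
  interpret P: left_module R P by (rule P')
  interpret Q: left_module R Q by (rule Q')
  interpret D: left_module R ?D by (rule D)
  note eq = left_module_homD[OF P(2)] left_module_homD[OF Q(2)]
    left_module_hom_zero[OF P' M P(2)] left_module_hom_zero[OF Q' M Q(2)]
  have E: "?E \<in> left_module_hom R ?D M"
    by (intro left_module_hom_add M left_module_hom_comp[OF h(1) P(2)] left_module_hom_comp[OF h(2) Q(2)])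
  show H: "submodule H R M" unfolding H_def by (rule submodule_image[OF D M E D.submodule_carrier])
  have MH: "left_module R (M\<lparr>carrier := H\<rparr>)" by (rule M.left_module_submodule[OF H])
  have E': "?E \<in> left_module_hom R ?D (M\<lparr>carrier := H\<rparr>)"
    by (intro left_module_hom_corestrict E) (simp add: H_def)
  \<comment> \<open>The syzygy \<open>K\<close> of \<open>H\<close> is analysed through
    \<open>odds\<close>: e x + q y = 0 can be solved for x iff q y lies in the image of
    \<open>e\<close>, so \<open>K\<close> maps onto \<open>T\<close>, with a copy of the kernel of
    \<open>e\<close> as its kernel. The premise \<open>ext\<close> applies to this sequence.\<close>
  define K where "K = a_kernel ?D (M\<lparr>carrier := H\<rparr>) ?E"
  have K: "K = {z. evens z \<in> carrier P \<and> odds z \<in> carrier Q \<and> e (evens z) \<oplus>\<^bsub>M\<^esub> q (odds z) = \<zero>\<^bsub>M\<^esub>}"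
    by (auto simp: K_def a_kernel_def' direct_sum_simps)
  define T where "T = {y \<in> carrier Q. q y \<in> e ` carrier P}"
  let ?i = "\<lambda>x. interleave x \<zero>\<^bsub>Q\<^esub>"
  have i: "?i \<in> left_module_hom R (P\<lparr>carrier := a_kernel P M e\<rparr>) (?D\<lparr>carrier := K\<rparr>)"
    by (intro left_module_hom_corestrict left_module_hom_restrict h(3)) (auto simp: a_kernel_def' K eq)
  have inj: "inj_on ?i (carrier (P\<lparr>carrier := a_kernel P M e\<rparr>))"
    by (rule inj_on_inverseI[of _ evens]) simp
  have o: "odds \<in> left_module_hom R (?D\<lparr>carrier := K\<rparr>) (Q\<lparr>carrier := T\<rparr>)"
  proof (intro left_module_hom_corestrict left_module_hom_restrict h(2))
    show "K \<subseteq> carrier ?D" by (auto simp: K direct_sum_simps)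
    show "odds ` carrier (?D\<lparr>carrier := K\<rparr>) \<subseteq> T"
    proof
      fix y assume "y \<in> odds ` carrier (?D\<lparr>carrier := K\<rparr>)"
      then obtain z where z: "evens z \<in> carrier P" "y = odds z" "odds z \<in> carrier Q"
        "e (evens z) \<oplus>\<^bsub>M\<^esub> q (odds z) = \<zero>\<^bsub>M\<^esub>" by (auto simp: K)
      then have "q y = \<ominus>\<^bsub>M\<^esub> e (evens z)"
        using M.M.minus_equality[of "q y" "e (evens z)"] by (simp add: eq M.M.a_comm)
      then have "q y = e (\<ominus>\<^bsub>P\<^esub> evens z)" using z by (simp add: left_module_hom_minus[OF P' M P(2)])
      then show "y \<in> T" unfolding T_def using z by auto
    qed
  qed
  have surj: "odds ` carrier (?D\<lparr>carrier := K\<rparr>) = carrier (Q\<lparr>carrier := T\<rparr>)"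
  proof
    show "odds ` carrier (?D\<lparr>carrier := K\<rparr>) \<subseteq> carrier (Q\<lparr>carrier := T\<rparr>)"
      using left_module_homD(1)[OF o] by auto
    show "carrier (Q\<lparr>carrier := T\<rparr>) \<subseteq> odds ` carrier (?D\<lparr>carrier := K\<rparr>)"
    proof
      fix y assume "y \<in> carrier (Q\<lparr>carrier := T\<rparr>)"
      then obtain x where "y \<in> carrier Q" "x \<in> carrier P" "q y = e x" by (auto simp: T_def)
      then show "y \<in> odds ` carrier (?D\<lparr>carrier := K\<rparr>)"
        by (intro image_eqI[of _ _ "interleave (\<ominus>\<^bsub>P\<^esub> x) y"])
          (auto simp: K left_module_hom_minus[OF P' M P(2)] eq M.M.l_neg)
    qed
  qed
  have ker: "?i ` carrier (P\<lparr>carrier := a_kernel P M e\<rparr>) = a_kernel (?D\<lparr>carrier := K\<rparr>) (Q\<lparr>carrier := T\<rparr>) odds"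
  proof
    show "a_kernel (?D\<lparr>carrier := K\<rparr>) (Q\<lparr>carrier := T\<rparr>) odds \<subseteq> ?i ` carrier (P\<lparr>carrier := a_kernel P M e\<rparr>)"
    proof
      fix z assume "z \<in> a_kernel (?D\<lparr>carrier := K\<rparr>) (Q\<lparr>carrier := T\<rparr>) odds"
      then have "evens z \<in> carrier P" "e (evens z) = \<zero>\<^bsub>M\<^esub>" "z = ?i (evens z)"
        using interleave_evens_odds[of z] by (auto simp: a_kernel_def' K eq)
      then show "z \<in> ?i ` carrier (P\<lparr>carrier := a_kernel P M e\<rparr>)"
        by (auto simp: a_kernel_def')
    qed
  qed (auto simp: a_kernel_def' K eq)
  have DK: "left_module R (?D\<lparr>carrier := K\<rparr>)"
    unfolding K_def by (rule left_module_a_kernel[OF D MH E'])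
  have kpd: "pd_le R k (?D\<lparr>carrier := K\<rparr>)"
    by (rule ext[OF DK i inj o surj ker P(3) Q(3)[folded T_def]])
  have "?E ` carrier ?D = carrier (M\<lparr>carrier := H\<rparr>)" by (simp add: H_def)
  then show "pd_le R (Suc k) (M\<lparr>carrier := H\<rparr>)"
    by (rule pd_le_SucI[OF MH pd_le_0_direct_sum[OF P(1) Q(1)] E' _ kpd[unfolded K_def]])
qed

text \<open>The horseshoe lemma: the presentation of \<open>L\<close> is lifted along
  \<open>p\<close> to \<open>q\<close>, and together with the presentation of \<open>N\<close> it
  covers \<open>M\<close>. As p q = d and the image of i e is the kernel of \<open>p\<close>, the
  preimage of that image under \<open>q\<close> is the kernel of \<open>d\<close>; so
  \<open>pd_le_Suc_sum\<close> asks just for the two given bounds on syzygies.\<close>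

lemma pd_le_extension:
  fixes M N L :: "'a lmod"
  assumes "left_module R M" "i \<in> left_module_hom R N M" "inj_on i (carrier N)"
    "p \<in> left_module_hom R M L" "p ` carrier M = carrier L" "i ` carrier N = a_kernel M L p"
    "pd_le R k N" "pd_le R k L"
  shows "pd_le R k M"
  using assms
proof (induction k arbitrary: M N L i p)
  case 0
  then show ?case by (rule pd_le_0_extension)
next
  case (Suc k)
  note M = Suc(2) and i = Suc(3,4) and p = Suc(5,6) and ex = Suc(7)
  obtain P e where P: "pd_le R 0 P" and e: "e \<in> left_module_hom R P N" "e ` carrier P = carrier N"
    "pd_le R k (P\<lparr>carrier := a_kernel P N e\<rparr>)" using Suc(8) by auto
  obtain Q d where Q: "pd_le R 0 Q" and d: "d \<in> left_module_hom R Q L" "d ` carrier Q = carrier L"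
    "pd_le R k (Q\<lparr>carrier := a_kernel Q L d\<rparr>)" using Suc(9) by auto
  note N = pd_le_left_module[OF Suc(8)] and L = pd_le_left_module[OF Suc(9)]
  interpret M: left_module R M by fact
  interpret N: left_module R N by fact
  interpret L: left_module R L by fact
  obtain q where q: "q \<in> left_module_hom R Q M" "\<And>y. y \<in> carrier Q \<Longrightarrow> p (q y) = d y"
    using projective_lift[OF _ M L p d(1)] Q by auto
  let ?e = "\<lambda>x. i (e x)"
  have e': "?e \<in> left_module_hom R P M" by (rule left_module_hom_comp[OF e(1) i(1)])
  have img: "?e ` carrier P = a_kernel M L p" unfolding ex[symmetric] e(2)[symmetric] by (simp add: image_image)
  have "i x = \<zero>\<^bsub>M\<^esub> \<longleftrightarrow> x = \<zero>\<^bsub>N\<^esub>" if "x \<in> carrier N" for x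
    using inj_onD[OF i(2), of x "\<zero>\<^bsub>N\<^esub>"] left_module_hom_zero[OF N M i(1)] that by auto
  then have "a_kernel P M ?e = a_kernel P N e"
    using left_module_homD(1)[OF e(1)] by (auto simp: a_kernel_def')
  moreover have "{y \<in> carrier Q. q y \<in> ?e ` carrier P} = a_kernel Q L d"
    unfolding img using q left_module_homD(1)[OF q(1)] by (auto simp: a_kernel_def')
  moreover have "(\<lambda>z. ?e (evens z) \<oplus>\<^bsub>M\<^esub> q (odds z)) ` carrier (direct_sum P Q) = carrier M"
  proof
    show "carrier M \<subseteq> (\<lambda>z. ?e (evens z) \<oplus>\<^bsub>M\<^esub> q (odds z)) ` carrier (direct_sum P Q)"
    proof
      fix m assume m: "m \<in> carrier M"
      then have "p m \<in> d ` carrier Q" using p d(2) left_module_homD(1) by blast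
      then obtain y where y: "y \<in> carrier Q" "p m = d y" by auto
      have qy: "q y \<in> carrier M" using left_module_homD(1)[OF q(1)] y by blast
      have "m \<oplus>\<^bsub>M\<^esub> \<ominus>\<^bsub>M\<^esub> q y \<in> a_kernel M L p"
        using m qy y q(2)[OF y(1)] left_module_homD(1)[OF p(1) m]
        by (simp add: a_kernel_def' left_module_homD[OF p(1)] left_module_hom_minus[OF M L p(1)] L.M.r_neg)
      then obtain x where x: "x \<in> carrier P" "m \<oplus>\<^bsub>M\<^esub> \<ominus>\<^bsub>M\<^esub> q y = ?e x" unfolding img[symmetric] by auto
      have "m = ?e x \<oplus>\<^bsub>M\<^esub> q y" using m qy by (simp add: x(2)[symmetric] M.M.a_assoc M.M.l_neg)
      then show "m \<in> (\<lambda>z. ?e (evens z) \<oplus>\<^bsub>M\<^esub> q (odds z)) ` carrier (direct_sum P Q)"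
        using x(1) y(1) by (intro image_eqI[of _ _ "interleave x y"]) (auto simp: direct_sum_simps)
    qed
  qed (use left_module_homD(1)[OF e'] left_module_homD(1)[OF q(1)] in \<open>auto simp: direct_sum_simps\<close>)
  moreover have "pd_le R (Suc k) (M\<lparr>carrier := (\<lambda>z. ?e (evens z) \<oplus>\<^bsub>M\<^esub> q (odds z)) ` carrier (direct_sum P Q)\<rparr>)"
    if "pd_le R k (P\<lparr>carrier := a_kernel P M ?e\<rparr>)" "pd_le R k (Q\<lparr>carrier := {y \<in> carrier Q. q y \<in> ?e ` carrier P}\<rparr>)"
    by (rule pd_le_Suc_sum(2)[OF _ M P e' that(1) Q q(1) that(2)]) (rule Suc.IH)
  ultimately have "pd_le R (Suc k) (M\<lparr>carrier := carrier M\<rparr>)"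
    using e(3) d(3) by (simp del: pd_le.simps)
  then show ?case by (simp del: pd_le.simps)
qed

text \<open>Here \<open>H\<close> is N + q(Q), and H / N is \<open>Q\<close> modulo the preimage of
  \<open>N\<close>. The bound \<open>k\<close> on that preimage stands for the bound
  \<open>Suc k\<close> on H / N, without any quotient being formed.\<close>

lemma pd_le_adjoin:
  fixes M Q :: "'a lmod"
  assumes M: "left_module R M" and N: "submodule N R M" "pd_le R (Suc k) (M\<lparr>carrier := N\<rparr>)"
    and Q: "pd_le R 0 Q" "q \<in> left_module_hom R Q M" "pd_le R k (Q\<lparr>carrier := {y \<in> carrier Q. q y \<in> N}\<rparr>)"
  obtains H where "submodule H R M" "N \<subseteq> H" "q ` carrier Q \<subseteq> H" "pd_le R (Suc k) (M\<lparr>carrier := H\<rparr>)"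
proof -
  interpret M: left_module R M by fact
  obtain P e where P: "pd_le R 0 P" and e: "e \<in> left_module_hom R P (M\<lparr>carrier := N\<rparr>)" "e ` carrier P = N"
    "pd_le R k (P\<lparr>carrier := a_kernel P (M\<lparr>carrier := N\<rparr>) e\<rparr>)" using N(2) by auto
  interpret P: left_module R P by (rule pd_le_left_module[OF P])
  interpret Q: left_module R Q by (rule pd_le_left_module[OF Q(1)])
  have e': "e \<in> left_module_hom R P M"
    by (rule left_module_hom_extend[OF e(1) M.submoduleD(1)[OF N(1)]])
  have "a_kernel P (M\<lparr>carrier := N\<rparr>) e = a_kernel P M e" by (simp add: a_kernel_def')
  then have ker: "pd_le R k (P\<lparr>carrier := a_kernel P M e\<rparr>)" using e(3) by simp
  let ?H = "(\<lambda>z. e (evens z) \<oplus>\<^bsub>M\<^esub> q (odds z)) ` carrier (direct_sum P Q)"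
  have H: "submodule ?H R M" "pd_le R (Suc k) (M\<lparr>carrier := ?H\<rparr>)"
    by (rule pd_le_Suc_sum[OF _ M P e' ker Q(1,2)], rule pd_le_extension, assumption+, simp only: e(2) Q(3))+
  note eq = left_module_homD(1)[OF e'] left_module_homD(1)[OF Q(2)]
    left_module_hom_zero[OF P.left_module_axioms M e'] left_module_hom_zero[OF Q.left_module_axioms M Q(2)]
  have "N \<subseteq> ?H"
  proof
    fix n assume "n \<in> N"
    then obtain x where "x \<in> carrier P" "n = e x" using e(2) by auto
    then show "n \<in> ?H"
      by (intro image_eqI[of _ _ "interleave x \<zero>\<^bsub>Q\<^esub>"]) (auto simp: direct_sum_simps eq)
  qed
  moreover have "q ` carrier Q \<subseteq> ?H"
  proof
    fix m assume "m \<in> q ` carrier Q"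
    then obtain y where "y \<in> carrier Q" "m = q y" by auto
    then show "m \<in> ?H"
      by (intro image_eqI[of _ _ "interleave \<zero>\<^bsub>P\<^esub> y"]) (auto simp: direct_sum_simps eq)
  qed
  ultimately show thesis using H that by blast
qed

section \<open>Cyclic left ideals\<close>

context ring
begin

text \<open>Module elements are functions on the natural numbers, so a ring element is stored at
  argument 0, recovered as \<open>x 0\<close>, and padded with zeros.\<close>

definition emb :: "'a \<Rightarrow> nat \<Rightarrow> 'a" where
  "emb a n = (if n = 0 then a else \<zero>)"

definition regular_module :: "'a lmod" where
  "regular_module = \<lparr>carrier = emb ` carrier R, mult = \<lambda>_ _. undefined, one = \<lambda>_. undefined,
     ring.zero = emb \<zero>, add = (\<lambda>x y. emb (x 0 \<oplus> y 0)), smult = (\<lambda>r x. emb (r \<otimes> x 0))\<rparr>"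

definition cyclic_ideal :: "'a \<Rightarrow> 'a lmod" where
  "cyclic_ideal a = regular_module\<lparr>carrier := {emb (r \<otimes> a) | r. r \<in> carrier R}\<rparr>"

lemma emb_0 [simp]: "emb a 0 = a"
  by (simp add: emb_def)

lemma emb_eq_iff [simp]: "emb a = emb b \<longleftrightarrow> a = b"
  by (metis emb_0)

lemma regular_module_simps [simp]:
  "carrier regular_module = emb ` carrier R" "\<zero>\<^bsub>regular_module\<^esub> = emb \<zero>"
  "x \<oplus>\<^bsub>regular_module\<^esub> y = emb (x 0 \<oplus> y 0)" "r \<odot>\<^bsub>regular_module\<^esub> x = emb (r \<otimes> x 0)"
  by (simp_all add: regular_module_def)

lemma cyclic_ideal_simps [simp]:
  "carrier (cyclic_ideal a) = {emb (r \<otimes> a) | r. r \<in> carrier R}" "\<zero>\<^bsub>cyclic_ideal a\<^esub> = emb \<zero>"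
  "x \<oplus>\<^bsub>cyclic_ideal a\<^esub> y = emb (x 0 \<oplus> y 0)" "r \<odot>\<^bsub>cyclic_ideal a\<^esub> x = emb (r \<otimes> x 0)"
  by (simp_all add: cyclic_ideal_def)

lemma left_module_regular: "left_module R regular_module"
proof -
  have "abelian_group regular_module"
  proof (rule abelian_groupI)
    fix x assume "x \<in> carrier regular_module"
    then show "\<exists>y\<in>carrier regular_module. y \<oplus>\<^bsub>regular_module\<^esub> x = \<zero>\<^bsub>regular_module\<^esub>"
      by (intro bexI[of _ "emb (\<ominus> (x 0))"]) (auto simp: l_neg)
  qed (auto simp: a_ac)
  moreover have "left_module_axioms R regular_module"
    by unfold_locales (auto simp: l_distr r_distr m_assoc)
  ultimately show ?thesis using ring_axioms by (simp add: left_module_def)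
qed

text \<open>The homomorphism that sends the identity to \<open>m\<close>; its restrictions to left
  ideals supply the explicit maps below.\<close>

lemma act_hom:
  assumes "left_module R M" "m \<in> carrier M"
  shows "(\<lambda>x. x 0 \<odot>\<^bsub>M\<^esub> m) \<in> left_module_hom R regular_module M"
proof -
  interpret M: left_module R M by fact
  show ?thesis using assms(2)
    by (intro left_module_homI) (auto simp: M.smult_l_distr M.smult_assoc M.smult_closed)
qed

lemma submodule_cyclic_ideal:
  assumes "a \<in> carrier R"
  shows "submodule {emb (r \<otimes> a) | r. r \<in> carrier R} R regular_module"
proof -
  have "emb a \<in> carrier regular_module" using assms by simp
  from submodule_image[OF left_module_regular left_module_regular act_hom[OF left_module_regular this]
      left_module.submodule_carrier[OF left_module_regular]]
  have "submodule ((\<lambda>x. x 0 \<odot>\<^bsub>regular_module\<^esub> emb a) ` carrier regular_module) R regular_module" .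
  also have "(\<lambda>x. x 0 \<odot>\<^bsub>regular_module\<^esub> emb a) ` carrier regular_module = {emb (r \<otimes> a) | r. r \<in> carrier R}"
    by (auto simp: image_image)
  finally show ?thesis .
qed

lemma left_module_cyclic_ideal: "a \<in> carrier R \<Longrightarrow> left_module R (cyclic_ideal a)"
  unfolding cyclic_ideal_def by (rule left_module.left_module_submodule[OF left_module_regular submodule_cyclic_ideal])

lemma act_hom_cyclic_ideal:
  assumes "left_module R M" "m \<in> carrier M" "a \<in> carrier R"
  shows "(\<lambda>x. x 0 \<odot>\<^bsub>M\<^esub> m) \<in> left_module_hom R (cyclic_ideal a) M"
  unfolding cyclic_ideal_def using assms(3)
  by (intro left_module_hom_restrict act_hom assms) auto

lemma fg_cyclic_ideal:
  assumes a: "a \<in> carrier R" shows "fg_left_module R (cyclic_ideal a)"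
proof -
  interpret I: left_module R "cyclic_ideal a" by (rule left_module_cyclic_ideal[OF a])
  have gen: "emb a \<in> carrier (cyclic_ideal a)" using a by (auto intro!: exI[of _ \<one>])
  have "H = carrier (cyclic_ideal a)" if H: "submodule H R (cyclic_ideal a)" "{emb a} \<subseteq> H" for H
  proof
    show "carrier (cyclic_ideal a) \<subseteq> H"
    proof
      fix x assume "x \<in> carrier (cyclic_ideal a)"
      then obtain r where "r \<in> carrier R" "x = emb (r \<otimes> a)" by auto
      then show "x \<in> H" using I.submoduleD(4)[OF H(1), of r "emb a"] H(2) by simp
    qed
  qed (rule I.submoduleD(1)[OF H(1)])
  then show ?thesis
    unfolding fg_left_module_def using I.left_module_axioms gen by (auto intro!: exI[of _ "{emb a}"] simp del: cyclic_ideal_simps)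
qed

text \<open>For a preimage \<open>m\<close> of g a the map x \<mapsto> x m is a lift:
  \<open>f\<close> takes (r a) m to (r a) (g a) = g (r a a) = g (r a).\<close>

lemma projective_cyclic_ideal:
  assumes a: "a \<in> carrier R" "a \<otimes> a = a" shows "projective_module R (cyclic_ideal a)"
  unfolding projective_module_def
proof (intro conjI allI impI)
  show "left_module R (cyclic_ideal a)" by (rule left_module_cyclic_ideal[OF a(1)])
  fix M N :: "'a lmod" and f g
  assume *: "left_module R M \<and> left_module R N \<and> f \<in> left_module_hom R M N \<and>
    f ` carrier M = carrier N \<and> g \<in> left_module_hom R (cyclic_ideal a) N"
  then have M: "left_module R M" and f: "f \<in> left_module_hom R M N" "f ` carrier M = carrier N"
    and g: "g \<in> left_module_hom R (cyclic_ideal a) N" by auto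
  have gen: "emb a \<in> carrier (cyclic_ideal a)" using a by (auto intro!: exI[of _ \<one>])
  have "g (emb a) \<in> f ` carrier M" using left_module_homD(1)[OF g gen] f(2) by simp
  then obtain m where m: "m \<in> carrier M" "f m = g (emb a)" by auto
  have "f (x 0 \<odot>\<^bsub>M\<^esub> m) = g x" if x: "x \<in> carrier (cyclic_ideal a)" for x
  proof -
    obtain r where r: "r \<in> carrier R" "x = emb (r \<otimes> a)" using x by auto
    then have "f (x 0 \<odot>\<^bsub>M\<^esub> m) = (r \<otimes> a) \<odot>\<^bsub>N\<^esub> g (emb a)"
      using left_module_homD(3)[OF f(1), of "r \<otimes> a" m] m a by simp
    also have "\<dots> = g ((r \<otimes> a) \<odot>\<^bsub>cyclic_ideal a\<^esub> emb a)"
      using left_module_homD(3)[OF g _ gen, of "r \<otimes> a"] r a by simp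
    also have "\<dots> = g x" using r a by (simp add: m_assoc)
    finally show ?thesis .
  qed
  then show "\<exists>h\<in>left_module_hom R (cyclic_ideal a) M. \<forall>x\<in>carrier (cyclic_ideal a). f (h x) = g x"
    by (intro bexI[OF _ act_hom_cyclic_ideal[OF M m(1) a(1)]] ballI)
qed

end

section \<open>Rings whose indecomposable projectives are uniserial\<close>

text \<open>In the application \<open>p x i\<close> is the residue class of the path with \<open>i\<close> arrows that starts at
  the vertex \<open>x\<close>, \<open>\<sigma> x\<close> is the end of the arrow starting at \<open>x\<close>, and \<open>l x\<close> is the length
  of the projective module \<open>P(x) = R e\<^sub>x\<close> with \<open>e\<^sub>x = p x 0\<close>. The submodules of \<open>P(x)\<close> are the
  \<open>R (p x i)\<close>; the assumptions \<open>local\<close> and \<open>proper\<close> say that \<open>R (p x 1)\<close> is the largest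
  proper one.\<close>

locale uniserial_ring = ring R for R (structure) +
  fixes V :: "nat set" and \<sigma> :: "nat \<Rightarrow> nat" and l :: "nat \<Rightarrow> nat" and p :: "nat \<Rightarrow> nat \<Rightarrow> 'a"
  assumes finite_V: "finite V"
    and p_closed [simp]: "x \<in> V \<Longrightarrow> p x i \<in> carrier R"
    and p_mult: "\<lbrakk>x \<in> V; y \<in> V\<rbrakk> \<Longrightarrow> p y j \<otimes> p x i = (if y = (\<sigma> ^^ i) x then p x (i + j) else \<zero>)"
    and p_eq_zero_iff: "x \<in> V \<Longrightarrow> p x i = \<zero> \<longleftrightarrow> l x \<le> i"
    and step: "\<lbrakk>x \<in> V; i < l x\<rbrakk> \<Longrightarrow> (\<sigma> ^^ i) x \<in> V"
    and sum_idem: "(\<Oplus>x\<in>V. p x 0) = \<one>"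
    and local: "\<lbrakk>x \<in> V; r \<in> carrier R\<rbrakk> \<Longrightarrow>
      (\<exists>s\<in>carrier R. r \<otimes> p x 0 = s \<otimes> p x 1) \<or> (\<exists>u\<in>carrier R. u \<otimes> (r \<otimes> p x 0) = p x 0)"
    and proper: "\<lbrakk>x \<in> V; s \<in> carrier R\<rbrakk> \<Longrightarrow> s \<otimes> p x 1 \<noteq> p x 0"
begin

abbreviation I :: "nat \<Rightarrow> nat \<Rightarrow> 'a lmod" where
  "I x i \<equiv> cyclic_ideal (p x i)"

lemma p_mult_same: "\<lbrakk>x \<in> V; i < l x\<rbrakk> \<Longrightarrow> p ((\<sigma> ^^ i) x) j \<otimes> p x i = p x (i + j)"
  using p_mult[of x "(\<sigma> ^^ i) x" j i] step by simp

lemma p_mult_0: "x \<in> V \<Longrightarrow> p x i \<otimes> p x 0 = p x i"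
  using p_mult[of x x i 0] by simp

lemma p_0_mult: "\<lbrakk>x \<in> V; i < l x\<rbrakk> \<Longrightarrow> p ((\<sigma> ^^ i) x) 0 \<otimes> p x i = p x i"
  using p_mult_same[of x i 0] by simp

text \<open>A path through \<open>(\<sigma> ^^ i) x\<close> vanishes as soon as its part after that
  vertex does.\<close>

lemma l_step: assumes "x \<in> V" "i < l x" shows "l x - i \<le> l ((\<sigma> ^^ i) x)"
proof (rule ccontr)
  assume "\<not> l x - i \<le> l ((\<sigma> ^^ i) x)"
  then have *: "i + l ((\<sigma> ^^ i) x) < l x" by simp
  have "p ((\<sigma> ^^ i) x) (l ((\<sigma> ^^ i) x)) = \<zero>" using p_eq_zero_iff[OF step[OF assms]] by simp
  then have "p x (i + l ((\<sigma> ^^ i) x)) = \<zero>" using p_mult_same[OF assms, symmetric] assms by simp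
  then show False using p_eq_zero_iff[OF assms(1)] * by simp
qed

lemma pd_le_0_projective: "x \<in> V \<Longrightarrow> pd_le R 0 (I x 0)"
  using fg_cyclic_ideal[of "p x 0"] projective_cyclic_ideal[of "p x 0"] p_mult_0[of x 0] by simp

text \<open>Put y = \<open>(\<sigma> ^^ i) x\<close>. An element that kills \<open>p x i\<close> is
  pushed down the chain of left ideals R (p y k). If the coefficient \<open>s\<close> did not move
  on to the next ideal, it would be left invertible at \<open>z\<close>; then p y k would be a
  multiple of r e_y, and multiplication with \<open>p x i\<close> would give p x (i + k) = 0
  although i + k < l x.\<close>

lemma right_mult_kernel:
  assumes x: "x \<in> V" "i < l x" and r: "r \<in> carrier R" "r \<otimes> p x i = \<zero>" and k: "k \<le> l x - i"
  shows "\<exists>s\<in>carrier R. r \<otimes> p ((\<sigma> ^^ i) x) 0 = s \<otimes> p ((\<sigma> ^^ i) x) k"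
  using k
proof (induction k)
  case 0
  then show ?case using r by auto
next
  case (Suc k)
  define y where "y = (\<sigma> ^^ i) x"
  have y: "y \<in> V" using step[OF x] by (simp add: y_def)
  have yk: "k < l y" using l_step[OF x] Suc(2) by (simp add: y_def)
  define z where "z = (\<sigma> ^^ k) y"
  have z: "z \<in> V" using step[OF y yk] by (simp add: z_def)
  obtain s where s: "s \<in> carrier R" "r \<otimes> p y 0 = s \<otimes> p y k" using Suc by (auto simp: y_def)
  from local[OF z s(1)] show ?case
  proof
    assume "\<exists>s'\<in>carrier R. s \<otimes> p z 0 = s' \<otimes> p z 1"
    then obtain s' where s': "s' \<in> carrier R" "s \<otimes> p z 0 = s' \<otimes> p z 1" by auto
    have "s \<otimes> p y k = (s \<otimes> p z 0) \<otimes> p y k" using p_0_mult[OF y yk] s z y by (simp add: z_def m_assoc)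
    also have "\<dots> = s' \<otimes> p y (Suc k)"
      using p_mult_same[OF y yk, of 1] s' z y by (simp add: z_def[symmetric] m_assoc)
    finally show ?thesis using s s' by (auto simp: y_def)
  next
    assume "\<exists>u\<in>carrier R. u \<otimes> (s \<otimes> p z 0) = p z 0"
    then obtain u where u: "u \<in> carrier R" "u \<otimes> (s \<otimes> p z 0) = p z 0" by auto
    have "p y k = p z 0 \<otimes> p y k" using p_0_mult[OF y yk] by (simp add: z_def)
    also have "\<dots> = u \<otimes> (s \<otimes> p z 0) \<otimes> p y k" by (simp only: u(2))
    also have "\<dots> = u \<otimes> (s \<otimes> (p z 0 \<otimes> p y k))" using u(1) s z y by (simp add: m_assoc)
    also have "\<dots> = u \<otimes> (r \<otimes> p y 0)" using p_0_mult[OF y yk] s by (simp add: z_def)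
    finally have "p x (i + k) = u \<otimes> (r \<otimes> p y 0) \<otimes> p x i" using p_mult_same[OF x, of k] by (simp add: y_def)
    also have "\<dots> = \<zero>" using u r y x p_0_mult[OF x] by (simp add: m_assoc y_def)
    finally show ?thesis using p_eq_zero_iff[OF x(1)] Suc(2) by auto
  qed
qed

text \<open>Right multiplication by \<open>p x i\<close> is the projective presentation of R (p x
  i). Its kernel is again an ideal of this form, so the class is closed under these
  syzygies.\<close>

lemma right_mult:
  assumes x: "x \<in> V" "i < l x"
  defines "f \<equiv> \<lambda>z. z 0 \<odot>\<^bsub>I x i\<^esub> emb (p x i)"
  shows "f \<in> left_module_hom R (I ((\<sigma> ^^ i) x) 0) (I x i)"
    "f ` carrier (I ((\<sigma> ^^ i) x) 0) = carrier (I x i)"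
    "(I ((\<sigma> ^^ i) x) 0)\<lparr>carrier := a_kernel (I ((\<sigma> ^^ i) x) 0) (I x i) f\<rparr> = I ((\<sigma> ^^ i) x) (l x - i)"
proof -
  define y where "y = (\<sigma> ^^ i) x"
  have y: "y \<in> V" using step[OF x] by (simp add: y_def)
  have px: "p x i \<in> carrier R" using x by simp
  have yx: "p y j \<otimes> p x i = p x (i + j)" for j using p_mult_same[OF x] by (simp add: y_def)
  have "emb (p x i) \<in> carrier (I x i)" using px by (auto intro!: exI[of _ \<one>])
  then show "f \<in> left_module_hom R (I ((\<sigma> ^^ i) x) 0) (I x i)"
    unfolding f_def y_def[symmetric] using y by (intro act_hom_cyclic_ideal left_module_cyclic_ideal px) auto
  have f: "f (emb (r \<otimes> p y 0)) = emb (r \<otimes> p x i)" if "r \<in> carrier R" for r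
    using that y px yx[of 0] by (simp add: f_def m_assoc)
  show "f ` carrier (I ((\<sigma> ^^ i) x) 0) = carrier (I x i)"
    unfolding y_def[symmetric] using f by (auto simp: image_iff) (metis f)
  have "a_kernel (I y 0) (I x i) f = carrier (I y (l x - i))"
  proof
    show "a_kernel (I y 0) (I x i) f \<subseteq> carrier (I y (l x - i))"
    proof
      fix z assume "z \<in> a_kernel (I y 0) (I x i) f"
      then obtain r where r: "r \<in> carrier R" "z = emb (r \<otimes> p y 0)" "r \<otimes> p x i = \<zero>"
        using f by (auto simp: a_kernel_def')
      then show "z \<in> carrier (I y (l x - i))"
        using right_mult_kernel[OF x r(1,3), of "l x - i"] by (auto simp: y_def)
    qed
    show "carrier (I y (l x - i)) \<subseteq> a_kernel (I y 0) (I x i) f"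
    proof
      fix z assume "z \<in> carrier (I y (l x - i))"
      then obtain r where r: "r \<in> carrier R" "z = emb (r \<otimes> p y (l x - i))" by auto
      let ?r = "r \<otimes> p y (l x - i)"
      have "?r \<otimes> p x i = \<zero>" using r y x yx[of "l x - i"] p_eq_zero_iff[OF x(1), of "l x"] by (simp add: m_assoc)
      moreover have "z = emb (?r \<otimes> p y 0)" using r y p_mult_0[OF y] by (simp add: m_assoc)
      ultimately show "z \<in> a_kernel (I y 0) (I x i) f" using r y f[of ?r] by (auto simp: a_kernel_def')
    qed
  qed
  then show "(I ((\<sigma> ^^ i) x) 0)\<lparr>carrier := a_kernel (I ((\<sigma> ^^ i) x) 0) (I x i) f\<rparr> = I ((\<sigma> ^^ i) x) (l x - i)"
    unfolding y_def[symmetric] by (simp add: cyclic_ideal_def)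
qed

section \<open>Projectivity of the ideals R (p x i)\<close>

lemma trivial_cyclic_ideal: "x \<in> V \<Longrightarrow> l x \<le> i \<Longrightarrow> carrier (I x i) = {\<zero>\<^bsub>I x i\<^esub>}"
  using p_eq_zero_iff[of x i] by (auto intro!: exI[of _ \<zero>])

lemma pd_le_trivial_cyclic_ideal:
  assumes "x \<in> V" "l x \<le> i" shows "pd_le R k (I x i)"
proof (rule pd_le_mono[OF _ le0])
  have "left_module R (I x i)" using assms by (intro left_module_cyclic_ideal) auto
  from trivial_module[OF this trivial_cyclic_ideal[OF assms]] show "pd_le R 0 (I x i)" by simp
qed

text \<open>If the lengths agree, the presentation in \<open>right_mult\<close> has zero kernel.
  Conversely a splitting \<open>g\<close> sends the generator to some r e_y that is left invertible,
  and this forces the kernel element p y (l x - i) to vanish.\<close>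

lemma projective_cyclic_ideal_iff:
  assumes x: "x \<in> V" "i < l x"
  shows "projective_module R (I x i) \<longleftrightarrow> l ((\<sigma> ^^ i) x) = l x - i"
proof
  let ?y = "(\<sigma> ^^ i) x"
  note y = step[OF x] and rm = right_mult[OF x]
  have px: "p x i \<in> carrier R" using x by simp
  note Lx = left_module_cyclic_ideal[OF px] and Ly = left_module_cyclic_ideal[OF p_closed[OF y]]
  {
    assume "l ?y = l x - i"
    then have "carrier (I ?y (l x - i)) = {\<zero>\<^bsub>I ?y 0\<^esub>}" using trivial_cyclic_ideal[OF y] by simp
    then have "a_kernel (I ?y 0) (I x i) (\<lambda>z. z 0 \<odot>\<^bsub>I x i\<^esub> emb (p x i)) = {\<zero>\<^bsub>I ?y 0\<^esub>}"
      using arg_cong[OF rm(3), of carrier] by simp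
    from pd_le_0_iso[OF pd_le_0_projective[OF y] Lx rm(1,2) this]
    show "projective_module R (I x i)" by simp
  next
    assume proj: "projective_module R (I x i)"
    obtain g where g: "g \<in> left_module_hom R (I x i) (I ?y 0)"
      "\<And>z. z \<in> carrier (I x i) \<Longrightarrow> (g z) 0 \<odot>\<^bsub>I x i\<^esub> emb (p x i) = z"
      using projective_lift[OF proj Ly Lx rm(1,2) left_module_hom_id] by blast
    have gen: "emb (p x i) \<in> carrier (I x i)" using px by (auto intro!: exI[of _ \<one>])
    obtain r where r: "r \<in> carrier R" "g (emb (p x i)) = emb (r \<otimes> p ?y 0)"
      using left_module_homD(1)[OF g(1) gen] by auto
    have rp: "r \<otimes> p x i = p x i"
      using g(2)[OF gen] r x y px p_0_mult[OF x] by (simp add: m_assoc)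
    have "\<exists>u\<in>carrier R. u \<otimes> (r \<otimes> p ?y 0) = p ?y 0"
    proof (rule ccontr)
      \<comment> \<open>In this case e_y - s (p y 1) kills \<open>p x i\<close>. By
        \<open>proper\<close> it is not in R (p y 1), so by \<open>local\<close> it is left
        invertible, and p x i = 0 follows.\<close>
      assume "\<not> ?thesis"
      then obtain s where s: "s \<in> carrier R" "r \<otimes> p ?y 0 = s \<otimes> p ?y 1" using local[OF y r(1)] by blast
      have "p x i = s \<otimes> p ?y 1 \<otimes> p x i"
        using rp s(2)[symmetric] r y px p_0_mult[OF x] by (simp add: m_assoc)
      then have zero: "(p ?y 0 \<ominus> s \<otimes> p ?y 1) \<otimes> p x i = \<zero>"
        using s y px p_0_mult[OF x] by (simp add: minus_eq l_distr l_minus r_neg)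
      let ?t = "p ?y 0 \<ominus> s \<otimes> p ?y 1"
      have t: "?t \<in> carrier R" "?t \<otimes> p ?y 0 = ?t"
        using s y p_mult_0[OF y] by (simp_all add: minus_eq l_distr l_minus m_assoc)
      have "\<not> (\<exists>s'\<in>carrier R. ?t \<otimes> p ?y 0 = s' \<otimes> p ?y 1)"
      proof
        assume "\<exists>s'\<in>carrier R. ?t \<otimes> p ?y 0 = s' \<otimes> p ?y 1"
        then obtain s' where s': "s' \<in> carrier R" "?t = s' \<otimes> p ?y 1" using t(2) by auto
        have "p ?y 0 = ?t \<oplus> s \<otimes> p ?y 1" using s y by (simp add: minus_eq a_assoc l_neg)
        also have "\<dots> = (s' \<oplus> s) \<otimes> p ?y 1" using s s' y by (simp add: l_distr)
        finally show False using proper[OF y, of "s' \<oplus> s"] s s' by simp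
      qed
      then obtain u where u: "u \<in> carrier R" "u \<otimes> ?t = p ?y 0" using local[OF y t(1)] t(2) by auto
      have "p x i = u \<otimes> ?t \<otimes> p x i" using u p_0_mult[OF x] by simp
      also have "\<dots> = u \<otimes> (?t \<otimes> p x i)" by (rule m_assoc[OF u(1) t(1) px])
      also have "\<dots> = \<zero>" using zero u by simp
      finally show False using p_eq_zero_iff[OF x(1)] x(2) by simp
    qed
    then obtain u where u: "u \<in> carrier R" "u \<otimes> (r \<otimes> p ?y 0) = p ?y 0" by auto
    \<comment> \<open>\<open>p y m\<close> kills \<open>p x i\<close>, since i + m = l x. The factor
      \<open>u\<close> is inserted so that \<open>g\<close> takes ?v (p x i) to exactly
      \<open>p y m\<close>.\<close>
    define m where "m = l x - i"
    let ?v = "p ?y m \<otimes> u"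
    have v: "?v \<in> carrier R" using u y by simp
    have "?v \<otimes> (r \<otimes> p ?y 0) = p ?y m" using u r y p_mult_0[OF y] by (simp add: m_assoc)
    then have "g (emb (?v \<otimes> p x i)) = emb (p ?y m)"
      using left_module_homD(3)[OF g(1) v gen] r by simp
    moreover have "emb (?v \<otimes> p x i) \<in> carrier (I x i)" using v by auto
    ultimately have "emb (?v \<otimes> p x i) = emb (p ?y m \<otimes> p x i)" using g(2)[of "emb (?v \<otimes> p x i)"] by simp
    also have "p ?y m \<otimes> p x i = \<zero>"
      using p_mult_same[OF x, of m] p_eq_zero_iff[OF x(1), of "i + m"] by (simp add: m_def)
    finally have "emb (?v \<otimes> p x i) = \<zero>\<^bsub>I x i\<^esub>" by simp
    then have "emb (p ?y m) = \<zero>\<^bsub>I ?y 0\<^esub>"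
      using left_module_hom_zero[OF Lx Ly g(1)] \<open>g (emb (?v \<otimes> p x i)) = emb (p ?y m)\<close> by simp
    then have "l ?y \<le> m" using p_eq_zero_iff[OF y] by simp
    then show "l ?y = l x - i" using l_step[OF x] by (simp add: m_def)
  }
qed

text \<open>Describes the simple module at \<open>x\<close> by its projective cover:
  \<open>P(x)\<close> modulo the largest proper submodule. This fits both a given simple module and
  one constructed as a quotient.\<close>

definition simple_cover :: "nat \<Rightarrow> 'a lmod \<Rightarrow> ((nat \<Rightarrow> 'a) \<Rightarrow> (nat \<Rightarrow> 'a)) \<Rightarrow> bool" where
  "simple_cover x M e \<longleftrightarrow> left_module R M \<and> e \<in> left_module_hom R (I x 0) M \<and>
     e ` carrier (I x 0) = carrier M \<and> a_kernel (I x 0) M e = carrier (I x 1)"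

lemma simple_coverD:
  assumes "simple_cover x M e"
  shows "left_module R M" "e \<in> left_module_hom R (I x 0) M" "e ` carrier (I x 0) = carrier M"
    "a_kernel (I x 0) M e = carrier (I x 1)" "(I x 0)\<lparr>carrier := a_kernel (I x 0) M e\<rparr> = I x 1"
proof -
  show "left_module R M" "e \<in> left_module_hom R (I x 0) M" "e ` carrier (I x 0) = carrier M"
    and *: "a_kernel (I x 0) M e = carrier (I x 1)"
    using assms by (simp_all only: simple_cover_def)
  show "(I x 0)\<lparr>carrier := a_kernel (I x 0) M e\<rparr> = I x 1"
    unfolding * by (simp add: cyclic_ideal_def)
qed

text \<open>For \<open>l x \<ge> 2\<close> the first two syzygies of the simple module at \<open>x\<close> are \<open>R (p x 1)\<close> and
  \<open>R (p (\<sigma> x) (l x - 1))\<close>. The disjuncts say that the second one is zero and that it is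
  projective and nonzero.\<close>

definition short_resolution :: "nat \<Rightarrow> bool" where
  "short_resolution x \<longleftrightarrow> l (\<sigma> x) = l x - 1 \<or> l ((\<sigma> ^^ l x) x) = l (\<sigma> x) - (l x - 1)"

section \<open>Syzygies of the simple modules\<close>

lemma fg_I: "x \<in> V \<Longrightarrow> fg_left_module R (I x i)"
  by (intro fg_cyclic_ideal) simp

lemma right_mult_1:
  assumes x: "x \<in> V" "2 \<le> l x"
  obtains d where "d \<in> left_module_hom R (I (\<sigma> x) 0) (I x 1)" "d ` carrier (I (\<sigma> x) 0) = carrier (I x 1)"
    "(I (\<sigma> x) 0)\<lparr>carrier := a_kernel (I (\<sigma> x) 0) (I x 1) d\<rparr> = I (\<sigma> x) (l x - 1)"
  using right_mult[of x 1] x by (intro that) simp_all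

lemma \<sigma>_closed: "x \<in> V \<Longrightarrow> 2 \<le> l x \<Longrightarrow> \<sigma> x \<in> V"
  using step[of x 1] by simp

text \<open>The vanishing of the second syzygy is a separate case, because the length criterion for
  R (p y i) presupposes i < l y.\<close>

lemma projective_second_syzygy_iff:
  assumes x: "x \<in> V" "2 \<le> l x"
  shows "projective_module R (I (\<sigma> x) (l x - 1)) \<longleftrightarrow> short_resolution x"
proof -
  have le: "l x - 1 \<le> l (\<sigma> x)" using l_step[of x 1] x by simp
  show ?thesis
  proof (cases "l x - 1 < l (\<sigma> x)")
    case True
    \<comment> \<open>The top of the second syzygy: \<open>l x - 1\<close> arrows after
      \<open>\<sigma> x\<close> are \<open>l x\<close> arrows after \<open>x\<close>.\<close>
    have "(\<sigma> ^^ (l x - 1)) (\<sigma> x) = (\<sigma> ^^ l x) x"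
      using x(2) funpow_Suc_right[of "l x - 1" \<sigma>] by simp
    then show ?thesis
      using projective_cyclic_ideal_iff[OF \<sigma>_closed[OF x] True] True by (simp add: short_resolution_def)
  next
    case False
    then have "l (\<sigma> x) = l x - 1" using le by simp
    then show ?thesis
      using pd_le_trivial_cyclic_ideal[OF \<sigma>_closed[OF x], of "l x - 1" 0] by (simp add: short_resolution_def)
  qed
qed

lemma pd_le_1_radical:
  assumes x: "x \<in> V" "2 \<le> l x \<Longrightarrow> short_resolution x"
  shows "pd_le R 1 (I x 1)"
proof (cases "2 \<le> l x")
  case True
  obtain d where d: "d \<in> left_module_hom R (I (\<sigma> x) 0) (I x 1)" "d ` carrier (I (\<sigma> x) 0) = carrier (I x 1)"
    "(I (\<sigma> x) 0)\<lparr>carrier := a_kernel (I (\<sigma> x) 0) (I x 1) d\<rparr> = I (\<sigma> x) (l x - 1)"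
    by (rule right_mult_1[OF x(1) True])
  have "pd_le R 0 (I (\<sigma> x) (l x - 1))"
    using projective_second_syzygy_iff[OF x(1) True] x(2)[OF True] fg_I[OF \<sigma>_closed[OF x(1) True]] by simp
  then have "pd_le R 0 ((I (\<sigma> x) 0)\<lparr>carrier := a_kernel (I (\<sigma> x) 0) (I x 1) d\<rparr>)" by (simp only: d(3))
  from pd_le_SucI[OF fg_left_module_D[OF fg_I[OF x(1)]] pd_le_0_projective[OF \<sigma>_closed[OF x(1) True]] d(1,2) this]
  show ?thesis by (simp only: One_nat_def)
next
  case False
  then show ?thesis using x(1) by (intro pd_le_trivial_cyclic_ideal) simp_all
qed

lemma pd_le_1_iff:
  assumes x: "x \<in> V" "2 \<le> l x" and M: "simple_cover x M e"
  shows "pd_le R 1 M \<longleftrightarrow> l (\<sigma> x) = l x - 1"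
proof -
  note e = simple_coverD[OF M]
  have P: "pd_le R 0 (I x 0)" by (rule pd_le_0_projective[OF x(1)])
  then have P': "projective_module R (I x 0)" by simp
  have iff: "projective_module R (I x 1) \<longleftrightarrow> l (\<sigma> x) = l x - 1"
    using projective_cyclic_ideal_iff[OF x(1), of 1] x(2) by simp
  show ?thesis
  proof
    assume "pd_le R 1 M"
    from pd_le_1_syzygy[OF e(1) this P' e(2,3)] show "l (\<sigma> x) = l x - 1" unfolding e(5) iff .
  next
    assume "l (\<sigma> x) = l x - 1"
    then have "pd_le R 0 (I x 1)" using iff fg_I[OF x(1)] by simp
    then have "pd_le R 0 ((I x 0)\<lparr>carrier := a_kernel (I x 0) M e\<rparr>)" by (simp only: e(5))
    from pd_le_SucI[OF e(1) P e(2,3) this] show "pd_le R 1 M" by (simp only: One_nat_def)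
  qed
qed

lemma I_1_subset_I_0: "x \<in> V \<Longrightarrow> carrier (I x 1) \<subseteq> carrier (I x 0)"
proof
  fix z assume x: "x \<in> V" and "z \<in> carrier (I x 1)"
  then obtain r where r: "r \<in> carrier R" "z = emb (r \<otimes> p x 1)" by auto
  then have "z = emb ((r \<otimes> p x 1) \<otimes> p x 0)" using x p_mult_0[OF x] by (simp add: m_assoc)
  then show "z \<in> carrier (I x 0)" using r x by auto
qed

text \<open>\<open>short_resolution x\<close> is projectivity of the second syzygy in the explicit
  resolution. By \<open>pd_le_2_syzygy\<close> any witness of the bound forces it; conversely it
  completes the explicit resolution.\<close>

lemma pd_le_2_iff:
  assumes x: "x \<in> V" "2 \<le> l x" and M: "simple_cover x M e"
  shows "pd_le R 2 M \<longleftrightarrow> short_resolution x"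
proof -
  note e = simple_coverD[OF M]
  have P: "pd_le R 0 (I x 0)" by (rule pd_le_0_projective[OF x(1)])
  then have P': "projective_module R (I x 0)" by simp
  have G: "projective_module R (I (\<sigma> x) 0)" using pd_le_0_projective[OF \<sigma>_closed[OF x]] by simp
  show ?thesis
  proof
    assume pd: "pd_le R 2 M"
    obtain d where d: "d \<in> left_module_hom R (I (\<sigma> x) 0) (I x 1)" "d ` carrier (I (\<sigma> x) 0) = carrier (I x 1)"
      "(I (\<sigma> x) 0)\<lparr>carrier := a_kernel (I (\<sigma> x) 0) (I x 1) d\<rparr> = I (\<sigma> x) (l x - 1)"
      by (rule right_mult_1[OF x])
    have "d \<in> left_module_hom R (I (\<sigma> x) 0) ((I x 0)\<lparr>carrier := a_kernel (I x 0) M e\<rparr>)"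
      using d(1) by (simp only: e(5))
    then have d': "d \<in> left_module_hom R (I (\<sigma> x) 0) (I x 0)"
      by (rule left_module_hom_extend) (auto simp: a_kernel_def')
    have "d ` carrier (I (\<sigma> x) 0) = a_kernel (I x 0) M e" by (simp only: e(4) d(2))
    from pd_le_2_syzygy[OF e(1) pd P' e(2,3) G d' this]
    have "projective_module R ((I (\<sigma> x) 0)\<lparr>carrier := a_kernel (I (\<sigma> x) 0) (I x 0) d\<rparr>)" .
    also have "a_kernel (I (\<sigma> x) 0) (I x 0) d = a_kernel (I (\<sigma> x) 0) (I x 1) d" by (simp add: a_kernel_def')
    finally show "short_resolution x" by (simp only: d(3) projective_second_syzygy_iff[OF x])
  next
    assume "short_resolution x"
    then have "pd_le R 1 (I x 1)" using pd_le_1_radical[OF x(1)] by simp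
    then have "pd_le R 1 ((I x 0)\<lparr>carrier := a_kernel (I x 0) M e\<rparr>)" by (simp only: e(5))
    from pd_le_SucI[OF e(1) P e(2,3) this] show "pd_le R 2 M" by (simp only: One_nat_def Suc_1 numeral_2_eq_2)
  qed
qed

lemma simple_cover_projective:
  assumes x: "x \<in> V" "l x < 2" and M: "simple_cover x M e"
  shows "projective_module R M"
proof -
  note e = simple_coverD[OF M]
  have "a_kernel (I x 0) M e = {\<zero>\<^bsub>I x 0\<^esub>}"
    using trivial_cyclic_ideal[OF x(1), of 1] x(2) unfolding e(4) by simp
  from pd_le_0_iso[OF pd_le_0_projective[OF x(1)] e(1-3) this] show ?thesis by simp
qed

text \<open>w = e_x v generates \<open>S\<close> and is fixed by e_x. If r e_x kills
  \<open>w\<close>, it is not left invertible, so it lies in R (p x 1) by \<open>local\<close>. That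
  \<open>p x 1\<close> kills \<open>w\<close> is an instance of Nakayama's lemma.\<close>

lemma simple_module_cover:
  assumes x: "x \<in> V" and S: "simple_left_module R S" and v: "v \<in> carrier S" "p x 0 \<odot>\<^bsub>S\<^esub> v \<noteq> \<zero>\<^bsub>S\<^esub>"
  obtains e where "simple_cover x S e"
proof -
  interpret S: left_module R S using S by (simp add: simple_left_module_def)
  have S': "H = {\<zero>\<^bsub>S\<^esub>} \<or> H = carrier S" if "submodule H R S" for H
    using S that by (simp add: simple_left_module_def)
  define w where "w = p x 0 \<odot>\<^bsub>S\<^esub> v"
  have px: "p x i \<in> carrier R" for i using x by simp
  have w: "w \<in> carrier S" "w \<noteq> \<zero>\<^bsub>S\<^esub>" "p x 0 \<odot>\<^bsub>S\<^esub> w = w"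
    using v px p_mult_0[OF x, of 0] by (auto simp: w_def S.smult_closed S.smult_assoc[symmetric])
  have gen: "{a \<odot>\<^bsub>S\<^esub> y | a. a \<in> carrier R} = carrier S" if y: "y \<in> carrier S" "y \<noteq> \<zero>\<^bsub>S\<^esub>" for y
  proof -
    have "submodule ((\<lambda>z. z 0 \<odot>\<^bsub>S\<^esub> y) ` carrier regular_module) R S"
      by (rule submodule_image[OF left_module_regular S.left_module_axioms act_hom[OF S.left_module_axioms y(1)]
            left_module.submodule_carrier[OF left_module_regular]])
    also have "(\<lambda>z. z 0 \<odot>\<^bsub>S\<^esub> y) ` carrier regular_module = {a \<odot>\<^bsub>S\<^esub> y | a. a \<in> carrier R}"
      by (auto simp: image_image)
    finally have "submodule {a \<odot>\<^bsub>S\<^esub> y | a. a \<in> carrier R} R S" .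
    moreover have "y \<in> {a \<odot>\<^bsub>S\<^esub> y | a. a \<in> carrier R}" using y S.smult_one[of y] by (auto intro!: exI[of _ \<one>])
    ultimately show ?thesis using S' y(2) by blast
  qed
  let ?e = "\<lambda>z. z 0 \<odot>\<^bsub>S\<^esub> w"
  have e: "?e \<in> left_module_hom R (I x 0) S" by (rule act_hom_cyclic_ideal[OF S.left_module_axioms w(1) px])
  have ew: "?e (emb (r \<otimes> p x 0)) = r \<odot>\<^bsub>S\<^esub> w" if "r \<in> carrier R" for r
    using that w px by (simp add: S.smult_assoc)
  have "carrier (I x 0) = (\<lambda>r. emb (r \<otimes> p x 0)) ` carrier R" by auto
  then have "?e ` carrier (I x 0) = (\<lambda>r. ?e (emb (r \<otimes> p x 0))) ` carrier R" by (simp only: image_image)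
  also have "\<dots> = (\<lambda>r. r \<odot>\<^bsub>S\<^esub> w) ` carrier R" by (rule image_cong) (simp_all only: ew)
  also have "\<dots> = carrier S" using gen[OF w(1,2)] by (simp add: setcompr_eq_image)
  finally have "?e ` carrier (I x 0) = carrier S" .
  moreover have "a_kernel (I x 0) S ?e = carrier (I x 1)"
  proof
    show "a_kernel (I x 0) S ?e \<subseteq> carrier (I x 1)"
    proof
      fix z assume "z \<in> a_kernel (I x 0) S ?e"
      then obtain r where r: "r \<in> carrier R" "z = emb (r \<otimes> p x 0)" "r \<odot>\<^bsub>S\<^esub> w = \<zero>\<^bsub>S\<^esub>"
        using ew by (auto simp: a_kernel_def')
      have False if u: "u \<in> carrier R" "u \<otimes> (r \<otimes> p x 0) = p x 0" for u
      proof -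
        have "w = u \<odot>\<^bsub>S\<^esub> (r \<odot>\<^bsub>S\<^esub> (p x 0 \<odot>\<^bsub>S\<^esub> w))"
          using u(1) r(1) w(1) px S.smult_assoc[of u "r \<otimes> p x 0" w] S.smult_assoc[of r "p x 0" w]
          by (simp add: u(2) w(3))
        then show False using u r w by simp
      qed
      then show "z \<in> carrier (I x 1)" using local[OF x r(1)] r(2) by auto
    qed
    have "p x 1 \<odot>\<^bsub>S\<^esub> w = \<zero>\<^bsub>S\<^esub>"
    proof (rule ccontr)
      \<comment> \<open>Simplicity gives w = r (p x 1) w, so e_x - r (p x 1) kills \<open>w\<close>;
        but by \<open>proper\<close> and \<open>local\<close> this element is left
        invertible.\<close>
      assume ne: "p x 1 \<odot>\<^bsub>S\<^esub> w \<noteq> \<zero>\<^bsub>S\<^esub>"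
      have "w \<in> {a \<odot>\<^bsub>S\<^esub> (p x 1 \<odot>\<^bsub>S\<^esub> w) | a. a \<in> carrier R}"
        unfolding gen[OF S.smult_closed[OF px w(1)] ne] by (rule w(1))
      then obtain r where r: "r \<in> carrier R" "w = r \<odot>\<^bsub>S\<^esub> (p x 1 \<odot>\<^bsub>S\<^esub> w)" by auto
      let ?t = "p x 0 \<ominus> r \<otimes> p x 1"
      have t: "?t \<in> carrier R" "?t \<otimes> p x 0 = ?t"
        using r px p_mult_0[OF x] by (simp_all add: minus_eq l_distr l_minus m_assoc)
      have split: "p x 0 = ?t \<oplus> r \<otimes> p x 1" using r px by (simp add: minus_eq a_assoc l_neg)
      have "?t \<odot>\<^bsub>S\<^esub> w \<oplus>\<^bsub>S\<^esub> w = w"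
        using S.smult_l_distr[of ?t "r \<otimes> p x 1" w] r t px w split
        by (simp add: S.smult_assoc del: One_nat_def)
      then have tw: "?t \<odot>\<^bsub>S\<^esub> w = \<zero>\<^bsub>S\<^esub>" using S.smult_closed[OF t(1) w(1)] w(1) by (simp add: S.M.add.r_cancel_one')
      from local[OF x t(1)] show False
      proof
        assume "\<exists>s\<in>carrier R. ?t \<otimes> p x 0 = s \<otimes> p x 1"
        then obtain s where s: "s \<in> carrier R" "?t = s \<otimes> p x 1" using t(2) by auto
        have "p x 0 = (s \<oplus> r) \<otimes> p x 1" using split s r px by (simp add: l_distr)
        then show False using proper[OF x, of "s \<oplus> r"] s r by simp
      next
        assume "\<exists>u\<in>carrier R. u \<otimes> (?t \<otimes> p x 0) = p x 0"
        then obtain u where u: "u \<in> carrier R" "u \<otimes> ?t = p x 0" using t(2) by auto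
        have "w = (u \<otimes> ?t) \<odot>\<^bsub>S\<^esub> w" using u w by simp
        also have "\<dots> = \<zero>\<^bsub>S\<^esub>" using S.smult_assoc[OF u(1) t(1) w(1)] tw u by simp
        finally show False using w by simp
      qed
    qed
    then show "carrier (I x 1) \<subseteq> a_kernel (I x 0) S ?e"
      using I_1_subset_I_0[OF x] w px by (auto simp: a_kernel_def' S.smult_assoc simp del: cyclic_ideal_simps(1)) 
        (auto simp: S.smult_assoc)
  qed
  ultimately have "simple_cover x S ?e" using e S.left_module_axioms by (simp only: simple_cover_def)
  then show thesis by (rule that)
qed

text \<open>The lower bound for the global dimension needs an actual simple module over the fixed
  element type.\<close>

lemma simple_cover_exists:
  assumes x: "x \<in> V" obtains M e where "simple_cover x M e"
proof -
  have px: "p x i \<in> carrier R" for i using x by simp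
  have L: "left_module R (I x 0)" by (rule left_module_cyclic_ideal[OF px])
  have K: "submodule (carrier (I x 1)) R (I x 0)"
  proof -
    have "submodule (carrier (I x 1)) R (regular_module\<lparr>carrier := carrier (I x 0)\<rparr>)"
      using left_module.submodule_of_submodule[OF left_module_regular _ I_1_subset_I_0[OF x]]
        submodule_cyclic_ideal[OF px] by simp
    also have "regular_module\<lparr>carrier := carrier (I x 0)\<rparr> = I x 0" by (simp add: cyclic_ideal_def)
    finally show ?thesis .
  qed
  obtain M :: "'a lmod" and e where "left_module R M" "e \<in> left_module_hom R (I x 0) M"
    "e ` carrier (I x 0) = carrier M" "a_kernel (I x 0) M e = carrier (I x 1)"
    by (rule quotient_module[OF L K])
  then have "simple_cover x M e" by (simp only: simple_cover_def)
  then show thesis by (rule that)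
qed

lemma simple_cover_fg: "x \<in> V \<Longrightarrow> simple_cover x M e \<Longrightarrow> fg_left_module R M"
  using fg_left_module_image[OF fg_I[of x 0]] simple_coverD(1-3) by metis

subsection \<open>Global dimension\<close>

text \<open>(N + R w) / N is zero or simple at \<open>y\<close>: for w outside \<open>N\<close> the
  preimage of \<open>N\<close> under z \<mapsto> z w is the radical R (p y 1) of P(y), whose
  projective dimension is at most 1 by \<open>good\<close>. So \<open>pd_le_adjoin\<close>
  applies.\<close>

lemma pd_le_2_adjoin_vertex_element:
  assumes good: "\<And>x. x \<in> V \<Longrightarrow> 2 \<le> l x \<Longrightarrow> short_resolution x"
    and M: "left_module R M" and N: "submodule N R M" "pd_le R 2 (M\<lparr>carrier := N\<rparr>)"
    and y: "y \<in> V" and w: "w \<in> carrier M" "p y 0 \<odot>\<^bsub>M\<^esub> w = w" "p y 1 \<odot>\<^bsub>M\<^esub> w \<in> N"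
  shows "\<exists>H. submodule H R M \<and> N \<subseteq> H \<and> w \<in> H \<and> pd_le R 2 (M\<lparr>carrier := H\<rparr>)"
proof (cases "w \<in> N")
  case True
  then show ?thesis using N by blast
next
  case False
  interpret M: left_module R M by fact
  have py: "p y i \<in> carrier R" for i using y by simp
  let ?q = "\<lambda>z. z 0 \<odot>\<^bsub>M\<^esub> w"
  have q: "?q \<in> left_module_hom R (I y 0) M" by (rule act_hom_cyclic_ideal[OF M w(1) py])
  have "{z \<in> carrier (I y 0). ?q z \<in> N} = carrier (I y 1)"
  proof
    show "{z \<in> carrier (I y 0). ?q z \<in> N} \<subseteq> carrier (I y 1)"
    proof
      fix z assume "z \<in> {z \<in> carrier (I y 0). ?q z \<in> N}"
      then obtain r where r: "r \<in> carrier R" "z = emb (r \<otimes> p y 0)" "(r \<otimes> p y 0) \<odot>\<^bsub>M\<^esub> w \<in> N" by auto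
      have False if u: "u \<in> carrier R" "u \<otimes> (r \<otimes> p y 0) = p y 0" for u
      proof -
        have "w = u \<odot>\<^bsub>M\<^esub> ((r \<otimes> p y 0) \<odot>\<^bsub>M\<^esub> w)"
          using M.smult_assoc[OF u(1) _ w(1), of "r \<otimes> p y 0"] u(2) r(1) py w(2) by simp
        then show False using M.submoduleD(4)[OF N(1) u(1) r(3)] False by simp
      qed
      then show "z \<in> carrier (I y 1)" using local[OF y r(1)] r(2) by auto
    qed
    show "carrier (I y 1) \<subseteq> {z \<in> carrier (I y 0). ?q z \<in> N}"
    proof
      fix z assume z: "z \<in> carrier (I y 1)"
      then obtain r where r: "r \<in> carrier R" "z = emb (r \<otimes> p y 1)" by auto
      then have "?q z \<in> N" using M.submoduleD(4)[OF N(1) r(1) w(3)] w(1) py by (simp add: M.smult_assoc)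
      then show "z \<in> {z \<in> carrier (I y 0). ?q z \<in> N}" using z I_1_subset_I_0[OF y] by blast
    qed
  qed
  then have "(I y 0)\<lparr>carrier := {z \<in> carrier (I y 0). ?q z \<in> N}\<rparr> = I y 1"
    by (simp only: cyclic_ideal_def) simp
  then have pd: "pd_le R 1 ((I y 0)\<lparr>carrier := {z \<in> carrier (I y 0). ?q z \<in> N}\<rparr>)"
    using pd_le_1_radical[OF y] good[OF y] by (simp only:)
  have N2: "pd_le R (Suc 1) (M\<lparr>carrier := N\<rparr>)" using N(2) by (simp only: Suc_1)
  obtain H where H: "submodule H R M" "N \<subseteq> H" "?q ` carrier (I y 0) \<subseteq> H" "pd_le R (Suc 1) (M\<lparr>carrier := H\<rparr>)"
    by (rule pd_le_adjoin[OF M N(1) N2 pd_le_0_projective[OF y] q pd])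
  have "?q (emb (\<one> \<otimes> p y 0)) = w" using w py by simp
  moreover have "emb (\<one> \<otimes> p y 0) \<in> carrier (I y 0)" by (auto simp del: l_one)
  ultimately have "w \<in> H" using H(3) by (metis image_subset_iff)
  then show ?thesis using H by (auto simp only: Suc_1)
qed

text \<open>The elements p x i m are adjoined from the bottom, starting with p x (l x) m = 0. Each
  is fixed by the idempotent at the end \<open>y\<close> of its path, and \<open>p y 1\<close> takes
  it to p x (i + 1) m, which has been adjoined before.\<close>

lemma pd_le_2_adjoin_idempotent:
  assumes good: "\<And>x. x \<in> V \<Longrightarrow> 2 \<le> l x \<Longrightarrow> short_resolution x"
    and M: "left_module R M" and N: "submodule N R M" "pd_le R 2 (M\<lparr>carrier := N\<rparr>)"
    and x: "x \<in> V" and m: "m \<in> carrier M" and j: "j \<le> l x"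
  shows "\<exists>H. submodule H R M \<and> N \<subseteq> H \<and> p x (l x - j) \<odot>\<^bsub>M\<^esub> m \<in> H \<and> pd_le R 2 (M\<lparr>carrier := H\<rparr>)"
  using j
proof (induction j)
  interpret M: left_module R M by fact
  have px: "p x i \<in> carrier R" for i using x by simp
  case 0
  then show ?case using N m p_eq_zero_iff[OF x, of "l x"] M.submoduleD(2)[OF N(1)] by auto
next
  interpret M: left_module R M by fact
  have px: "p x i \<in> carrier R" for i using x by simp
  case (Suc j)
  then obtain H where H: "submodule H R M" "N \<subseteq> H" "p x (l x - j) \<odot>\<^bsub>M\<^esub> m \<in> H" "pd_le R 2 (M\<lparr>carrier := H\<rparr>)"
    by auto
  define i where "i = l x - Suc j"
  have i: "i < l x" "Suc i = l x - j" using Suc(2) by (auto simp: i_def)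
  let ?y = "(\<sigma> ^^ i) x"
  have y: "?y \<in> V" by (rule step[OF x i(1)])
  have "p ?y 0 \<odot>\<^bsub>M\<^esub> (p x i \<odot>\<^bsub>M\<^esub> m) = p x i \<odot>\<^bsub>M\<^esub> m"
    using p_0_mult[OF x i(1)] y px m by (simp add: M.smult_assoc[symmetric])
  moreover have "p ?y 1 \<odot>\<^bsub>M\<^esub> (p x i \<odot>\<^bsub>M\<^esub> m) \<in> H"
    using p_mult_same[OF x i(1), of 1] y px m H(3) i(2) by (simp add: M.smult_assoc[symmetric])
  ultimately obtain H' where "submodule H' R M" "H \<subseteq> H'" "p x i \<odot>\<^bsub>M\<^esub> m \<in> H'" "pd_le R 2 (M\<lparr>carrier := H'\<rparr>)"
    using pd_le_2_adjoin_vertex_element[OF good M H(1,4) y M.smult_closed[OF px m]] by blast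
  then show ?case using H(2) unfolding i_def by blast
qed

text \<open>m is the sum of the e_x m, because the idempotents add up to the identity.\<close>

lemma pd_le_2_adjoin:
  assumes good: "\<And>x. x \<in> V \<Longrightarrow> 2 \<le> l x \<Longrightarrow> short_resolution x"
    and M: "left_module R M" and N: "submodule N R M" "pd_le R 2 (M\<lparr>carrier := N\<rparr>)"
    and m: "m \<in> carrier M"
  shows "\<exists>H. submodule H R M \<and> N \<subseteq> H \<and> m \<in> H \<and> pd_le R 2 (M\<lparr>carrier := H\<rparr>)"
proof -
  interpret M: left_module R M by fact
  have "\<exists>H. submodule H R M \<and> N \<subseteq> H \<and> (\<Oplus>x\<in>W. p x 0) \<odot>\<^bsub>M\<^esub> m \<in> H \<and> pd_le R 2 (M\<lparr>carrier := H\<rparr>)"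
    if "W \<subseteq> V" for W
    using finite_subset[OF that finite_V] that
  proof (induction W rule: finite_induct)
    case empty
    then show ?case using N m M.submoduleD(2)[OF N(1)] by auto
  next
    case (insert x W)
    then obtain H where H: "submodule H R M" "N \<subseteq> H" "(\<Oplus>x\<in>W. p x 0) \<odot>\<^bsub>M\<^esub> m \<in> H" "pd_le R 2 (M\<lparr>carrier := H\<rparr>)"
      by auto
    have x: "x \<in> V" and W: "(\<lambda>x. p x 0) \<in> W \<rightarrow> carrier R" using insert(4) by auto
    obtain H' where H': "submodule H' R M" "H \<subseteq> H'" "p x 0 \<odot>\<^bsub>M\<^esub> m \<in> H'" "pd_le R 2 (M\<lparr>carrier := H'\<rparr>)"
      using pd_le_2_adjoin_idempotent[OF good M H(1,4) x m, of "l x"] by auto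
    have "(\<Oplus>x\<in>insert x W. p x 0) \<odot>\<^bsub>M\<^esub> m = p x 0 \<odot>\<^bsub>M\<^esub> m \<oplus>\<^bsub>M\<^esub> (\<Oplus>x\<in>W. p x 0) \<odot>\<^bsub>M\<^esub> m"
      using insert(1,2) x W m by (simp add: finsum_insert M.smult_l_distr)
    also have "\<dots> \<in> H'" using H' H(3) by (intro M.submoduleD(3)[OF H'(1)]) auto
    finally show ?case using H' H(2) by blast
  qed
  from this[of V] show ?thesis using m by (simp add: sum_idem M.smult_one)
qed

lemma pd_le_2_all:
  assumes good: "\<And>x. x \<in> V \<Longrightarrow> 2 \<le> l x \<Longrightarrow> short_resolution x"
    and fg: "fg_left_module R M"
  shows "pd_le R 2 M"
proof -
  note M = fg_left_module_D[OF fg]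
  interpret M: left_module R M by (rule M)
  obtain B where B: "finite B" "B \<subseteq> carrier M" "\<forall>H. submodule H R M \<and> B \<subseteq> H \<longrightarrow> H = carrier M"
    using fg by (elim fg_left_moduleE) (rule that)
  have "\<exists>H. submodule H R M \<and> C \<subseteq> H \<and> pd_le R 2 (M\<lparr>carrier := H\<rparr>)" if "finite C" "C \<subseteq> carrier M" for C
    using that
  proof (induction C rule: finite_induct)
    case empty
    have "left_module R (M\<lparr>carrier := {\<zero>\<^bsub>M\<^esub>}\<rparr>)" by (rule M.left_module_submodule[OF M.submodule_zero])
    from trivial_module[OF this] have "pd_le R 0 (M\<lparr>carrier := {\<zero>\<^bsub>M\<^esub>}\<rparr>)" by simp
    then have "pd_le R 2 (M\<lparr>carrier := {\<zero>\<^bsub>M\<^esub>}\<rparr>)" by (rule pd_le_mono) simp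
    then show ?case using M.submodule_zero by blast
  next
    case (insert m C)
    then obtain H where H: "submodule H R M" "C \<subseteq> H" "pd_le R 2 (M\<lparr>carrier := H\<rparr>)" by auto
    obtain H' where "submodule H' R M" "H \<subseteq> H'" "m \<in> H'" "pd_le R 2 (M\<lparr>carrier := H'\<rparr>)"
      using pd_le_2_adjoin[OF good M H(1,3), of m] insert(4) by auto
    then show ?case using H(2) by blast
  qed
  from this[OF B(1,2)] obtain H where H: "submodule H R M" "B \<subseteq> H" "pd_le R 2 (M\<lparr>carrier := H\<rparr>)" by blast
  have "H = carrier M" by (rule B(3)[rule_format]) (use H in blast)
  then show ?thesis using H(3) by (simp only: partial_object.update_convs) simp
qed

end

section \<open>Walks in a quiver with at most one arrow into and out of each vertex\<close>

text \<open>Arrows bear the name of their tail, so at most one leaves each vertex and a path is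
  determined by its origin and its number of arrows; \<open>inj_head\<close> allows going back from
  its end.\<close>

locale arrow_quiver =
  fixes Q :: "(nat, nat) pre_digraph"
  assumes finite_verts: "finite (verts Q)"
    and arcs_verts: "arcs Q \<subseteq> verts Q"
    and tail_id: "tail Q e = e"
    and head_verts: "e \<in> arcs Q \<Longrightarrow> head Q e \<in> verts Q"
    and inj_head: "inj_on (head Q) (arcs Q)"
begin

abbreviation \<sigma> :: "nat \<Rightarrow> nat" where "\<sigma> \<equiv> head Q"

definition arrs :: "nat \<Rightarrow> nat \<Rightarrow> nat list" where
  "arrs x i = map (\<lambda>k. (\<sigma> ^^ k) x) [0..<i]"

text \<open>\<open>\<sigma>\<close> is total and on the linear quiver runs beyond the last vertex;
  validity says that the iterates really follow arrows.\<close>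

definition valid :: "nat \<Rightarrow> nat \<Rightarrow> bool" where
  "valid x i \<longleftrightarrow> x \<in> verts Q \<and> (\<forall>k<i. (\<sigma> ^^ k) x \<in> arcs Q)"

lemma funpow_funpow: "(\<sigma> ^^ j) ((\<sigma> ^^ i) x) = (\<sigma> ^^ (i + j)) x"
  by (metis add.commute comp_apply funpow_add)

lemma length_arrs [simp]: "length (arrs x i) = i"
  by (simp add: arrs_def)

lemma arrs_0 [simp]: "arrs x 0 = []"
  by (simp add: arrs_def)

lemma arrs_add: "arrs x (i + j) = arrs x i @ arrs ((\<sigma> ^^ i) x) j"
  by (rule nth_equalityI) (auto simp: arrs_def nth_append funpow_funpow)

lemma arrs_Suc: "arrs x (Suc i) = x # arrs (\<sigma> x) i"
  using arrs_add[of x 1 i] by (simp add: arrs_def)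

lemma take_arrs: "k \<le> i \<Longrightarrow> take k (arrs x i) = arrs x k"
  and drop_arrs: "k \<le> i \<Longrightarrow> drop k (arrs x i) = arrs ((\<sigma> ^^ k) x) (i - k)"
  using arrs_add[of x k "i - k"] by simp_all

lemma valid_0 [simp]: "valid x 0 \<longleftrightarrow> x \<in> verts Q"
  by (simp add: valid_def)

lemma valid_vert: "valid x i \<Longrightarrow> x \<in> verts Q"
  by (simp add: valid_def)

lemma valid_le: "valid x i \<Longrightarrow> j \<le> i \<Longrightarrow> valid x j"
  by (simp add: valid_def)

lemma valid_end: "valid x i \<Longrightarrow> k \<le> i \<Longrightarrow> (\<sigma> ^^ k) x \<in> verts Q"
  by (cases k) (auto simp: valid_def head_verts)

lemma valid_add: "valid x (i + j) \<longleftrightarrow> valid x i \<and> valid ((\<sigma> ^^ i) x) j"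
proof
  assume *: "valid x (i + j)"
  have "(\<sigma> ^^ k) ((\<sigma> ^^ i) x) \<in> arcs Q" if "k < j" for k
    using * that by (auto simp: valid_def funpow_funpow)
  then show "valid x i \<and> valid ((\<sigma> ^^ i) x) j"
    using * valid_end[OF *, of i] by (auto simp: valid_def)
next
  assume *: "valid x i \<and> valid ((\<sigma> ^^ i) x) j"
  have "(\<sigma> ^^ k) x \<in> arcs Q" if k: "k < i + j" for k
  proof (cases "k < i")
    case False
    then have "(\<sigma> ^^ (k - i)) ((\<sigma> ^^ i) x) \<in> arcs Q" using * k by (auto simp: valid_def)
    then show ?thesis using False by (simp add: funpow_funpow)
  qed (use * in \<open>auto simp: valid_def\<close>)
  then show "valid x (i + j)" using * by (auto simp: valid_def)
qed

lemma valid_1: "valid x (Suc 0) \<longleftrightarrow> x \<in> arcs Q"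
  using arcs_verts by (auto simp: valid_def)

lemma awalk_iff: "(\<exists>v. pre_digraph.awalk Q x es v) \<longleftrightarrow> valid x (length es) \<and> es = arrs x (length es)"
proof (induction es arbitrary: x)
  case Nil
  then show ?case by (simp add: pre_digraph.awalk_def pre_digraph.cas.simps)
next
  case (Cons e es)
  have "(\<exists>v. pre_digraph.awalk Q x (e # es) v) \<longleftrightarrow> e = x \<and> x \<in> arcs Q \<and> (\<exists>v. pre_digraph.awalk Q (\<sigma> x) es v)"
    using arcs_verts head_verts by (auto simp: pre_digraph.awalk_def pre_digraph.cas.simps tail_id)
  also have "\<dots> \<longleftrightarrow> valid x (Suc (length es)) \<and> e # es = arrs x (Suc (length es))"
    using Cons valid_add[of x 1 "length es"] by (auto simp: valid_1 arrs_Suc)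
  finally show ?case by simp
qed

lemma qpaths_iff: "(x, es) \<in> qpaths Q \<longleftrightarrow> valid x (length es) \<and> es = arrs x (length es)"
  by (simp add: qpaths_def awalk_iff)

lemma arrs_qpaths_iff [simp]: "(x, arrs x i) \<in> qpaths Q \<longleftrightarrow> valid x i"
  by (simp add: qpaths_iff)

lemma qpathsE:
  assumes "q \<in> qpaths Q" obtains x i where "q = (x, arrs x i)" "valid x i"
  using assms by (cases q) (auto simp: qpaths_iff)

lemma awalk_verts_arrs: "pre_digraph.awalk_verts Q x (arrs x i) = map (\<lambda>k. (\<sigma> ^^ k) x) [0..<Suc i]"
proof (induction i arbitrary: x)
  case 0
  then show ?case by (simp add: pre_digraph.awalk_verts.simps)
next
  case (Suc i)
  then have "pre_digraph.awalk_verts Q x (arrs x (Suc i)) = x # map (\<lambda>k. (\<sigma> ^^ k) (\<sigma> x)) [0..<Suc i]"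
    by (simp add: arrs_Suc pre_digraph.awalk_verts.simps tail_id)
  also have "\<dots> = map (\<lambda>k. (\<sigma> ^^ k) x) [0..<Suc (Suc i)]"
    by (simp add: map_upt_Suc funpow_swap1 del: upt_Suc)
  finally show ?case .
qed

lemma path_end_arrs [simp]: "path_end Q (x, arrs x i) = (\<sigma> ^^ i) x"
  by (simp add: path_end_def awalk_verts_arrs)

text \<open>At most one arrow enters a vertex, so of two paths with the same end the shorter is a
  final part of the longer.\<close>

lemma funpow_eq_backward:
  assumes "valid x i" "valid y j" "(\<sigma> ^^ i) x = (\<sigma> ^^ j) y" "j \<le> i"
  shows "y = (\<sigma> ^^ (i - j)) x"
  using assms
proof (induction j arbitrary: i)
  case 0
  then show ?case by simp
next
  case (Suc j)
  then obtain i' where i: "i = Suc i'" by (cases i) auto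
  have arcs: "(\<sigma> ^^ i') x \<in> arcs Q" "(\<sigma> ^^ j) y \<in> arcs Q"
    using Suc.prems(1,2) i by (simp_all add: valid_def)
  have "\<sigma> ((\<sigma> ^^ i') x) = \<sigma> ((\<sigma> ^^ j) y)" using Suc.prems(3) i by simp
  from inj_onD[OF inj_head this arcs] have "(\<sigma> ^^ i') x = (\<sigma> ^^ j) y" .
  then have "y = (\<sigma> ^^ (i' - j)) x"
    using Suc.prems(4) i by (intro Suc.IH valid_le[OF Suc.prems(1)] valid_le[OF Suc.prems(2)]) simp_all
  then show ?case using i by simp
qed

end

section \<open>Path algebras of such quivers\<close>

text \<open>That the path algebra is a ring is an assumption here; it is contained in the hypothesis
  that \<open>I\<close> is an ideal.\<close>

locale path_alg = arrow_quiver Q for Q +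
  fixes A :: "((nat, nat) qpath \<Rightarrow> 'k::field) ring"
  assumes A_def: "A = path_algebra Q"
    and ring_A: "ring A"
begin

sublocale A: ring A by (rule ring_A)

section \<open>Monomials and coefficients of products\<close>

definition mon :: "'k \<Rightarrow> nat \<Rightarrow> nat \<Rightarrow> (nat, nat) qpath \<Rightarrow> 'k" where
  "mon c x i q = (if q = (x, arrs x i) then c else 0)"

lemma path_elem_mon: "path_elem (x, arrs x i) = mon 1 x i"
  by (auto simp: path_elem_def mon_def)

lemma carrier_iff: "f \<in> carrier A \<longleftrightarrow> finite {q. f q \<noteq> 0} \<and> {q. f q \<noteq> 0} \<subseteq> qpaths Q"
  by (simp add: A_def path_algebra_def)

lemma add_eq: "f \<oplus>\<^bsub>A\<^esub> g = (\<lambda>q. f q + g q)"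
  and zero_eq: "\<zero>\<^bsub>A\<^esub> = (\<lambda>q. 0)"
  and one_eq: "\<one>\<^bsub>A\<^esub> = (\<lambda>q. if fst q \<in> verts Q \<and> snd q = [] then 1 else 0)"
  by (simp_all add: A_def path_algebra_def)

lemma mult_eq: "(f \<otimes>\<^bsub>A\<^esub> g) q = (\<Sum>k\<le>length (snd q). f (path_end Q (fst q, take k (snd q)), drop k (snd q)) *
    g (fst q, take k (snd q)))"
  by (simp add: A_def path_algebra_def)

lemma mon_closed: "valid x i \<Longrightarrow> mon c x i \<in> carrier A"
  by (auto simp: carrier_iff mon_def)

lemma mon_0 [simp]: "mon 0 x i = \<zero>\<^bsub>A\<^esub>"
  by (auto simp: mon_def zero_eq)

text \<open>Comparing lengths leaves only the splitting after \<open>i\<close> arrows.\<close>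

lemma mult_mon: "(f \<otimes>\<^bsub>A\<^esub> mon c x i) q =
    (if fst q = x \<and> i \<le> length (snd q) \<and> take i (snd q) = arrs x i then f ((\<sigma> ^^ i) x, drop i (snd q)) * c else 0)"
proof -
  have "(f \<otimes>\<^bsub>A\<^esub> mon c x i) q = (\<Sum>k\<le>length (snd q). if k = i then
      (if fst q = x \<and> take i (snd q) = arrs x i then f ((\<sigma> ^^ i) x, drop i (snd q)) * c else 0) else 0)"
    unfolding mult_eq
  proof (rule sum.cong)
    fix k assume k: "k \<in> {..length (snd q)}"
    have "k = i" if "take k (snd q) = arrs x i"
      using arg_cong[OF that, of length] k by simp
    then show "f (path_end Q (fst q, take k (snd q)), drop k (snd q)) * mon c x i (fst q, take k (snd q)) =
      (if k = i then (if fst q = x \<and> take i (snd q) = arrs x i then f ((\<sigma> ^^ i) x, drop i (snd q)) * c else 0) else 0)"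
      by (auto simp: mon_def)
  qed simp
  then show ?thesis by simp
qed

lemma mon_mult_mon: "mon c y j \<otimes>\<^bsub>A\<^esub> mon d x i = (if y = (\<sigma> ^^ i) x then mon (c * d) x (i + j) else \<zero>\<^bsub>A\<^esub>)"
proof
  fix q :: "(nat, nat) qpath"
  have "take i es = arrs x i \<and> drop i es = arrs ((\<sigma> ^^ i) x) j \<longleftrightarrow> es = arrs x (i + j)" if "i \<le> length es" for es
    unfolding arrs_add by (metis append_eq_conv_conj append_take_drop_id length_arrs)
  moreover have "i \<le> length (arrs x (i + j))" by simp
  ultimately show "(mon c y j \<otimes>\<^bsub>A\<^esub> mon d x i) q =
      (if y = (\<sigma> ^^ i) x then mon (c * d) x (i + j) else \<zero>\<^bsub>A\<^esub>) q"
    unfolding mult_mon by (cases q) (auto simp: mon_def zero_eq simp del: length_arrs)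
qed

lemma mult_support:
  assumes "(f \<otimes>\<^bsub>A\<^esub> g) (x, arrs x i) \<noteq> 0"
  obtains k where "k \<le> i" "f ((\<sigma> ^^ k) x, arrs ((\<sigma> ^^ k) x) (i - k)) \<noteq> 0" "g (x, arrs x k) \<noteq> 0"
proof -
  have "(f \<otimes>\<^bsub>A\<^esub> g) (x, arrs x i) = (\<Sum>k\<le>i. f ((\<sigma> ^^ k) x, arrs ((\<sigma> ^^ k) x) (i - k)) * g (x, arrs x k))"
    unfolding mult_eq by (rule sum.cong) (simp_all add: take_arrs drop_arrs)
  then have "(\<Sum>k\<le>i. f ((\<sigma> ^^ k) x, arrs ((\<sigma> ^^ k) x) (i - k)) * g (x, arrs x k)) \<noteq> 0" using assms by simp
  then obtain k where "k \<in> {..i}" "f ((\<sigma> ^^ k) x, arrs ((\<sigma> ^^ k) x) (i - k)) * g (x, arrs x k) \<noteq> 0"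
    by (rule sum.not_neutral_contains_not_neutral)
  then show thesis by (intro that[of k]) auto
qed

section \<open>Ideals spanned by paths\<close>

definition support_in :: "(nat \<Rightarrow> nat \<Rightarrow> bool) \<Rightarrow> ((nat, nat) qpath \<Rightarrow> 'k) set" where
  "support_in B = {f \<in> carrier A. \<forall>x i. f (x, arrs x i) \<noteq> 0 \<longrightarrow> B x i}"

text \<open>The premises close the set of paths under extension at the end and at the origin. Used
  for the paths of positive length and for those containing a generator, where it bounds a generated
  ideal from above.\<close>

lemma ideal_support_in:
  assumes B: "\<And>x i j. B x i \<Longrightarrow> B x (i + j)" "\<And>x i j. B ((\<sigma> ^^ i) x) j \<Longrightarrow> B x (i + j)"
  shows "ideal (support_in B) A"
proof (rule idealI[OF ring_A])
  show "subgroup (support_in B) (add_monoid A)"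
  proof (rule A.add.subgroupI)
    show "support_in B \<noteq> {}" by (auto simp: support_in_def zero_eq intro!: exI[of _ "\<zero>\<^bsub>A\<^esub>"])
    fix f assume f: "f \<in> support_in B"
    then have "f \<in> carrier A" by (simp add: support_in_def)
    moreover have "\<ominus>\<^bsub>A\<^esub> f = (\<lambda>q. - f q)"
      using \<open>f \<in> carrier A\<close> by (intro A.minus_equality) (auto simp: add_eq zero_eq carrier_iff)
    ultimately show "\<ominus>\<^bsub>A\<^esub> f \<in> support_in B" using f by (auto simp: support_in_def carrier_iff)
    fix g assume g: "g \<in> support_in B"
    have "f \<oplus>\<^bsub>A\<^esub> g \<in> carrier A" using f g by (simp add: support_in_def)
    then show "f \<oplus>\<^bsub>A\<^esub> g \<in> support_in B" using f g
      by (auto simp: support_in_def add_eq) (metis add_0)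
  qed (auto simp: support_in_def)
  show "g \<otimes>\<^bsub>A\<^esub> f \<in> support_in B" "f \<otimes>\<^bsub>A\<^esub> g \<in> support_in B"
    if f: "f \<in> support_in B" and g: "g \<in> carrier A" for f g
  proof -
    have "B x i" if "(g \<otimes>\<^bsub>A\<^esub> f) (x, arrs x i) \<noteq> 0" for x i
    proof -
      obtain k where "k \<le> i" "f (x, arrs x k) \<noteq> 0" using \<open>(g \<otimes>\<^bsub>A\<^esub> f) (x, arrs x i) \<noteq> 0\<close> by (rule mult_support)
      then show ?thesis using f B(1)[of x k "i - k"] by (auto simp: support_in_def)
    qed
    then show "g \<otimes>\<^bsub>A\<^esub> f \<in> support_in B" using f g by (auto simp: support_in_def)
    have "B x i" if "(f \<otimes>\<^bsub>A\<^esub> g) (x, arrs x i) \<noteq> 0" for x i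
    proof -
      obtain k where "k \<le> i" "f ((\<sigma> ^^ k) x, arrs ((\<sigma> ^^ k) x) (i - k)) \<noteq> 0"
        using \<open>(f \<otimes>\<^bsub>A\<^esub> g) (x, arrs x i) \<noteq> 0\<close> by (rule mult_support)
      then show ?thesis using f B(2)[of k x "i - k"] by (auto simp: support_in_def)
    qed
    then show "f \<otimes>\<^bsub>A\<^esub> g \<in> support_in B" using f g by (auto simp: support_in_def)
  qed
qed

lemma one_decomposition: "(\<Oplus>\<^bsub>A\<^esub>x\<in>verts Q. mon 1 x 0) = \<one>\<^bsub>A\<^esub>"
proof -
  have "(\<Oplus>\<^bsub>A\<^esub>x\<in>W. mon 1 x 0) = (\<lambda>q. if fst q \<in> W \<and> snd q = [] then 1 else 0)"
    if "finite W" "W \<subseteq> verts Q" for W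
    using that
  proof (induction W rule: finite_induct)
    case empty
    then show ?case by (simp add: zero_eq)
  next
    case (insert x W)
    have "(\<lambda>x. mon 1 x 0) \<in> W \<rightarrow> carrier A" "mon 1 x 0 \<in> carrier A"
      using insert(4) by (auto intro!: mon_closed)
    then have "(\<Oplus>\<^bsub>A\<^esub>x\<in>insert x W. mon 1 x 0) = mon 1 x 0 \<oplus>\<^bsub>A\<^esub> (\<Oplus>\<^bsub>A\<^esub>x\<in>W. mon 1 x 0)"
      using insert(1,2) by (simp add: A.finsum_insert)
    also have "(\<Oplus>\<^bsub>A\<^esub>x\<in>W. mon 1 x 0) = (\<lambda>q. if fst q \<in> W \<and> snd q = [] then 1 else 0)"
      using insert by simp
    also have "mon 1 x 0 \<oplus>\<^bsub>A\<^esub> \<dots> = (\<lambda>q. if fst q \<in> insert x W \<and> snd q = [] then 1 else 0)"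
      using insert(2) by (auto simp: add_eq mon_def fun_eq_iff)
    finally show ?case .
  qed
  from this[OF finite_verts subset_refl] show ?thesis by (simp add: one_eq)
qed

text \<open>f e_x collects the paths from \<open>x\<close>. Apart from the trivial one they all
  begin with the only arrow at \<open>x\<close>, and \<open>s\<close> arises by deleting it; if no
  arrow starts at \<open>x\<close>, nothing else is left.\<close>

lemma right_mult_idempotent:
  assumes f: "f \<in> carrier A" and x: "x \<in> verts Q"
  obtains s where "s \<in> carrier A"
    "f \<otimes>\<^bsub>A\<^esub> mon 1 x 0 = mon (f (x, [])) x 0 \<oplus>\<^bsub>A\<^esub> s \<otimes>\<^bsub>A\<^esub> (if x \<in> arcs Q then mon 1 x 1 else \<zero>\<^bsub>A\<^esub>)"
proof
  define s where "s q = (if x \<in> arcs Q \<and> fst q = \<sigma> x then f (x, x # snd q) else 0)" for q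
  have tail: "(\<sigma> x, es) \<in> qpaths Q \<and> x \<in> arcs Q" if "f (x, e # es) \<noteq> 0" for e es
  proof -
    have "(x, e # es) \<in> qpaths Q" using f that by (auto simp: carrier_iff)
    then show ?thesis using valid_add[of x 1 "length es"] by (auto simp: qpaths_iff arrs_Suc valid_1)
  qed
  have head: "e = x" if "f (x, e # es) \<noteq> 0" for e es
  proof -
    have "(x, e # es) \<in> qpaths Q" using f that by (auto simp: carrier_iff)
    then show ?thesis by (auto simp: qpaths_iff arrs_Suc)
  qed
  have "{q. s q \<noteq> 0} \<subseteq> (\<lambda>q. (\<sigma> x, tl (snd q))) ` {q. f q \<noteq> 0}"
  proof
    fix q assume "q \<in> {q. s q \<noteq> 0}"
    then have "q = (\<sigma> x, tl (snd (x, x # snd q)))" "f (x, x # snd q) \<noteq> 0" by (auto simp: s_def prod_eq_iff split: if_splits)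
    then show "q \<in> (\<lambda>q. (\<sigma> x, tl (snd q))) ` {q. f q \<noteq> 0}" by blast
  qed
  moreover have "{q. s q \<noteq> 0} \<subseteq> qpaths Q"
  proof
    fix q assume "q \<in> {q. s q \<noteq> 0}"
    then have "q = (\<sigma> x, snd q)" "f (x, x # snd q) \<noteq> 0" by (auto simp: s_def prod_eq_iff split: if_splits)
    then show "q \<in> qpaths Q" using tail by metis
  qed
  ultimately show "s \<in> carrier A" using f by (auto simp: carrier_iff intro: finite_subset)
  then have s0: "s \<otimes>\<^bsub>A\<^esub> \<zero>\<^bsub>A\<^esub> = \<zero>\<^bsub>A\<^esub>" by simp
  show "f \<otimes>\<^bsub>A\<^esub> mon 1 x 0 = mon (f (x, [])) x 0 \<oplus>\<^bsub>A\<^esub> s \<otimes>\<^bsub>A\<^esub> (if x \<in> arcs Q then mon 1 x 1 else \<zero>\<^bsub>A\<^esub>)"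
  proof
    fix q :: "(nat, nat) qpath"
    obtain y es where q: "q = (y, es)" by (cases q)
    show "(f \<otimes>\<^bsub>A\<^esub> mon 1 x 0) q = (mon (f (x, [])) x 0 \<oplus>\<^bsub>A\<^esub> s \<otimes>\<^bsub>A\<^esub> (if x \<in> arcs Q then mon 1 x 1 else \<zero>\<^bsub>A\<^esub>)) q"
    proof (cases es)
      case Nil
      then show ?thesis using s0 by (auto simp: q add_eq mult_mon mon_def zero_eq)
    next
      case (Cons e es')
      then show ?thesis using s0 tail[of e es'] head[of e es']
        by (auto simp: q add_eq mult_mon mon_def zero_eq arrs_Suc s_def)
    qed
  qed
qed

end

section \<open>Nakayama algebras\<close>

text \<open>The geometric series: \<open>u\<close> accumulates the powers of \<open>t\<close> below
  \<open>k\<close>.\<close>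

lemma (in ring) left_inverse_one_minus_nilpotent:
  assumes t: "t \<in> carrier R" "t [^] (n::nat) = \<zero>"
  shows "\<exists>u\<in>carrier R. u \<otimes> (\<one> \<ominus> t) = \<one>"
proof -
  have "\<exists>u\<in>carrier R. u \<otimes> (\<one> \<ominus> t) = \<one> \<ominus> t [^] k" for k :: nat
  proof (induction k)
    case 0
    then show ?case using t by (auto intro!: bexI[of _ \<zero>] simp: minus_eq r_neg)
  next
    case (Suc k)
    then obtain u where u: "u \<in> carrier R" "u \<otimes> (\<one> \<ominus> t) = \<one> \<ominus> t [^] k" by auto
    have "(u \<oplus> t [^] k) \<otimes> (\<one> \<ominus> t) = (\<one> \<ominus> t [^] k) \<oplus> t [^] k \<otimes> (\<one> \<ominus> t)"
      using u t by (simp add: l_distr)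
    also have "t [^] k \<otimes> (\<one> \<ominus> t) = t [^] k \<ominus> t [^] Suc k"
      using t by (simp add: minus_eq r_distr r_minus)
    also have "(\<one> \<ominus> t [^] k) \<oplus> (t [^] k \<ominus> t [^] Suc k) = \<one> \<ominus> t [^] Suc k"
      using t by (simp add: minus_eq a_assoc r_neg1 del: nat_pow_Suc)
    finally show ?case using u t by (intro bexI[of _ "u \<oplus> t [^] k"]) auto
  qed
  from this[of n] show ?thesis using t by (simp add: minus_eq)
qed

locale nakayama = path_alg Q A for Q and A :: "((nat, nat) qpath \<Rightarrow> 'k::field) ring" +
  fixes I :: "((nat, nat) qpath \<Rightarrow> 'k) set" and G :: "(nat, nat) qpath set"
  assumes admissible: "admissible_ideal Q I" and generators: "minimal_path_generators Q I G"
begin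

sublocale quo: ideal I A
  using admissible by (simp add: admissible_ideal_def A_def)

sublocale quot: ring "A Quot I"
  by (rule quo.quotient_is_ring)

sublocale proj: ring_hom_ring A "A Quot I" "(+>\<^bsub>A\<^esub>) I"
  by (rule quo.rcos_ring_hom_ring)

section \<open>The arrow ideal and its powers\<close>

abbreviation pe :: "(nat, nat) qpath \<Rightarrow> (nat, nat) qpath \<Rightarrow> 'k" where "pe \<equiv> path_elem"

abbreviation J :: "((nat, nat) qpath \<Rightarrow> 'k) set" where "J \<equiv> arrow_ideal Q"

lemma J_def: "J = Idl\<^bsub>A\<^esub> (pe ` {p \<in> qpaths Q. length (snd p) = 1})"
  by (simp add: arrow_ideal_def A_def)

lemma path_elem_closed: "p \<in> qpaths Q \<Longrightarrow> pe p \<in> carrier A"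
  by (elim qpathsE) (simp add: path_elem_mon mon_closed)

lemma ideal_J: "ideal J A"
  unfolding J_def by (rule A.genideal_ideal) (auto intro: path_elem_closed)

lemma mon_J: "x \<in> arcs Q \<Longrightarrow> mon 1 x 1 \<in> J"
proof -
  assume "x \<in> arcs Q"
  then have "pe (x, arrs x 1) \<in> pe ` {p \<in> qpaths Q. length (snd p) = 1}"
    by (intro imageI) (simp add: valid_1)
  moreover have "pe ` {p \<in> qpaths Q. length (snd p) = 1} \<subseteq> carrier A"
    by (auto intro: path_elem_closed)
  ultimately show ?thesis unfolding J_def path_elem_mon using A.genideal_self by blast
qed

lemma J_support: "J \<subseteq> support_in (\<lambda>x i. 1 \<le> i)"
  unfolding J_def
proof (rule A.genideal_minimal)
  show "ideal (support_in (\<lambda>x i. 1 \<le> i)) A" by (rule ideal_support_in) auto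
  show "pe ` {p \<in> qpaths Q. length (snd p) = 1} \<subseteq> support_in (\<lambda>x i. 1 \<le> i)"
    by (auto simp: support_in_def path_elem_closed) (auto simp: path_elem_def split: if_splits)
qed

text \<open>The factor \<open>J\<close> lengthens all paths by at least one arrow. \<open>Y\<close>
  is an arbitrary set, so that the statement can be iterated along
  \<open>ideal_power\<close>.\<close>

lemma J_prod_support:
  assumes X: "\<And>f. f \<in> Y \<Longrightarrow> f \<in> carrier A \<and> (\<forall>x i. f (x, arrs x i) \<noteq> 0 \<longrightarrow> m \<le> i)"
    and f: "f \<in> ideal_prod A J Y"
  shows "f \<in> carrier A \<and> (\<forall>x i. f (x, arrs x i) \<noteq> 0 \<longrightarrow> Suc m \<le> i)"
  using f
proof (induction rule: ideal_prod.induct)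
  case (prod f g)
  then have fg: "f \<in> carrier A" "g \<in> carrier A" and f: "\<And>x i. f (x, arrs x i) \<noteq> 0 \<Longrightarrow> 1 \<le> i"
    and g: "\<And>x i. g (x, arrs x i) \<noteq> 0 \<Longrightarrow> m \<le> i"
    using J_support X by (auto simp: support_in_def)
  have "Suc m \<le> i" if nz: "(f \<otimes>\<^bsub>A\<^esub> g) (x, arrs x i) \<noteq> 0" for x i
  proof -
    obtain k where "k \<le> i" "f ((\<sigma> ^^ k) x, arrs ((\<sigma> ^^ k) x) (i - k)) \<noteq> 0" "g (x, arrs x k) \<noteq> 0"
      using nz by (rule mult_support)
    then show ?thesis using f[of "(\<sigma> ^^ k) x" "i - k"] g[of x k] by simp
  qed
  then show ?case using fg by simp
next
  case (sum f g)
  have "Suc m \<le> i" if nz: "(f \<oplus>\<^bsub>A\<^esub> g) (x, arrs x i) \<noteq> 0" for x i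
  proof -
    have "f (x, arrs x i) \<noteq> 0 \<or> g (x, arrs x i) \<noteq> 0" using nz by (auto simp: add_eq)
    then show ?thesis using sum by blast
  qed
  then show ?case using sum by simp
qed

lemma I_support_ge_2: "f \<in> I \<Longrightarrow> f (x, arrs x i) \<noteq> 0 \<Longrightarrow> 2 \<le> i"
proof -
  assume f: "f \<in> I" "f (x, arrs x i) \<noteq> 0"
  have "f \<in> ideal_prod A J (ideal_prod A J (carrier A))"
    using admissible f(1) by (auto simp: admissible_ideal_def A_def numeral_2_eq_2)
  then have "Suc (Suc 0) \<le> i"
    using J_prod_support[of "ideal_prod A J (carrier A)" "Suc 0" f] J_prod_support[of "carrier A" 0] f(2) by simp
  then show ?thesis by simp
qed

section \<open>Minimal generators and zero paths\<close>

lemma G_qpaths: "g \<in> G \<Longrightarrow> g \<in> qpaths Q"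
  and I_eq: "I = Idl\<^bsub>A\<^esub> (pe ` G)"
  and G_minimal: "G' \<subset> G \<Longrightarrow> I \<noteq> Idl\<^bsub>A\<^esub> (pe ` G')"
  using generators by (auto simp: minimal_path_generators_def A_def)

lemma G_valid: "g \<in> G \<Longrightarrow> valid (fst g) (length (snd g))"
  and G_arrs: "g \<in> G \<Longrightarrow> snd g = arrs (fst g) (length (snd g))"
  using G_qpaths[of g] qpaths_iff[of "fst g" "snd g"] by auto

lemma path_elem_G: "g \<in> G \<Longrightarrow> pe g = mon 1 (fst g) (length (snd g))"
  using path_elem_mon[of "fst g" "length (snd g)"] G_arrs[of g] by simp

lemma path_elem_G_I: "g \<in> G \<Longrightarrow> pe g \<in> I"
proof -
  assume "g \<in> G"
  have "pe ` G \<subseteq> carrier A" using G_qpaths path_elem_closed by auto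
  then show ?thesis unfolding I_eq using A.genideal_self \<open>g \<in> G\<close> by blast
qed

lemma G_ge_2: "g \<in> G \<Longrightarrow> 2 \<le> length (snd g)"
proof -
  assume g: "g \<in> G"
  have "pe g (fst g, arrs (fst g) (length (snd g))) \<noteq> (0::'k)"
    unfolding path_elem_G[OF g] by (simp add: mon_def)
  then show ?thesis by (rule I_support_ge_2[OF path_elem_G_I[OF g]])
qed

text \<open>The path with \<open>i\<close> arrows that starts at \<open>x\<close> contains a member of \<open>G'\<close>.\<close>

definition hit :: "(nat, nat) qpath set \<Rightarrow> nat \<Rightarrow> nat \<Rightarrow> bool" where
  "hit G' x i \<longleftrightarrow> (\<exists>g\<in>G'. \<exists>j. fst g = (\<sigma> ^^ j) x \<and> j + length (snd g) \<le> i)"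

lemma hit_add: "hit G' x i \<Longrightarrow> hit G' x (i + j)" "hit G' ((\<sigma> ^^ i) x) j \<Longrightarrow> hit G' x (i + j)"
proof -
  show "hit G' x i \<Longrightarrow> hit G' x (i + j)" unfolding hit_def by (meson trans_le_add1)
  assume "hit G' ((\<sigma> ^^ i) x) j"
  then obtain g k where "g \<in> G'" "fst g = (\<sigma> ^^ k) ((\<sigma> ^^ i) x)" "k + length (snd g) \<le> j" unfolding hit_def by blast
  then show "hit G' x (i + j)" unfolding hit_def by (intro bexI[of _ g] exI[of _ "i + k"]) (auto simp: funpow_funpow)
qed

text \<open>The path is a product of a final part, a generator and an initial part. \<open>K\<close>
  and \<open>G'\<close> are general, for use with the ideal of a proper subset of
  \<open>G\<close>.\<close>

lemma hit_ideal:
  assumes K: "ideal K A" and sub: "G' \<subseteq> G" "pe ` G' \<subseteq> K" and x: "valid x i" "hit G' x i"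
  shows "mon c x i \<in> K"
proof -
  interpret K: ideal K A by (rule K)
  obtain g j where g: "g \<in> G'" "fst g = (\<sigma> ^^ j) x" "j + length (snd g) \<le> i" using x(2) unfolding hit_def by blast
  define m where "m = length (snd g)"
  define k where "k = i - (j + m)"
  have i: "i = j + m + k" using g(3) by (simp add: k_def m_def)
  have gK: "mon 1 ((\<sigma> ^^ j) x) m \<in> K" using sub(2) g(1,2) path_elem_G[OF subsetD[OF sub(1) g(1)]] by (auto simp: m_def)
  have v: "valid x j" "valid ((\<sigma> ^^ (j + m)) x) k" using x(1) by (auto simp: i valid_add)
  have "mon c ((\<sigma> ^^ (j + m)) x) k \<otimes>\<^bsub>A\<^esub> (mon 1 ((\<sigma> ^^ j) x) m \<otimes>\<^bsub>A\<^esub> mon 1 x j) \<in> K"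
    by (intro K.I_l_closed K.I_r_closed gK mon_closed v)
  also have "mon c ((\<sigma> ^^ (j + m)) x) k \<otimes>\<^bsub>A\<^esub> (mon 1 ((\<sigma> ^^ j) x) m \<otimes>\<^bsub>A\<^esub> mon 1 x j) = mon c x i"
    by (simp add: mon_mult_mon i)
  finally show ?thesis .
qed

text \<open>A generator that contained another one would lie in the ideal of the rest and could be
  omitted.\<close>

lemma G_antichain:
  assumes g: "g \<in> G" "g' \<in> G" and occ: "fst g' = (\<sigma> ^^ j) (fst g)" "j + length (snd g') \<le> length (snd g)"
  shows "g' = g"
proof (rule ccontr)
  assume "g' \<noteq> g"
  let ?G = "G - {g}"
  have sub: "pe ` ?G \<subseteq> carrier A" using G_qpaths path_elem_closed by auto
  note K = A.genideal_ideal[OF sub] and self = A.genideal_self[OF sub]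
  have "hit ?G (fst g) (length (snd g))"
    unfolding hit_def using g(2) \<open>g' \<noteq> g\<close> occ by auto
  from hit_ideal[OF K _ self G_valid[OF g(1)] this] have "pe g \<in> Idl\<^bsub>A\<^esub> (pe ` ?G)"
    unfolding path_elem_G[OF g(1)] by blast
  then have "pe ` G \<subseteq> Idl\<^bsub>A\<^esub> (pe ` ?G)" using self by auto
  then have "I \<subseteq> Idl\<^bsub>A\<^esub> (pe ` ?G)" unfolding I_eq by (rule A.genideal_minimal[OF K])
  moreover have "Idl\<^bsub>A\<^esub> (pe ` ?G) \<subseteq> I"
    by (rule A.genideal_minimal[OF quo.is_ideal]) (use path_elem_G_I in auto)
  ultimately show False using G_minimal[of ?G] g(1) by blast
qed

text \<open>The elements supported on paths that contain a generator form an ideal with all of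
  \<open>G\<close> in it, so this ideal contains \<open>I\<close>.\<close>

lemma mon_I_iff:
  assumes "valid x i" shows "mon 1 x i \<in> I \<longleftrightarrow> hit G x i"
proof
  assume "mon 1 x i \<in> I"
  also have "I \<subseteq> support_in (hit G)"
    unfolding I_eq
  proof (rule A.genideal_minimal)
    show "ideal (support_in (hit G)) A" by (rule ideal_support_in) (rule hit_add; assumption)+
    show "pe ` G \<subseteq> support_in (hit G)"
    proof
      fix f assume "f \<in> pe ` G"
      then obtain g where g: "g \<in> G" "f = mon 1 (fst g) (length (snd g))" using path_elem_G by auto
      have "hit G (fst g) (length (snd g))" unfolding hit_def using g(1) by (intro bexI[of _ g] exI[of _ 0]) auto
      moreover have "i = length (snd g)" if "arrs x i = arrs (fst g) (length (snd g))" for x i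
        using arg_cong[OF that, of length] by simp
      ultimately show "f \<in> support_in (hit G)"
        using mon_closed[OF G_valid[OF g(1)]] by (auto simp: support_in_def g(2) mon_def split: if_splits)
    qed
  qed
  finally show "hit G x i" by (auto simp: support_in_def mon_def)
next
  assume "hit G x i"
  then show "mon 1 x i \<in> I"
    using hit_ideal[OF quo.is_ideal subset_refl _ assms] path_elem_G_I by blast
qed

lemma J_power_subset_I: obtains N where "ideal_power A J N \<subseteq> I"
  using admissible that unfolding admissible_ideal_def A_def by blast

lemma mon_J_power: "valid x N \<Longrightarrow> mon 1 x N \<in> ideal_power A J N"
proof (induction N)
  case 0
  then show ?case by (simp add: mon_closed)
next
  case (Suc N)
  then have v: "valid x N" "(\<sigma> ^^ N) x \<in> arcs Q" using valid_add[of x N 1] by (auto simp: valid_1)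
  have "mon 1 ((\<sigma> ^^ N) x) 1 \<otimes>\<^bsub>A\<^esub> mon 1 x N \<in> ideal_power A J (Suc N)"
    using mon_J[OF v(2)] Suc.IH[OF v(1)] by (auto intro: ideal_prod.prod)
  then show ?case by (simp add: mon_mult_mon)
qed

section \<open>Lengths of the projective modules\<close>

definition nz :: "nat \<Rightarrow> nat \<Rightarrow> bool" where
  "nz x i \<longleftrightarrow> valid x i \<and> \<not> hit G x i"

definition len :: "nat \<Rightarrow> nat" where
  "len x = (LEAST i. \<not> nz x i)"

lemma nz_le: "nz x i \<Longrightarrow> j \<le> i \<Longrightarrow> nz x j"
  using hit_add(1)[of G x j "i - j"] valid_le[of x i j] by (auto simp: nz_def)

text \<open>Nonzero paths stay nonzero when shortened, and a path of \<open>N\<close> arrows lies in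
  the \<open>N\<close>-th power of the arrow ideal; so a least length fails and separates the two
  kinds.\<close>

lemma nz_iff: "nz x i \<longleftrightarrow> i < len x"
proof -
  obtain N where "ideal_power A J N \<subseteq> I" by (rule J_power_subset_I)
  then have "\<not> nz x N" using mon_J_power[of x N] mon_I_iff[of x N] by (auto simp: nz_def)
  then have "\<not> nz x (len x)" unfolding len_def by (rule LeastI)
  then show ?thesis using nz_le[of x i "len x"] not_less_Least[of i "\<lambda>i. \<not> nz x i"] unfolding len_def
    by (meson not_le)
qed

text \<open>Zero where \<open>x\<close> has no path with \<open>i\<close> arrows, so that the
  product rule of \<open>uniserial_ring\<close> holds for all indices.\<close>

definition pth :: "nat \<Rightarrow> nat \<Rightarrow> ((nat, nat) qpath \<Rightarrow> 'k) set" where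
  "pth x i = I +>\<^bsub>A\<^esub> (if valid x i then mon 1 x i else \<zero>\<^bsub>A\<^esub>)"

section \<open>The quotient as a uniserial ring\<close>

lemma coset_eq_zero_iff: "a \<in> carrier A \<Longrightarrow> I +>\<^bsub>A\<^esub> a = \<zero>\<^bsub>A Quot I\<^esub> \<longleftrightarrow> a \<in> I"
  unfolding FactRing_def ring.simps using quo.a_rcos_const[of a] quo.rcos_const_imp_mem[of a] by blast

lemma quot_carrierE:
  assumes "r \<in> carrier (A Quot I)" obtains f where "f \<in> carrier A" "r = I +>\<^bsub>A\<^esub> f"
proof -
  have "\<exists>f\<in>carrier A. r = I +>\<^bsub>A\<^esub> f"
    using assms unfolding FactRing_def partial_object.simps A_RCOSETS_def' UN_iff singleton_iff .
  then obtain f where "f \<in> carrier A" "r = I +>\<^bsub>A\<^esub> f" by (rule bexE)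
  then show thesis by (rule that)
qed

lemma pth_arg_closed: "(if valid x i then mon 1 x i else \<zero>\<^bsub>A\<^esub>) \<in> carrier A"
  by (simp add: mon_closed)

text \<open>Up to paths with an arrow, r e_x is a scalar \<open>c\<close> times e_x. For c = 0 it is
  a multiple of the arrow; otherwise dividing by \<open>c\<close> leaves e_x minus an element of the
  arrow ideal, which is nilpotent modulo \<open>I\<close>.\<close>

lemma pth_local:
  assumes x: "x \<in> verts Q" and r: "r \<in> carrier (A Quot I)"
  shows "(\<exists>s\<in>carrier (A Quot I). r \<otimes>\<^bsub>A Quot I\<^esub> pth x 0 = s \<otimes>\<^bsub>A Quot I\<^esub> pth x 1) \<or>
    (\<exists>u\<in>carrier (A Quot I). u \<otimes>\<^bsub>A Quot I\<^esub> (r \<otimes>\<^bsub>A Quot I\<^esub> pth x 0) = pth x 0)"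
proof -
  obtain f where f: "f \<in> carrier A" "r = I +>\<^bsub>A\<^esub> f" using r by (rule quot_carrierE)
  define a where "a = (if x \<in> arcs Q then mon 1 x 1 else \<zero>\<^bsub>A\<^esub>)"
  define c where "c = f (x, [])"
  obtain s where s: "s \<in> carrier A" "f \<otimes>\<^bsub>A\<^esub> mon 1 x 0 = mon c x 0 \<oplus>\<^bsub>A\<^esub> s \<otimes>\<^bsub>A\<^esub> a"
    unfolding a_def c_def by (rule right_mult_idempotent[OF f(1) x])
  have a: "a \<in> carrier A" "a \<otimes>\<^bsub>A\<^esub> mon 1 x 0 = a" "a \<in> J"
    using x mon_J ideal.axioms(1)[OF ideal_J, THEN additive_subgroup.zero_closed]
    by (auto simp: a_def mon_closed valid_1 mon_mult_mon)
  have e: "mon d x 0 \<in> carrier A" for d using x by (simp add: mon_closed)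
  have p0: "pth x 0 = I +>\<^bsub>A\<^esub> mon 1 x 0" and p1: "pth x 1 = I +>\<^bsub>A\<^esub> a"
    using x by (auto simp: pth_def a_def valid_1)
  have r0: "r \<otimes>\<^bsub>A Quot I\<^esub> pth x 0 = I +>\<^bsub>A\<^esub> (f \<otimes>\<^bsub>A\<^esub> mon 1 x 0)" using f e p0 by simp
  show ?thesis
  proof (cases "c = 0")
    case True
    then have "f \<otimes>\<^bsub>A\<^esub> mon 1 x 0 = s \<otimes>\<^bsub>A\<^esub> a" using s a by simp
    then have "r \<otimes>\<^bsub>A Quot I\<^esub> pth x 0 = (I +>\<^bsub>A\<^esub> s) \<otimes>\<^bsub>A Quot I\<^esub> pth x 1" using r0 p1 s a by simp
    then show ?thesis using proj.hom_closed[OF s(1)] by (intro disjI1 bexI)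
  next
    case False
    \<comment> \<open>Chosen so that multiplying f e_x from the left by the idempotent scaled with 1
      / c gives (1 - t) e_x.\<close>
    define t where "t = \<ominus>\<^bsub>A\<^esub> (mon (1 / c) x 0 \<otimes>\<^bsub>A\<^esub> (s \<otimes>\<^bsub>A\<^esub> a))"
    have t: "t \<in> carrier A" "t \<otimes>\<^bsub>A\<^esub> mon 1 x 0 = t"
      using s a e by (auto simp: t_def A.l_minus A.m_assoc)
    have "mon (1 / c) x 0 \<otimes>\<^bsub>A\<^esub> (s \<otimes>\<^bsub>A\<^esub> a) \<in> J"
      using ideal.I_l_closed[OF ideal_J] a s e by blast
    then have tJ: "t \<in> J" unfolding t_def
      using additive_subgroup.a_inv_closed[OF ideal.axioms(1)[OF ideal_J]] by blast
    have "t [^]\<^bsub>A\<^esub> N \<in> ideal_power A J N" for N :: nat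
    proof (induction N)
      case (Suc N)
      then have "t \<otimes>\<^bsub>A\<^esub> t [^]\<^bsub>A\<^esub> N \<in> ideal_power A J (Suc N)" using tJ by (auto intro: ideal_prod.prod)
      then show ?case using A.nat_pow_Suc2[OF t(1)] by simp
    qed simp
    moreover obtain N where "ideal_power A J N \<subseteq> I" by (rule J_power_subset_I)
    ultimately have "t [^]\<^bsub>A\<^esub> N \<in> I" by blast
    then have "(I +>\<^bsub>A\<^esub> t) [^]\<^bsub>A Quot I\<^esub> N = \<zero>\<^bsub>A Quot I\<^esub>"
      using coset_eq_zero_iff[of "t [^]\<^bsub>A\<^esub> N"] t(1) by (simp add: proj.hom_nat_pow[symmetric])
    from quot.left_inverse_one_minus_nilpotent[OF proj.hom_closed[OF t(1)] this]
    obtain u where u: "u \<in> carrier (A Quot I)"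
      "u \<otimes>\<^bsub>A Quot I\<^esub> (\<one>\<^bsub>A Quot I\<^esub> \<ominus>\<^bsub>A Quot I\<^esub> (I +>\<^bsub>A\<^esub> t)) = \<one>\<^bsub>A Quot I\<^esub>" by blast
    let ?T = "I +>\<^bsub>A\<^esub> t" and ?K = "I +>\<^bsub>A\<^esub> mon (1 / c) x 0"
    have "mon (1 / c) x 0 \<otimes>\<^bsub>A\<^esub> (f \<otimes>\<^bsub>A\<^esub> mon 1 x 0) = mon 1 x 0 \<oplus>\<^bsub>A\<^esub> \<ominus>\<^bsub>A\<^esub> t"
      using s a e False by (simp add: t_def A.r_distr mon_mult_mon)
    also have "\<dots> = (\<one>\<^bsub>A\<^esub> \<ominus>\<^bsub>A\<^esub> t) \<otimes>\<^bsub>A\<^esub> mon 1 x 0"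
      using t e by (simp add: A.minus_eq A.l_distr A.l_minus)
    finally have eq: "I +>\<^bsub>A\<^esub> (mon (1 / c) x 0 \<otimes>\<^bsub>A\<^esub> (f \<otimes>\<^bsub>A\<^esub> mon 1 x 0)) = I +>\<^bsub>A\<^esub> ((\<one>\<^bsub>A\<^esub> \<ominus>\<^bsub>A\<^esub> t) \<otimes>\<^bsub>A\<^esub> mon 1 x 0)" by simp
    have KT: "?K \<otimes>\<^bsub>A Quot I\<^esub> (r \<otimes>\<^bsub>A Quot I\<^esub> pth x 0) =
      (\<one>\<^bsub>A Quot I\<^esub> \<ominus>\<^bsub>A Quot I\<^esub> ?T) \<otimes>\<^bsub>A Quot I\<^esub> pth x 0"
      using eq r0 p0 f(1) t e by (simp add: A.minus_eq quot.minus_eq)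
    have c: "?K \<in> carrier (A Quot I)" "?T \<in> carrier (A Quot I)" "pth x 0 \<in> carrier (A Quot I)"
      "r \<otimes>\<^bsub>A Quot I\<^esub> pth x 0 \<in> carrier (A Quot I)"
      using proj.hom_closed[OF e] proj.hom_closed[OF t(1)] r by (simp_all add: p0)
    have "(u \<otimes>\<^bsub>A Quot I\<^esub> ?K) \<otimes>\<^bsub>A Quot I\<^esub> (r \<otimes>\<^bsub>A Quot I\<^esub> pth x 0) =
      u \<otimes>\<^bsub>A Quot I\<^esub> ((\<one>\<^bsub>A Quot I\<^esub> \<ominus>\<^bsub>A Quot I\<^esub> ?T) \<otimes>\<^bsub>A Quot I\<^esub> pth x 0)"
      using KT quot.m_assoc[OF u(1) c(1,4)] by simp
    also have "\<dots> = (u \<otimes>\<^bsub>A Quot I\<^esub> (\<one>\<^bsub>A Quot I\<^esub> \<ominus>\<^bsub>A Quot I\<^esub> ?T)) \<otimes>\<^bsub>A Quot I\<^esub> pth x 0"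
      using quot.m_assoc[OF u(1) _ c(3), of "\<one>\<^bsub>A Quot I\<^esub> \<ominus>\<^bsub>A Quot I\<^esub> ?T"] c(2) by simp
    also have "\<dots> = pth x 0" using u(2) c(3) by simp
    finally show ?thesis using quot.m_closed[OF u(1) c(1)] by blast
  qed
qed

text \<open>The coefficient of the trivial path tells the sides apart: it is 0 on the left, 1 on the
  right, and 0 on \<open>I\<close>, whose elements involve only paths with at least two
  arrows.\<close>

lemma pth_proper:
  assumes x: "x \<in> verts Q" and s: "s \<in> carrier (A Quot I)"
  shows "s \<otimes>\<^bsub>A Quot I\<^esub> pth x 1 \<noteq> pth x 0"
proof
  assume eq: "s \<otimes>\<^bsub>A Quot I\<^esub> pth x 1 = pth x 0"
  obtain f where f: "f \<in> carrier A" "s = I +>\<^bsub>A\<^esub> f" using s by (rule quot_carrierE)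
  define a where "a = (if valid x 1 then mon 1 x 1 else \<zero>\<^bsub>A\<^esub>)"
  have a: "a \<in> carrier A" unfolding a_def by (rule pth_arg_closed)
  have e: "mon 1 x 0 \<in> carrier A" using x by (simp add: mon_closed)
  have p1: "pth x 1 = I +>\<^bsub>A\<^esub> a" and p0: "pth x 0 = I +>\<^bsub>A\<^esub> mon 1 x 0"
    using x by (simp_all add: pth_def a_def)
  have "I +>\<^bsub>A\<^esub> (f \<otimes>\<^bsub>A\<^esub> a) = I +>\<^bsub>A\<^esub> mon 1 x 0"
    using eq proj.hom_mult[OF f(1) a] unfolding f(2) p1 p0 by (simp only:)
  then have "I +>\<^bsub>A\<^esub> (f \<otimes>\<^bsub>A\<^esub> a \<ominus>\<^bsub>A\<^esub> mon 1 x 0) = \<zero>\<^bsub>A Quot I\<^esub>"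
    using f a e by (simp add: A.minus_eq quot.r_neg)
  then have mem: "f \<otimes>\<^bsub>A\<^esub> a \<ominus>\<^bsub>A\<^esub> mon 1 x 0 \<in> I" using coset_eq_zero_iff f a e by simp
  have "f \<otimes>\<^bsub>A\<^esub> a = (f \<otimes>\<^bsub>A\<^esub> a \<ominus>\<^bsub>A\<^esub> mon 1 x 0) \<oplus>\<^bsub>A\<^esub> mon 1 x 0" using f a e by (simp add: A.minus_eq A.a_assoc A.l_neg)
  then have "(f \<otimes>\<^bsub>A\<^esub> a) (x, []) = (f \<otimes>\<^bsub>A\<^esub> a \<ominus>\<^bsub>A\<^esub> mon 1 x 0) (x, []) + mon 1 x 0 (x, [])"
    by (metis add_eq)
  moreover have "(f \<otimes>\<^bsub>A\<^esub> a) (x, []) = 0" by (auto simp: mult_eq a_def mon_def zero_eq arrs_Suc)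
  ultimately have "(f \<otimes>\<^bsub>A\<^esub> a \<ominus>\<^bsub>A\<^esub> mon 1 x 0) (x, arrs x 0) \<noteq> 0" by (auto simp: mon_def)
  from I_support_ge_2[OF mem this] show False by simp
qed

sublocale uni: uniserial_ring "A Quot I" "verts Q" \<sigma> len pth
proof
  show "finite (verts Q)" by (rule finite_verts)
  show "pth x i \<in> carrier (A Quot I)" if "x \<in> verts Q" for x i
    unfolding pth_def by (intro proj.hom_closed pth_arg_closed)
  show "pth y j \<otimes>\<^bsub>A Quot I\<^esub> pth x i = (if y = (\<sigma> ^^ i) x then pth x (i + j) else \<zero>\<^bsub>A Quot I\<^esub>)"
    if "x \<in> verts Q" "y \<in> verts Q" for x y i j
  proof -
    have "pth y j \<otimes>\<^bsub>A Quot I\<^esub> pth x i = I +>\<^bsub>A\<^esub> ((if valid y j then mon 1 y j else \<zero>\<^bsub>A\<^esub>) \<otimes>\<^bsub>A\<^esub>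
      (if valid x i then mon 1 x i else \<zero>\<^bsub>A\<^esub>))"
      unfolding pth_def by (rule proj.hom_mult[symmetric, OF pth_arg_closed pth_arg_closed])
    also have "(if valid y j then mon 1 y j else \<zero>\<^bsub>A\<^esub>) \<otimes>\<^bsub>A\<^esub> (if valid x i then mon 1 x i else \<zero>\<^bsub>A\<^esub>) =
      (if y = (\<sigma> ^^ i) x then (if valid x (i + j) then mon 1 x (i + j) else \<zero>\<^bsub>A\<^esub>) else \<zero>\<^bsub>A\<^esub>)"
      by (auto simp: mon_mult_mon mon_closed valid_add)
    finally show ?thesis by (simp add: pth_def)
  qed
  show "pth x i = \<zero>\<^bsub>A Quot I\<^esub> \<longleftrightarrow> len x \<le> i" if "x \<in> verts Q" for x i
  proof -
    have "pth x i = \<zero>\<^bsub>A Quot I\<^esub> \<longleftrightarrow> \<not> nz x i"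
      using coset_eq_zero_iff[OF pth_arg_closed, of x i] mon_I_iff[of x i] by (auto simp: pth_def nz_def)
    then show ?thesis by (simp add: nz_iff not_less)
  qed
  show "(\<sigma> ^^ i) x \<in> verts Q" if "x \<in> verts Q" "i < len x" for x i
    using that valid_end[of x i i] by (simp add: nz_iff[symmetric] nz_def)
  show "(\<Oplus>\<^bsub>A Quot I\<^esub>x\<in>verts Q. pth x 0) = \<one>\<^bsub>A Quot I\<^esub>"
  proof -
    have "(\<Oplus>\<^bsub>A Quot I\<^esub>x\<in>verts Q. pth x 0) = (\<Oplus>\<^bsub>A Quot I\<^esub>x\<in>verts Q. I +>\<^bsub>A\<^esub> mon 1 x 0)"
      by (rule quot.finsum_cong') (auto simp: pth_def mon_closed)
    also have "\<dots> = I +>\<^bsub>A\<^esub> (\<Oplus>\<^bsub>A\<^esub>x\<in>verts Q. mon 1 x 0)"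
      by (subst proj.hom_finsum) (auto simp: mon_closed comp_def)
    finally show ?thesis by (simp add: one_decomposition)
  qed
qed (rule pth_local pth_proper; assumption)+

subsection \<open>Hooks and denouements\<close>

text \<open>By \<open>G_antichain\<close> no shorter initial part of \<open>g\<close> contains a
  generator.\<close>

lemma len_hook:
  assumes g: "g \<in> G" shows "len (fst g) = length (snd g)"
proof -
  have "hit G (fst g) (length (snd g))" unfolding hit_def using g by (intro bexI[of _ g] exI[of _ 0]) auto
  then have "\<not> nz (fst g) (length (snd g))" by (simp add: nz_def)
  moreover have "nz (fst g) i" if i: "i < length (snd g)" for i
  proof -
    have "\<not> hit G (fst g) i"
    proof
      assume "hit G (fst g) i"
      then obtain g' j where g': "g' \<in> G" "fst g' = (\<sigma> ^^ j) (fst g)" "j + length (snd g') \<le> i"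
        unfolding hit_def by blast
      then have "g' = g" using G_antichain[OF g g'(1,2)] i by simp
      then show False using g'(3) i by simp
    qed
    then show ?thesis using valid_le[OF G_valid[OF g]] i by (simp add: nz_def)
  qed
  ultimately show ?thesis by (meson nz_iff less_irrefl linorder_neqE_nat)
qed

text \<open>Covers every proper subpath, not only initial ones: a generator inside it would be
  \<open>g\<close> itself, which does not fit.\<close>

lemma nz_proper_prefix: "g \<in> G \<Longrightarrow> j + i \<le> length (snd g) \<Longrightarrow> j + i < length (snd g) \<or> 0 < j \<Longrightarrow> nz ((\<sigma> ^^ j) (fst g)) i"
proof -
  assume g: "g \<in> G" and le: "j + i \<le> length (snd g)" and pr: "j + i < length (snd g) \<or> 0 < j"
  have "valid (fst g) (j + i)" by (rule valid_le[OF G_valid[OF g] le])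
  then have v: "valid ((\<sigma> ^^ j) (fst g)) i" by (simp add: valid_add)
  have "\<not> hit G ((\<sigma> ^^ j) (fst g)) i"
  proof
    assume "hit G ((\<sigma> ^^ j) (fst g)) i"
    then obtain g' k where g': "g' \<in> G" "fst g' = (\<sigma> ^^ k) ((\<sigma> ^^ j) (fst g))" "k + length (snd g') \<le> i"
      unfolding hit_def by blast
    have occ: "fst g' = (\<sigma> ^^ (j + k)) (fst g)" using g'(2) by (simp add: funpow_funpow)
    have "g' = g" using G_antichain[OF g g'(1) occ] g'(3) le by simp
    then show False using g'(3) le pr by auto
  qed
  then show ?thesis using v by (simp add: nz_def)
qed

text \<open>If \<open>g\<close> starts at \<open>x\<close>, then \<open>g\<close> without its first
  arrow is a nonzero path with len x - 1 arrows from \<open>\<sigma> x\<close>. If no generator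
  does, one that kills the path with \<open>len x\<close> arrows from \<open>x\<close> already lies
  in its part from \<open>\<sigma> x\<close>.\<close>

lemma len_step_iff:
  assumes x: "x \<in> verts Q" "2 \<le> len x"
  shows "len (\<sigma> x) = len x - 1 \<longleftrightarrow> \<not> (\<exists>g\<in>G. x = fst g)"
proof
  assume eq: "len (\<sigma> x) = len x - 1"
  show "\<not> (\<exists>g\<in>G. x = fst g)"
  proof
    assume "\<exists>g\<in>G. x = fst g"
    then obtain g where g: "g \<in> G" "x = fst g" by auto
    have "nz (\<sigma> x) (length (snd g) - 1)"
      using nz_proper_prefix[OF g(1), of 1 "length (snd g) - 1"] G_ge_2[OF g(1)] g(2) by simp
    then have "length (snd g) - 1 < len (\<sigma> x)" by (simp add: nz_iff)
    then show False using eq len_hook[OF g(1)] g(2) by simp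
  qed
next
  assume nohook: "\<not> (\<exists>g\<in>G. x = fst g)"
  have "\<not> nz (\<sigma> x) (len x - 1)"
  proof
    assume nz: "nz (\<sigma> x) (len x - 1)"
    have "nz x 1" using x(2) by (simp add: nz_iff)
    then have "valid x 1 \<and> valid ((\<sigma> ^^ 1) x) (len x - 1)" using nz by (simp add: nz_def)
    then have v: "valid x (1 + (len x - 1))" by (simp only: valid_add)
    have "\<not> nz x (len x)" by (simp add: nz_iff)
    then have "hit G x (len x)" using v x(2) by (simp add: nz_def)
    then obtain g j where g: "g \<in> G" "fst g = (\<sigma> ^^ j) x" "j + length (snd g) \<le> len x" unfolding hit_def by blast
    then obtain j' where j: "j = Suc j'" using nohook by (cases j) auto
    have "hit G (\<sigma> x) (len x - 1)" unfolding hit_def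
      using g j by (intro bexI[of _ g] exI[of _ j']) (auto simp: funpow_swap1)
    then show False using nz by (simp add: nz_def)
  qed
  then have "len (\<sigma> x) \<le> len x - 1" by (simp add: nz_iff)
  moreover have "len x - 1 \<le> len (\<sigma> x)" using uni.l_step[of x 1] x by simp
  ultimately show "len (\<sigma> x) = len x - 1" by simp
qed

section \<open>Vertices visited by a generator\<close>

lemma Hod_set: "g \<in> G \<Longrightarrow> set_mset (Hod Q g) = (\<lambda>k. (\<sigma> ^^ k) (fst g)) ` {..length (snd g)}"
  using awalk_verts_arrs[of "fst g" "length (snd g)"] G_arrs[of g]
  by (auto simp: Hod_def atLeast0LessThan lessThan_Suc_atMost simp del: upt_Suc)

lemma denouement_eq: "g \<in> G \<Longrightarrow> denouement Q g = (\<sigma> ^^ length (snd g)) (fst g)"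
  using path_end_arrs[of "fst g" "length (snd g)"] G_arrs[of g] by (simp add: denouement_def)

text \<open>One occurrence of each end is removed, so an end vertex that recurs inside stays;
  positions 1 to m - 1 are left.\<close>

lemma Intr_set: "g \<in> G \<Longrightarrow> set_mset (Intr Q g) = (\<lambda>k. (\<sigma> ^^ k) (fst g)) ` {0<..<length (snd g)}"
proof -
  assume g: "g \<in> G"
  define m where "m = length (snd g)"
  have m: "1 \<le> m" using G_ge_2[OF g] by (simp add: m_def)
  let ?f = "\<lambda>k. (\<sigma> ^^ k) (fst g)"
  have "[0..<Suc m] = 0 # [1..<m] @ [m]" using m by (simp add: upt_conv_Cons)
  then have "Hod Q g = mset (map ?f (0 # [1..<m] @ [m]))"
    using awalk_verts_arrs[of "fst g" m] G_arrs[OF g] by (simp add: Hod_def m_def)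
  then have "Hod Q g = {#?f 0#} + mset (map ?f [1..<m]) + {#?f m#}" by simp
  then have "Intr Q g = mset (map ?f [1..<m])"
    by (simp add: Intr_def hook_def denouement_eq[OF g] m_def)
  then show ?thesis by (auto simp: m_def)
qed

lemma denouement_X_iff:
  assumes g: "g \<in> G"
  shows "denouement Q g \<in> X_set Q G \<longleftrightarrow>
    (\<forall>g'\<in>G. \<forall>j. 0 < j \<and> j < length (snd g') \<longrightarrow> (\<sigma> ^^ length (snd g)) (fst g) \<noteq> (\<sigma> ^^ j) (fst g'))"
proof -
  let ?v = "(\<sigma> ^^ length (snd g)) (fst g)"
  have "?v \<in> X_set Q G \<longleftrightarrow> (\<forall>g'\<in>G. ?v \<notin> set_mset (Intr Q g'))"
    using valid_end[OF G_valid[OF g], of "length (snd g)"] by (simp add: X_set_def)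
  moreover have "?v \<notin> set_mset (Intr Q g') \<longleftrightarrow>
      (\<forall>j. 0 < j \<and> j < length (snd g') \<longrightarrow> ?v \<noteq> (\<sigma> ^^ j) (fst g'))" if "g' \<in> G" for g'
    unfolding Intr_set[OF that] by auto
  ultimately show ?thesis unfolding denouement_eq[OF g] by blast
qed

text \<open>As \<open>x\<close> is a hook, only the second disjunct of
  \<open>short_resolution\<close> matters: P(d) is as long as what remains of P(\<sigma> x) from
  \<open>d\<close> on. It is longer iff the shortest zero path from \<open>\<sigma> x\<close> is
  killed by a generator that begins before \<open>d\<close>, and such a generator has
  \<open>d\<close> in its interior.\<close>

lemma short_resolution_hook_iff:
  assumes g: "g \<in> G"
  shows "uni.short_resolution (fst g) \<longleftrightarrow> denouement Q g \<in> X_set Q G"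
proof -
  define x m d where "x = fst g" and "m = length (snd g)" and "d = (\<sigma> ^^ m) x"
  have m: "2 \<le> m" "len x = m" using G_ge_2[OF g] len_hook[OF g] by (simp_all add: m_def x_def)
  have x: "x \<in> verts Q" using valid_vert[OF G_valid[OF g]] by (simp add: x_def)
  have vx: "valid x m" using G_valid[OF g] by (simp add: x_def m_def)
  have ne: "len (\<sigma> x) \<noteq> m - 1" using len_step_iff[OF x] m g by (auto simp: x_def)
  then have Lm: "m - 1 < len (\<sigma> x)" using uni.l_step[of x 1] x m by simp
  have sr: "uni.short_resolution x \<longleftrightarrow> len d = len (\<sigma> x) - (m - 1)"
    using ne m by (simp add: uni.short_resolution_def d_def)
  have y: "\<sigma> x \<in> verts Q" using uni.\<sigma>_closed[OF x] m by simp
  have dy: "d = (\<sigma> ^^ (m - 1)) (\<sigma> x)"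
    using m funpow_Suc_right[of "m - 1" \<sigma>] by (simp add: d_def)
  have ge: "len (\<sigma> x) - (m - 1) \<le> len d" using uni.l_step[OF y Lm] dy by simp
  show ?thesis
    unfolding x_def[symmetric] sr denouement_X_iff[OF g]
  proof
    assume eq: "len d = len (\<sigma> x) - (m - 1)"
    show "\<forall>g'\<in>G. \<forall>j. 0 < j \<and> j < length (snd g') \<longrightarrow> (\<sigma> ^^ length (snd g)) x \<noteq> (\<sigma> ^^ j) (fst g')"
    proof (intro ballI allI impI notI)
      fix g' j assume g': "g' \<in> G" and j: "0 < j \<and> j < length (snd g')"
        and dj: "(\<sigma> ^^ length (snd g)) x = (\<sigma> ^^ j) (fst g')"
      define m' where "m' = length (snd g')"
      have vj: "valid (fst g') j" using valid_le[OF G_valid[OF g']] j by simp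
      \<comment> \<open>Otherwise \<open>g\<close> would lie within \<open>g'\<close>, ending at
        position \<open>j\<close>.\<close>
      have "j < m"
      proof (rule ccontr)
        assume "\<not> j < m"
        then have "x = (\<sigma> ^^ (j - m)) (fst g')"
          using funpow_eq_backward[OF vj vx] dj by (simp add: m_def)
        then have "g = g'" using G_antichain[OF g' g, of "j - m"] j \<open>\<not> j < m\<close> by (simp add: x_def m_def)
        then show False using j \<open>\<not> j < m\<close> by (simp add: m_def)
      qed
      then have h': "fst g' = (\<sigma> ^^ (m - j)) x"
        using funpow_eq_backward[OF vx vj] dj by (simp add: m_def)
      \<comment> \<open>\<open>d\<close> comes m - 1 arrows after \<open>\<sigma> x\<close>, and
        \<open>g'\<close> ends m' - j arrows after \<open>d\<close>. The path from
        \<open>\<sigma> x\<close> up to there is zero, but its part from \<open>d\<close> on is a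
        proper subpath of \<open>g'\<close> and so nonzero.\<close>
      have "hit G (\<sigma> x) (m - 1 + (m' - j))"
        unfolding hit_def
      proof (intro bexI[OF _ g'] exI[of _ "m - j - 1"] conjI)
        have "1 + (m - j - 1) = m - j" using \<open>j < m\<close> by simp
        moreover have "(\<sigma> ^^ 1) x = \<sigma> x" by simp
        ultimately show "fst g' = (\<sigma> ^^ (m - j - 1)) (\<sigma> x)"
          using h' funpow_funpow[of "m - j - 1" 1 x] by metis
        show "m - j - 1 + length (snd g') \<le> m - 1 + (m' - j)" using \<open>j < m\<close> j by (simp add: m'_def)
      qed
      then have "\<not> nz (\<sigma> x) (m - 1 + (m' - j))" by (simp add: nz_def)
      then have "len (\<sigma> x) \<le> m - 1 + (m' - j)" by (simp add: nz_iff)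
      moreover have "nz ((\<sigma> ^^ j) (fst g')) (m' - j)"
        using nz_proper_prefix[OF g', of j "m' - j"] j by (simp add: m'_def)
      then have "m' - j < len d" using dj by (simp add: nz_iff d_def m_def)
      ultimately show False using eq by simp
    qed
  next
    assume X: "\<forall>g'\<in>G. \<forall>j. 0 < j \<and> j < length (snd g') \<longrightarrow> (\<sigma> ^^ length (snd g)) x \<noteq> (\<sigma> ^^ j) (fst g')"
    show "len d = len (\<sigma> x) - (m - 1)"
    proof (rule ccontr)
      assume "len d \<noteq> len (\<sigma> x) - (m - 1)"
      \<comment> \<open>Paths from \<open>\<sigma> x\<close> become zero at \<open>L\<close> arrows,
        \<open>k\<close> of them after \<open>d\<close>; by assumption \<open>k\<close> arrows from
        \<open>d\<close> are still nonzero.\<close>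
      define L k where "L = len (\<sigma> x)" and "k = L - (m - 1)"
      have k: "k < len d" "L = m - 1 + k" using ge Lm \<open>len d \<noteq> _\<close> by (simp_all add: k_def L_def)
      have nzd: "nz d k" using k by (simp add: nz_iff)
      have "valid (\<sigma> x) (m - 1)" using vx valid_add[of x 1 "m - 1"] m by simp
      then have v: "valid (\<sigma> x) L" using nzd dy k(2) by (simp add: valid_add nz_def)
      have "\<not> nz (\<sigma> x) L" by (simp add: nz_iff L_def)
      then have "hit G (\<sigma> x) L" using v by (simp add: nz_def)
      then obtain g' t where g': "g' \<in> G" "fst g' = (\<sigma> ^^ t) (\<sigma> x)" "t + length (snd g') \<le> L"
        unfolding hit_def by blast
      have "t < m - 1"
      proof (rule ccontr)
        assume t: "\<not> t < m - 1"
        have "fst g' = (\<sigma> ^^ (t - (m - 1))) d" using g'(2) t by (simp add: dy funpow_funpow)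
        moreover have "t - (m - 1) + length (snd g') \<le> k" using g'(3) t k(2) by simp
        ultimately have "hit G d k" unfolding hit_def using g'(1) by blast
        then show False using nzd by (simp add: nz_def)
      qed
      \<comment> \<open>By minimality of \<open>L\<close> the generator \<open>g'\<close> ends no
        earlier than the whole path, hence strictly after \<open>d\<close>.\<close>
      have "L \<le> t + length (snd g')"
      proof (rule ccontr)
        assume "\<not> L \<le> t + length (snd g')"
        then have "hit G (\<sigma> x) (L - 1)" unfolding hit_def using g' by (intro bexI[of _ g'] exI[of _ t]) auto
        moreover have "nz (\<sigma> x) (L - 1)" using Lm by (simp add: nz_iff L_def)
        ultimately show False by (simp add: nz_def)
      qed
      then have "0 < m - 1 - t \<and> m - 1 - t < length (snd g')" using \<open>t < m - 1\<close> Lm by (auto simp: L_def)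
      moreover have "(\<sigma> ^^ length (snd g)) x = (\<sigma> ^^ (m - 1 - t)) (fst g')"
        using \<open>t < m - 1\<close> dy by (simp add: g'(2) funpow_funpow d_def[symmetric] m_def[symmetric])
      ultimately show False using X g'(1) by blast
    qed
  qed
qed

text \<open>\<open>covers\<close> expresses that a path with its end vertex in its interior has gone
  around the whole quiver. It handles a generator that overlaps itself; distinct overlapping
  generators are aligned with \<open>funpow_eq_backward\<close> and kept from containing each other
  by \<open>G_antichain\<close>.\<close>

lemma Hod_Int_iff:
  assumes covers: "\<And>h m j. \<lbrakk>valid h m; (\<sigma> ^^ m) h = (\<sigma> ^^ j) h; 0 < j; j < m\<rbrakk> \<Longrightarrow>
      n < m \<and> verts Q \<subseteq> (\<lambda>k. (\<sigma> ^^ k) h) ` {0<..<m}"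
    and single: "\<forall>g. G = {g} \<longrightarrow> path_length g \<le> n + 1"
  shows "(\<exists>g\<in>G. denouement Q g \<notin> X_set Q G) \<longleftrightarrow>
    (\<Union>g\<in>G. \<Union>g'\<in>G - {g}. set_mset (Hod Q g \<inter># Intr Q g')) \<noteq> {}"
proof
  assume "\<exists>g\<in>G. denouement Q g \<notin> X_set Q G"
  then obtain g g' j where g: "g \<in> G" and g': "g' \<in> G" and j: "0 < j" "j < length (snd g')"
    and eq: "(\<sigma> ^^ length (snd g)) (fst g) = (\<sigma> ^^ j) (fst g')" using denouement_X_iff by blast
  have mem: "(\<sigma> ^^ length (snd g)) (fst g) \<in> set_mset (Hod Q g)" using Hod_set[OF g] by auto
  show "(\<Union>g\<in>G. \<Union>g'\<in>G - {g}. set_mset (Hod Q g \<inter># Intr Q g')) \<noteq> {}"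
  proof (cases "g' = g")
    case False
    have "(\<sigma> ^^ length (snd g)) (fst g) \<in> set_mset (Intr Q g')" using Intr_set[OF g'] eq j by auto
    then show ?thesis using mem g g' False by (auto simp: set_mset_inter)
  next
    case True
    \<comment> \<open>\<open>g\<close> overlaps itself. It is too long to be the only generator, and
      the hook of any other one lies in its interior.\<close>
    have c: "n < length (snd g)" "verts Q \<subseteq> (\<lambda>k. (\<sigma> ^^ k) (fst g)) ` {0<..<length (snd g)}"
      using covers[OF G_valid[OF g], of j] eq j True by auto
    have "G \<noteq> {g}"
    proof
      assume "G = {g}"
      then have "path_length g \<le> n + 1" using single by blast
      then show False using c(1) by (simp add: path_length_def)
    qed
    then obtain f where f: "f \<in> G" "f \<noteq> g" using g by blast
    have "fst f \<in> set_mset (Hod Q f)" using Hod_set[OF f(1)] by (auto intro: image_eqI[of _ _ 0])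
    moreover have "fst f \<in> set_mset (Intr Q g)"
      using c(2) valid_vert[OF G_valid[OF f(1)]] Intr_set[OF g] by auto
    ultimately show ?thesis using f g by (auto simp: set_mset_inter)
  qed
next
  assume "(\<Union>g\<in>G. \<Union>g'\<in>G - {g}. set_mset (Hod Q g \<inter># Intr Q g')) \<noteq> {}"
  then obtain g g' v where g: "g \<in> G" and g'': "g' \<in> G - {g}" and v': "v \<in># Hod Q g \<inter># Intr Q g'" by blast
  have g': "g' \<in> G" "g' \<noteq> g" and v: "v \<in># Hod Q g" "v \<in># Intr Q g'"
    using g'' v' by (simp_all add: set_mset_inter)
  define m m' where "m = length (snd g)" and "m' = length (snd g')"
  obtain i where i: "i \<le> m" "v = (\<sigma> ^^ i) (fst g)" using v(1) Hod_set[OF g] by (auto simp: m_def)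
  obtain j where j: "0 < j" "j < m'" "v = (\<sigma> ^^ j) (fst g')" using v(2) Intr_set[OF g'(1)] by (auto simp: m'_def)
  have vi: "valid (fst g) i" and vj: "valid (fst g') j"
    using valid_le[OF G_valid[OF g]] valid_le[OF G_valid[OF g'(1)]] i j by (auto simp: m_def m'_def)
  show "\<exists>g\<in>G. denouement Q g \<notin> X_set Q G"
  proof (cases "j \<le> i")
    case True
    have h: "fst g' = (\<sigma> ^^ (i - j)) (fst g)" using funpow_eq_backward[OF vi vj _ True] i j by simp
    \<comment> \<open>\<open>g'\<close> starts i - j arrows after \<open>g\<close> and is not
      contained in it, so the denouement of \<open>g\<close> is at position m - (i - j) of
      \<open>g'\<close>.\<close>
    have "\<not> i - j + m' \<le> m" using G_antichain[OF g g'(1) h] g'(2) by (auto simp: m_def m'_def)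
    then have k: "0 < m - (i - j)" "m - (i - j) < m'" using i j True by auto
    have "(\<sigma> ^^ m) (fst g) = (\<sigma> ^^ (m - (i - j))) (fst g')" using i True by (simp add: h funpow_funpow)
    then have "denouement Q g \<notin> X_set Q G"
      unfolding denouement_X_iff[OF g] using k g'(1) unfolding m_def m'_def by blast
    then show ?thesis using g by blast
  next
    case False
    have h: "fst g = (\<sigma> ^^ (j - i)) (fst g')" using funpow_eq_backward[OF vj vi] i j False by simp
    have "\<not> j - i + m \<le> m'" using G_antichain[OF g'(1) g h] g'(2) by (auto simp: m_def m'_def)
    then have k: "0 < m' - (j - i)" "m' - (j - i) < m" using i j False by auto
    have "(\<sigma> ^^ m') (fst g') = (\<sigma> ^^ (m' - (j - i))) (fst g)" using j False by (simp add: h funpow_funpow)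
    then have "denouement Q g' \<notin> X_set Q G"
      unfolding denouement_X_iff[OF g'(1)] using k g unfolding m_def m'_def by blast
    then show ?thesis using g'(1) by blast
  qed
qed

section \<open>Projective dimension of the simple modules and global dimension\<close>

lemma proj_dim_simple:
  assumes x: "x \<in> verts Q" and S: "simple_at Q I x S"
    and np: "\<not> projective_module (bound_quiver_algebra Q I) S"
  shows "proj_dim (bound_quiver_algebra Q I) S = 1 \<longleftrightarrow> \<not> (\<exists>g\<in>G. x = hook g)"
    and "proj_dim (bound_quiver_algebra Q I) S = 2 \<longleftrightarrow> (\<exists>g\<in>G. x = hook g \<and> denouement Q g \<in> X_set Q G)"
proof -
  have R: "bound_quiver_algebra Q I = A Quot I" by (simp add: bound_quiver_algebra_def A_def)
  obtain v where v: "v \<in> carrier S" "pth x 0 \<odot>\<^bsub>S\<^esub> v \<noteq> \<zero>\<^bsub>S\<^esub>" and simple: "simple_left_module (A Quot I) S"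
    using S path_elem_mon[of x 0] x unfolding simple_at_def R A_def[symmetric] pth_def by auto
  obtain e where e: "uni.simple_cover x S e" by (rule uni.simple_module_cover[OF x simple v])
  \<comment> \<open>For \<open>len x < 2\<close> the radical of P(x) is zero, and the simple module
    would be projective.\<close>
  have len2: "2 \<le> len x" using uni.simple_cover_projective[OF x _ e] np R by (cases "len x < 2") auto
  note le = proj_dim_le_iff[OF uni.simple_coverD(1)[OF e]]
  have d0: "\<not> proj_dim (A Quot I) S \<le> enat 0" unfolding le using np by (simp add: R)
  have d1: "proj_dim (A Quot I) S \<le> enat 1 \<longleftrightarrow> \<not> (\<exists>g\<in>G. x = hook g)"
    unfolding le uni.pd_le_1_iff[OF x len2 e] len_step_iff[OF x len2] by (simp add: hook_def)
  have d2: "proj_dim (A Quot I) S \<le> enat 2 \<longleftrightarrow> uni.short_resolution x"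
    unfolding le uni.pd_le_2_iff[OF x len2 e] ..
  have "d = 1 \<longleftrightarrow> d \<le> enat 1 \<and> \<not> d \<le> enat 0" "d = 2 \<longleftrightarrow> d \<le> enat 2 \<and> \<not> d \<le> enat 1" for d :: enat
    by (cases d; auto simp: one_enat_def numeral_eq_enat)+
  note split = this
  show "proj_dim (bound_quiver_algebra Q I) S = 1 \<longleftrightarrow> \<not> (\<exists>g\<in>G. x = hook g)"
    unfolding R split(1) using d0 d1 by simp
  show "proj_dim (bound_quiver_algebra Q I) S = 2 \<longleftrightarrow> (\<exists>g\<in>G. x = hook g \<and> denouement Q g \<in> X_set Q G)"
    \<comment> \<open>Vertices that are not hooks satisfy \<open>short_resolution\<close> by its
      first disjunct; \<open>d1\<close> removes them.\<close>
    unfolding R split(2) d1 d2 using short_resolution_hook_iff by (auto simp: hook_def)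
qed

text \<open>If \<open>short_resolution\<close> holds at all vertices with \<open>len\<close> at
  least 2, \<open>pd_le_2_all\<close> bounds every finitely generated module; otherwise the simple
  module at a failing vertex exceeds 2. Such a vertex is a hook, because at the others the first
  disjunct holds.\<close>

lemma gl_dim_ge_3_iff:
  "gl_dim (bound_quiver_algebra Q I) \<ge> 3 \<longleftrightarrow> (\<exists>g\<in>G. denouement Q g \<notin> X_set Q G)"
proof -
  have R: "bound_quiver_algebra Q I = A Quot I" by (simp add: bound_quiver_algebra_def A_def)
  have "3 \<le> d \<longleftrightarrow> \<not> d \<le> enat 2" for d :: enat by (cases d) (auto simp: numeral_eq_enat)
  then have "gl_dim (A Quot I) \<ge> 3 \<longleftrightarrow>
      (\<exists>M :: ((nat, nat) qpath \<Rightarrow> 'k) set lmod. fg_left_module (A Quot I) M \<and> \<not> proj_dim (A Quot I) M \<le> enat 2)"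
    unfolding gl_dim_def by (auto simp: Sup_le_iff)
  also have "\<dots> \<longleftrightarrow> (\<exists>M :: ((nat, nat) qpath \<Rightarrow> 'k) set lmod. fg_left_module (A Quot I) M \<and> \<not> pd_le (A Quot I) 2 M)"
    using proj_dim_le_iff[OF fg_left_module_D, of "A Quot I"] by blast
  also have "\<dots> \<longleftrightarrow> (\<exists>g\<in>G. denouement Q g \<notin> X_set Q G)"
  proof
    assume "\<exists>M :: ((nat, nat) qpath \<Rightarrow> 'k) set lmod. fg_left_module (A Quot I) M \<and> \<not> pd_le (A Quot I) 2 M"
    then obtain x where x: "x \<in> verts Q" "2 \<le> len x" "\<not> uni.short_resolution x"
      using uni.pd_le_2_all by blast
    then have "\<exists>g\<in>G. x = fst g" using len_step_iff[OF x(1,2)] by (auto simp: uni.short_resolution_def)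
    then show "\<exists>g\<in>G. denouement Q g \<notin> X_set Q G" using x(3) short_resolution_hook_iff by blast
  next
    assume "\<exists>g\<in>G. denouement Q g \<notin> X_set Q G"
    then obtain g where g: "g \<in> G" "\<not> uni.short_resolution (fst g)" using short_resolution_hook_iff by blast
    have x: "fst g \<in> verts Q" "2 \<le> len (fst g)"
      using valid_vert[OF G_valid[OF g(1)]] len_hook[OF g(1)] G_ge_2[OF g(1)] by auto
    obtain M e where M: "uni.simple_cover (fst g) M e" by (rule uni.simple_cover_exists[OF x(1)])
    show "\<exists>M :: ((nat, nat) qpath \<Rightarrow> 'k) set lmod. fg_left_module (A Quot I) M \<and> \<not> pd_le (A Quot I) 2 M"
      using uni.pd_le_2_iff[OF x M] uni.simple_cover_fg[OF x(1) M] g(2) by blast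
  qed
  finally show ?thesis by (simp add: R)
qed

end

section \<open>Linear and cyclic quivers\<close>

lemma arrow_quiver_linear: "arrow_quiver (linear_quiver n)"
  by unfold_locales (auto simp: linear_quiver_def inj_on_def)

lemma arrow_quiver_cyclic: "arrow_quiver (cyclic_quiver n)"
  by unfold_locales (auto simp: cyclic_quiver_def inj_on_def split: if_splits)

lemma linear_quiver_funpow: "(head (linear_quiver n) ^^ k) x = x + k"
  by (induction k) (auto simp: linear_quiver_def)

text \<open>Vertices are numbered from 1, so residues are formed after subtracting 1.\<close>

lemma cyclic_quiver_funpow:
  assumes "x \<in> {1..n}" shows "(head (cyclic_quiver n) ^^ k) x = (x - 1 + k) mod n + 1"
proof (induction k)
  case 0
  then show ?case using assms by auto
next
  case (Suc k)
  have "n > 0" using assms by auto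
  then show ?case using Suc by (auto simp: cyclic_quiver_def mod_Suc)
qed

text \<open>Only the cyclic quiver lets a vertex recur. There \<open>m\<close> and \<open>j\<close>
  differ by a multiple of \<open>n\<close>, and j > 0, so m > n: the interior positions include 1 to
  n and hence all vertices.\<close>

lemma repeated_vertex_covers:
  assumes Q: "Q = linear_quiver n \<or> Q = cyclic_quiver n"
    and h: "h \<in> verts Q" and rep: "(head Q ^^ m) h = (head Q ^^ j) h" and j: "0 < j" "j < m"
  shows "n < m \<and> verts Q \<subseteq> (\<lambda>k. (head Q ^^ k) h) ` {0<..<m}"
proof -
  have "Q \<noteq> linear_quiver n" using rep j by (auto simp: linear_quiver_funpow)
  then have Q: "Q = cyclic_quiver n" using Q by simp
  then have h: "h \<in> {1..n}" and V: "verts Q = {1..n}" using h by (auto simp: cyclic_quiver_def)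
  note fp = cyclic_quiver_funpow[OF h, folded Q]
  have "(h - 1 + m) mod n = (h - 1 + j) mod n" using rep fp by simp
  then have "n dvd (h - 1 + m) - (h - 1 + j)" using j by (metis mod_eq_dvd_iff_nat nat_add_left_cancel_le less_imp_le)
  then have "n dvd m - j" by simp
  then have "n \<le> m - j" using j by (simp add: dvd_imp_le)
  then have n: "n < m" using j by simp
  have "v \<in> (\<lambda>k. (head Q ^^ k) h) ` {0<..<m}" if v: "v \<in> {1..n}" for v
  proof
    \<comment> \<open>The number of arrows from \<open>h\<close> to \<open>v\<close>, with
      \<open>n\<close> in place of 0 for v = h, since position 0 is not interior.\<close>
    define k where "k = (if h < v then v - h else v + n - h)"
    show "k \<in> {0<..<m}" using h v n by (auto simp: k_def)
    have "(h - 1 + k) mod n = v - 1"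
    proof (cases "h < v")
      case True
      then have "h - 1 + k = v - 1" using h by (simp add: k_def)
      then show ?thesis using v by auto
    next
      case False
      then have "h - 1 + k = v - 1 + n" using h v by (auto simp: k_def)
      moreover have "(v - 1 + n) mod n = v - 1" unfolding mod_add_self2 using v by auto
      ultimately show ?thesis by (simp only:)
    qed
    then show "v = (head Q ^^ k) h" using fp v by simp
  qed
  then show ?thesis using n V by auto
qed

theorem proposition2p2:
  fixes n :: nat and x :: nat
    and Q :: "(nat, nat) pre_digraph"
    and I :: "((nat, nat) qpath \<Rightarrow> 'k::alg_closed_field) set"
    and G :: "(nat, nat) qpath set"
    and S :: "((nat, nat) qpath \<Rightarrow> 'k) set lmod"
  assumes "n \<ge> 2"
    and "Q = linear_quiver n \<or> Q = cyclic_quiver n"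
    and "admissible_ideal Q I"
    and "minimal_path_generators Q I G"
    and "x \<in> verts Q"
    and "simple_at Q I x S"
    and "\<not> projective_module (bound_quiver_algebra Q I) S"
  shows "(proj_dim (bound_quiver_algebra Q I) S = 1 \<longleftrightarrow> \<not> (\<exists>g\<in>G. x = hook g))
       \<and> (proj_dim (bound_quiver_algebra Q I) S = 2 \<longleftrightarrow>
            (\<exists>g\<in>G. x = hook g \<and> denouement Q g \<in> X_set Q G))
       \<and> ((\<forall>g. G = {g} \<longrightarrow> path_length g \<le> n + 1) \<longrightarrow>
            (gl_dim (bound_quiver_algebra Q I) \<ge> 3 \<longleftrightarrow>
             (\<Union>g\<in>G. \<Union>g'\<in>G - {g}. set_mset (Hod Q g \<inter># Intr Q g')) \<noteq> {}))"
proof -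
  have "arrow_quiver Q" using assms(2) arrow_quiver_linear arrow_quiver_cyclic by auto
  moreover have "ring (path_algebra Q :: ((nat, nat) qpath \<Rightarrow> 'k) ring)"
    using assms(3) by (simp add: admissible_ideal_def ideal_def)
  ultimately interpret nakayama Q "path_algebra Q :: ((nat, nat) qpath \<Rightarrow> 'k) ring" I G
    using assms(3,4) by (simp add: nakayama_def nakayama_axioms_def path_alg_def path_alg_axioms_def)
  have "gl_dim (bound_quiver_algebra Q I) \<ge> 3 \<longleftrightarrow>
      (\<Union>g\<in>G. \<Union>g'\<in>G - {g}. set_mset (Hod Q g \<inter># Intr Q g')) \<noteq> {}"
    if single: "\<forall>g. G = {g} \<longrightarrow> path_length g \<le> n + 1"
    unfolding gl_dim_ge_3_iff
    by (rule Hod_Int_iff[OF repeated_vertex_covers[OF assms(2) valid_vert] single])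
  then show ?thesis using proj_dim_simple[OF assms(5-7)] by blast
qed

end
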